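(* Let $q\ge 1$ be an integer, let $H_1,H_2\in(1/2,1)$, and let $(\gamma_N)_{N\ge1}$ be an arbitrary sequence of positive real numbers. Put $t_i=\gamma_N i$. Let $Z^{H_1,q}$ and $Z^{H_2,q+1}$ be Hermite processes built from a Brownian motion $B$, and let $\tilde Z^{H_2,q+1}$ be an independent copy of $Z^{H_2,q+1}$ (independent also of $Z^{H_1,q}$). Define $$\tilde V_N^{(3)}=\sum_{i=0}^{N-1}\left(Z^{H_1,q}_{t_{i+1}}-Z^{H_1,q}_{t_i}\right)\left(\tilde Z^{H_2,q+1}_{t_{i+1}}-\tilde Z^{H_2,q+1}_{t_i}\right)$$ and, for $j=1,2$, $\sigma_N^{(j)}=(\mathbb{E}[(V_N^{(j)})^2])^{1/2}$, where $$V_N^{(1)}=\sum_{i=0}^{N-1}\left[\left(Z^{H_1,q}_{t_{i+1}}-Z^{H_1,q}_{t_i}\right)^2-\mathbb{E}\left(Z^{H_1,q}_{t_{i+1}}-Z^{H_1,q}_{t_i}\right)^2\right],$$ $$V_N^{(2)}=\sum_{i=0}^{N-1}\left[\left(Z^{H_2,q+1}_{t_{i+1}}-Z^{H_2,q+1}_{t_i}\right)^2-\mathbb{E}\left(Z^{H_2,q+1}_{t_{i+1}}-Z^{H_2,q+1}_{t_i}\right)^2\right].$$ Then, as $N\to\infty$, $$\mathbb{E}\left[\left(\tilde V_N^{(3)}\right)^2\right]=o\left(\sigma_N^{(1)}\,\sigma_N^{(2)}\right).$$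
   Context: Let $B$ be a standard Brownian motion on $\mathbb{R}$. For $f\in L^2(\mathbb{R}^n)$, $I_n(f)$ denotes the multiple Wiener–Itô integral of order $n$ of $f$ with respect to $B$ (diagonals excluded, $I_n(f)=I_n(\tilde f)$ with $\tilde f$ the symmetrization of $f$, $\mathbb{E}[I_n(f)^2]=n!\|\tilde f\|_2^2$). For an integer $q\ge1$ and $H\in(1/2,1)$, the Hermite process of order $q$ and index $H$ is $$Z^{H,q}_t=c(H,q)\,I_q(L_t^{H,q}),\qquad L_t^{H,q}(y_1,\dots,y_q)=\int_0^t\prod_{\ell=1}^q(u-y_\ell)_+^{-\left(\frac12+\frac{1-H}{q}\right)}\,du,\qquad t\ge0,$$ with $c(H,q)=(q!\|L_1^{H,q}\|_2^2)^{-1/2}$, so that $\mathbb{E}[(Z_t^{H,q})^2]=t^{2H}$. *)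

theory Defs
  imports "HOL-Probability.Probability" "HOL-Library.Landau_Symbols"
begin

section \<open>Two-sided Brownian motion\<close>

locale brownian_motion = prob_space M for M :: "'w measure" +
  fixes B :: "real \<Rightarrow> 'w \<Rightarrow> real"
  assumes measurable_B: "\<And>t. B t \<in> borel_measurable M"
    and B_zero: "AE \<omega> in M. B 0 \<omega> = 0"
    and normal_increments: "\<And>s t. s < t \<Longrightarrow>
      distributed M lborel (\<lambda>\<omega>. B t \<omega> - B s \<omega>) (normal_density 0 (sqrt (t - s)))"
    and indep_increments: "\<And>(n::nat) \<tau>. strict_mono_on {..n} \<tau> \<Longrightarrow>
      indep_vars (\<lambda>_. borel) (\<lambda>i \<omega>. B (\<tau> (Suc i)) \<omega> - B (\<tau> i) \<omega>) {..<n}"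
    and continuous_paths: "AE \<omega> in M. continuous_on UNIV (\<lambda>t. B t \<omega>)"

section \<open>Multiple Wiener--Ito integrals\<close>

definition square_integrable :: "'a measure \<Rightarrow> ('a \<Rightarrow> real) \<Rightarrow> bool" where
  "square_integrable M f \<longleftrightarrow> f \<in> borel_measurable M \<and> integrable M (\<lambda>x. (f x)\<^sup>2)"

definition L2_tendsto :: "'a measure \<Rightarrow> (nat \<Rightarrow> 'a \<Rightarrow> real) \<Rightarrow> ('a \<Rightarrow> real) \<Rightarrow> bool" where
  "L2_tendsto M F f \<longleftrightarrow>
     (\<forall>k. square_integrable M (F k)) \<and> square_integrable M f \<and>
     (\<lambda>k. \<integral>x. (F k x - f x)\<^sup>2 \<partial>M) \<longlonglongrightarrow> 0"

text \<open>Points of \<open>\<real>\<^sup>n\<close> are elements of \<open>{..<n} \<rightarrow>\<^sub>E UNIV\<close>.\<close>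

abbreviation lborel_pow :: "nat \<Rightarrow> (nat \<Rightarrow> real) measure" where
  "lborel_pow n \<equiv> Pi\<^sub>M {..<n} (\<lambda>_. lborel)"

text \<open>
  An elementary integrand is given by a grid \<open>s 0 < \<dots> < s m\<close> and coefficients \<open>a i\<close> for the
  multi-indices \<open>i\<close> in \<open>{..<n} \<rightarrow>\<^sub>E {..<m}\<close>; it takes the value \<open>a i\<close> on the product of the
  intervals \<open>(s (i l), s (i l + 1)]\<close>, \<open>l < n\<close>. Coefficients with a repeated index must vanish:
  this is what excludes the diagonals.
\<close>

definition off_diagonal ::
  "nat \<Rightarrow> nat \<Rightarrow> (nat \<Rightarrow> real) \<Rightarrow> ((nat \<Rightarrow> nat) \<Rightarrow> real) \<Rightarrow> bool" where
  "off_diagonal n m s a \<longleftrightarrow> strict_mono_on {..m} s \<and>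
     (\<forall>i \<in> {..<n} \<rightarrow>\<^sub>E {..<m}. \<not> inj_on i {..<n} \<longrightarrow> a i = 0)"

definition step_function ::
  "nat \<Rightarrow> nat \<Rightarrow> (nat \<Rightarrow> real) \<Rightarrow> ((nat \<Rightarrow> nat) \<Rightarrow> real) \<Rightarrow> (nat \<Rightarrow> real) \<Rightarrow> real" where
  "step_function n m s a y =
     (\<Sum>i \<in> {..<n} \<rightarrow>\<^sub>E {..<m}. a i * (\<Prod>l<n. indicator {s (i l)<..s (Suc (i l))} (y l)))"

definition step_integral ::
  "(real \<Rightarrow> 'w \<Rightarrow> real) \<Rightarrow> nat \<Rightarrow> nat \<Rightarrow> (nat \<Rightarrow> real) \<Rightarrow> ((nat \<Rightarrow> nat) \<Rightarrow> real) \<Rightarrow> 'w \<Rightarrow> real" where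
  "step_integral B n m s a \<omega> =
     (\<Sum>i \<in> {..<n} \<rightarrow>\<^sub>E {..<m}. a i * (\<Prod>l<n. B (s (Suc (i l))) \<omega> - B (s (i l)) \<omega>))"

text \<open>
  \<open>X\<close> is a version of \<open>I\<^sub>n(f)\<close>: the integral is the continuous extension of the elementary
  integral from off-diagonal step functions to \<open>L\<^sup>2(\<real>\<^sup>n)\<close>. It is determined almost surely, and
  so is formulated as a relation.
\<close>

definition has_wiener_ito_integral ::
  "'w measure \<Rightarrow> (real \<Rightarrow> 'w \<Rightarrow> real) \<Rightarrow> nat \<Rightarrow> ((nat \<Rightarrow> real) \<Rightarrow> real) \<Rightarrow> ('w \<Rightarrow> real) \<Rightarrow> bool" where
  "has_wiener_ito_integral M B n f X \<longleftrightarrow>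
     (\<exists>m s a. (\<forall>k. off_diagonal n (m k) (s k) (a k)) \<and>
        L2_tendsto (lborel_pow n) (\<lambda>k. step_function n (m k) (s k) (a k)) f \<and>
        L2_tendsto M (\<lambda>k. step_integral B n (m k) (s k) (a k)) X)"

section \<open>Hermite processes\<close>

text \<open>
  Since \<open>0 powr x = 0\<close>, the factor \<open>max 0 (u - y l) powr _\<close> vanishes for \<open>u \<le> y l\<close>, as
  \<open>(u - y\<^sub>l)\<^sub>+\<close> with a negative exponent is meant to. The integral over \<open>u\<close> can diverge only on a
  null set of \<open>y\<close>, where it is \<open>0\<close> by the library's convention.
\<close>

definition hermite_kernel :: "real \<Rightarrow> nat \<Rightarrow> real \<Rightarrow> (nat \<Rightarrow> real) \<Rightarrow> real" where
  "hermite_kernel H q t y =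
     (LINT u:{0..t}|lborel. (\<Prod>l<q. max 0 (u - y l) powr (- (1 / 2 + (1 - H) / real q))))"

definition hermite_const :: "real \<Rightarrow> nat \<Rightarrow> real" where
  "hermite_const H q =
     (fact q * (\<integral>y. (hermite_kernel H q 1 y)\<^sup>2 \<partial>lborel_pow q)) powr (- 1 / 2)"

definition hermite_process ::
  "'w measure \<Rightarrow> (real \<Rightarrow> 'w \<Rightarrow> real) \<Rightarrow> real \<Rightarrow> nat \<Rightarrow> (real \<Rightarrow> 'w \<Rightarrow> real) \<Rightarrow> bool" where
  "hermite_process M B H q Z \<longleftrightarrow>
     (\<forall>t\<ge>0. \<exists>X. has_wiener_ito_integral M B q (hermite_kernel H q t) X \<and>
        Z t = (\<lambda>\<omega>. hermite_const H q * X \<omega>))"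

section \<open>Processes as random elements of the path space\<close>

abbreviation path_space :: "(real \<Rightarrow> real) measure" where
  "path_space \<equiv> Pi\<^sub>M {0..} (\<lambda>_. borel)"

definition trajectory :: "(real \<Rightarrow> 'w \<Rightarrow> real) \<Rightarrow> 'w \<Rightarrow> real \<Rightarrow> real" where
  "trajectory Z \<omega> = (\<lambda>t\<in>{0..}. Z t \<omega>)"

definition indep_processes ::
  "'w measure \<Rightarrow> (real \<Rightarrow> 'w \<Rightarrow> real) \<Rightarrow> (real \<Rightarrow> 'w \<Rightarrow> real) \<Rightarrow> bool" where
  "indep_processes M Y Z \<longleftrightarrow>
     prob_space.indep_var M path_space (trajectory Y) path_space (trajectory Z)"

definition independent_copy ::
  "'w measure \<Rightarrow> (real \<Rightarrow> 'w \<Rightarrow> real) \<Rightarrow> (real \<Rightarrow> 'w \<Rightarrow> real) \<Rightarrow> bool" where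
  "independent_copy M Y Z \<longleftrightarrow>
     indep_processes M Y Z \<and> distr M path_space (trajectory Y) = distr M path_space (trajectory Z)"

section \<open>Quadratic and cross variations along the grid \<open>t\<^sub>i = g i\<close>\<close>

definition increment :: "(real \<Rightarrow> 'w \<Rightarrow> real) \<Rightarrow> real \<Rightarrow> nat \<Rightarrow> 'w \<Rightarrow> real" where
  "increment Z g i \<omega> = Z (g * real (i + 1)) \<omega> - Z (g * real i) \<omega>"

definition centred_quadratic_variation ::
  "'w measure \<Rightarrow> (real \<Rightarrow> 'w \<Rightarrow> real) \<Rightarrow> real \<Rightarrow> nat \<Rightarrow> 'w \<Rightarrow> real" where
  "centred_quadratic_variation M Z g N \<omega> =
     (\<Sum>i<N. (increment Z g i \<omega>)\<^sup>2 - (\<integral>\<omega>'. (increment Z g i \<omega>')\<^sup>2 \<partial>M))"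

definition qv_deviation :: "'w measure \<Rightarrow> (real \<Rightarrow> 'w \<Rightarrow> real) \<Rightarrow> real \<Rightarrow> nat \<Rightarrow> real" where
  "qv_deviation M Z g N = sqrt (\<integral>\<omega>. (centred_quadratic_variation M Z g N \<omega>)\<^sup>2 \<partial>M)"

definition cross_variation ::
  "(real \<Rightarrow> 'w \<Rightarrow> real) \<Rightarrow> (real \<Rightarrow> 'w \<Rightarrow> real) \<Rightarrow> real \<Rightarrow> nat \<Rightarrow> 'w \<Rightarrow> real" where
  "cross_variation Y Z g N \<omega> = (\<Sum>i<N. increment Y g i \<omega> * increment Z g i \<omega>)"

end

theory Submission
  imports Defs
begin

text \<open>
  By independence, the second moment of the cross variation is the double sum over the grid of the products of the covariances of the
  increments of the two processes, and these decay like \<open>(1 + |i - j|)\<close> to the powers \<open>2 H\<^sub>1 - 2\<close> and \<open>2 H\<^sub>2 - 2\<close>.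
  The kernels of the increments are nonnegative, so in the expansion of \<open>Cov(I\<^sub>q(f)\<^sup>2, I\<^sub>q(g)\<^sup>2)\<close> over pairings all
  terms are nonnegative, and the single pairing that contracts \<open>f\<close> with \<open>f\<close> and \<open>g\<close> with \<open>g\<close> in \<open>q - 1\<close>
  variables already gives a lower bound of order \<open>(1 + |i - j|)\<close> to the power \<open>-4 (1 - H) / q\<close>, uniformly in the
  mesh after scaling. For \<open>q = 1\<close> this is the square of the covariance; for \<open>q \<ge> 2\<close> it decays strictly more
  slowly, with an exponent above \<open>-1\<close>. The Cauchy--Schwarz inequality for the double sum then gives \<open>O\<close>, and the
  strict gap for the process of order \<open>q + 1 \<ge> 2\<close> turns it into \<open>o\<close>.

  For fourth moments in the limit from step functions one needs convergence in \<open>L\<^sup>4\<close>, which is hypercontractivity;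
  step functions can be replaced by their positive parts because the kernels are nonnegative.
\<close>

text \<open>\<open>has_wiener_ito_integral\<close> only provides some off-diagonal step functions
  that converge in L^2 together with their integrals. Every moment relation is therefore proved for
  polynomials in finitely many independent Gaussian increments and has to survive an L^2 limit. The
  two sides of the covariance bound for squares survive it differently: moments converge because, at
  a fixed order, L^2 convergence improves to L^4; for the contraction of the kernels lower
  semicontinuity, from Fatou's lemma, is enough, since only a lower bound is wanted.

  With \<open>\<beta> = 2 - 2 * H\<close>, covariances of increments decay with exponent
  \<open>\<beta>\<close>, and the lower bound for covariances of squares with exponent
  \<open>2 * \<beta> / q\<close>. The double sums are compared with each other rather than
  evaluated, which avoids distinguishing whether an exponent is below, at or above 1. Mesh and
  normalizing constants enter the upper and the lower bound in the same powers and cancel; this is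
  why the mesh may depend on \<open>N\<close> in any way.\<close>

text \<open>Step functions (with \<open>W l t = - [t < y l]\<close>) and their integrals (with \<open>W l t = B t \<omega>\<close>) are both
  of the following form, so that refining the grid is done once for both.\<close>

definition grid_sum ::
  "nat \<Rightarrow> nat \<Rightarrow> (nat \<Rightarrow> real) \<Rightarrow> ((nat \<Rightarrow> nat) \<Rightarrow> real) \<Rightarrow> (nat \<Rightarrow> real \<Rightarrow> real) \<Rightarrow> real" where
  "grid_sum n m s a W = (\<Sum>i \<in> {..<n} \<rightarrow>\<^sub>E {..<m}. a i * (\<Prod>l<n. W l (s (Suc (i l))) - W l (s (i l))))"

lemma step_integral_eq_grid_sum: "step_integral B n m s a \<omega> = grid_sum n m s a (\<lambda>_ t. B t \<omega>)"
  by (simp add: step_integral_def grid_sum_def)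

lemma step_function_eq_grid_sum:
  assumes "strict_mono_on {..m} s"
  shows "step_function n m s a y = grid_sum n m s a (\<lambda>l t. - of_bool (t < y l))"
proof -
  \<comment> \<open>Left-open, right-closed intervals are exactly the increments of the map taking
    \<open>t\<close> to \<open>- of_bool (t < x)\<close>; with other end points the identity would
    fail at grid points.\<close>
  have "indicator {s p<..s (Suc p)} x = (- of_bool (s (Suc p) < x) - - of_bool (s p < x) :: real)"
    if "p < m" for p x
  proof -
    have "s p < s (Suc p)"
      using assms that by (auto simp: strict_mono_on_def)
    then show ?thesis by (auto simp: indicator_def)
  qed
  then show ?thesis
    unfolding step_function_def grid_sum_def
    by (intro sum.cong prod.cong refl arg_cong2[of _ _ _ _ "(*)"]) (auto simp: PiE_iff)
qed

text \<open>The coefficient of the coarse cell that contains the fine cell \<open>i'\<close>, and 0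
  if there is none; \<open>\<phi>\<close> sends a coarse grid index to its position in the fine
  grid. As a sum over all coarse cells it falls out of the expansion of a product of sums.\<close>

definition refine_coeff ::
  "nat \<Rightarrow> nat \<Rightarrow> (nat \<Rightarrow> nat) \<Rightarrow> ((nat \<Rightarrow> nat) \<Rightarrow> real) \<Rightarrow> (nat \<Rightarrow> nat) \<Rightarrow> real" where
  "refine_coeff n m \<phi> a i' =
     (\<Sum>i \<in> {..<n} \<rightarrow>\<^sub>E {..<m}. a i * (\<Prod>l<n. of_bool (\<phi> (i l) \<le> i' l \<and> i' l < \<phi> (Suc (i l)))))"

text \<open>A coarse increment telescopes over the fine increments inside it, and the product of
  \<open>n\<close> such sums expands into a sum over fine multi-indices.\<close>

lemma grid_sum_refine:
  assumes \<phi>: "strict_mono_on {..m} \<phi>" "\<phi> ` {..m} \<subseteq> {..m'}"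
    and s: "\<And>p. p \<le> m \<Longrightarrow> s p = s' (\<phi> p)"
  shows "grid_sum n m s a W = grid_sum n m' s' (refine_coeff n m \<phi> a) W"
proof -
  define \<theta> :: "nat \<Rightarrow> nat \<Rightarrow> real" where "\<theta> = (\<lambda>p p'. of_bool (\<phi> p \<le> p' \<and> p' < \<phi> (Suc p)))"
  have tele: "W l (s (Suc p)) - W l (s p) = (\<Sum>p'<m'. \<theta> p p' * (W l (s' (Suc p')) - W l (s' p')))"
    if "p < m" for p l
  proof -
    have le: "\<phi> p \<le> \<phi> (Suc p)"
      using \<phi>(1) that by (auto simp: strict_mono_on_def intro!: less_imp_le)
    have "\<phi> (Suc p) \<le> m'"
      using \<phi>(2) that by (auto simp: image_subset_iff)
    then have "(\<Sum>p'<m'. \<theta> p p' * (W l (s' (Suc p')) - W l (s' p')))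
        = (\<Sum>p' = \<phi> p..<\<phi> (Suc p). W l (s' (Suc p')) - W l (s' p'))"
      by (intro sum.mono_neutral_cong_right) (auto simp: \<theta>_def)
    also have "\<dots> = W l (s' (\<phi> (Suc p))) - W l (s' (\<phi> p))"
      using sum_Suc_diff'[OF le, of "\<lambda>p. W l (s' p)"] by simp
    finally show ?thesis using s that by simp
  qed
  have "grid_sum n m s a W =
      (\<Sum>i \<in> {..<n} \<rightarrow>\<^sub>E {..<m}. a i * (\<Prod>l<n. \<Sum>p'<m'. \<theta> (i l) p' * (W l (s' (Suc p')) - W l (s' p'))))"
    unfolding grid_sum_def
    by (intro sum.cong prod.cong refl arg_cong2[of _ _ _ _ "(*)"] tele) (auto simp: PiE_iff)
  also have "\<dots> = (\<Sum>i \<in> {..<n} \<rightarrow>\<^sub>E {..<m}. a i *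
      (\<Sum>i' \<in> {..<n} \<rightarrow>\<^sub>E {..<m'}. \<Prod>l<n. \<theta> (i l) (i' l) * (W l (s' (Suc (i' l))) - W l (s' (i' l)))))"
    by (subst prod_sum_PiE) auto
  also have "\<dots> = (\<Sum>i' \<in> {..<n} \<rightarrow>\<^sub>E {..<m'}. \<Sum>i \<in> {..<n} \<rightarrow>\<^sub>E {..<m}.
      a i * (\<Prod>l<n. \<theta> (i l) (i' l)) * (\<Prod>l<n. W l (s' (Suc (i' l))) - W l (s' (i' l))))"
    by (simp add: sum_distrib_left prod.distrib mult.assoc) (rule sum.swap)
  also have "\<dots> = grid_sum n m' s' (refine_coeff n m \<phi> a) W"
    by (simp add: grid_sum_def refine_coeff_def \<theta>_def sum_distrib_right)
  finally show ?thesis .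
qed

lemma refine_coeff_nonneg:
  assumes "\<And>i. i \<in> {..<n} \<rightarrow>\<^sub>E {..<m} \<Longrightarrow> 0 \<le> a i"
  shows "0 \<le> refine_coeff n m \<phi> a i'"
  unfolding refine_coeff_def using assms by (intro sum_nonneg mult_nonneg_nonneg prod_nonneg) auto

text \<open>Coarse intervals are disjoint, so equal fine indices lie in the same one. A repeated
  index in \<open>i'\<close> thus forces a repeated index in every coarse \<open>i\<close> that
  could contribute, and its coefficient vanishes.\<close>

lemma refine_coeff_off_diagonal:
  assumes \<phi>: "strict_mono_on {..m} \<phi>" and a: "off_diagonal n m s a"
    and i': "\<not> inj_on i' {..<n}"
  shows "refine_coeff n m \<phi> a i' = 0"
  unfolding refine_coeff_def
proof (intro sum.neutral ballI)
  fix i assume i: "i \<in> {..<n} \<rightarrow>\<^sub>E {..<m}"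
  show "a i * (\<Prod>l<n. of_bool (\<phi> (i l) \<le> i' l \<and> i' l < \<phi> (Suc (i l)))) = 0"
  proof (cases "inj_on i {..<n}")
    case False
    then show ?thesis using a i by (auto simp: off_diagonal_def)
  next
    case True
    obtain l1 l2 where l: "l1 < n" "l2 < n" "l1 \<noteq> l2" "i' l1 = i' l2"
      using i' by (auto simp: inj_on_def)
    then have ne: "i l1 \<noteq> i l2" using True by (auto simp: inj_on_def)
    have mono: "\<phi> (Suc p) \<le> \<phi> p'" if "p < p'" "p' < m" for p p'
      using \<phi> that by (cases "Suc p = p'") (auto simp: strict_mono_on_def intro!: less_imp_le)
    have "i l1 < m" "i l2 < m" using i l by (auto simp: PiE_iff)
    then have "\<not> (\<phi> (i l1) \<le> i' l1 \<and> i' l1 < \<phi> (Suc (i l1))) \<or> \<not> (\<phi> (i l2) \<le> i' l2 \<and> i' l2 < \<phi> (Suc (i l2)))"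
      using mono[of "i l1" "i l2"] mono[of "i l2" "i l1"] ne l(4) by linarith
    then have "\<exists>l\<in>{..<n}. of_bool (\<phi> (i l) \<le> i' l \<and> i' l < \<phi> (Suc (i l))) = (0::real)"
      using l by (metis lessThan_iff of_bool_eq(1))
    then show ?thesis by (simp add: prod_zero_iff)
  qed
qed

lemma ex_common_grid:
  fixes s1 s2 :: "nat \<Rightarrow> real"
  assumes "strict_mono_on {..m1} s1" "strict_mono_on {..m2} s2"
  obtains m :: nat and s :: "nat \<Rightarrow> real" and \<phi>1 \<phi>2 :: "nat \<Rightarrow> nat" where "strict_mono_on {..m} s"
    "strict_mono_on {..m1} \<phi>1" "\<phi>1 ` {..m1} \<subseteq> {..m}" "\<And>p. p \<le> m1 \<Longrightarrow> s1 p = s (\<phi>1 p)"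
    "strict_mono_on {..m2} \<phi>2" "\<phi>2 ` {..m2} \<subseteq> {..m}" "\<And>p. p \<le> m2 \<Longrightarrow> s2 p = s (\<phi>2 p)"
proof -
  define S where "S = s1 ` {..m1} \<union> s2 ` {..m2}"
  define xs where "xs = sorted_list_of_set S"
  define s where "s = (\<lambda>k. xs ! k)"
  \<comment> \<open>\<open>m\<close> counts intervals, not points; \<open>S\<close> is nonempty even
    for grids of a single point, so the subtraction is not truncated.\<close>
  define m where "m = card S - 1"
  have fin: "finite S" and ne: "S \<noteq> {}" by (auto simp: S_def)
  have len: "length xs = Suc m"
    using fin ne by (simp add: xs_def m_def card_gt_0_iff)
  have xs: "sorted xs" "distinct xs" "set xs = S"
    using fin by (auto simp: xs_def)
  have sm: "strict_mono_on {..m} s"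
    unfolding strict_mono_on_def s_def
    using xs len by (auto simp: sorted_wrt_nth_less strict_sorted_iff less_Suc_eq_le)
  have less: "p < p'" if "s p < s p'" "p \<le> m" "p' \<le> m" for p p'
  proof (rule ccontr)
    assume "\<not> p < p'"
    then have "s p' \<le> s p"
      using sm that by (cases "p = p'") (auto simp: not_less strict_mono_on_leD)
    then show False using that by simp
  qed
  have ex: "\<exists>\<phi>. strict_mono_on {..m0} \<phi> \<and> \<phi> ` {..m0} \<subseteq> {..m} \<and> (\<forall>p\<le>m0. s0 p = s (\<phi> p))"
    if s0: "strict_mono_on {..m0} s0" and sub: "s0 ` {..m0} \<subseteq> S" for m0 and s0 :: "nat \<Rightarrow> real"
  proof -
    have "\<exists>k. k \<le> m \<and> s0 p = s k" if "p \<le> m0" for p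
    proof -
      have "s0 p \<in> set xs" using sub that xs by auto
      then show ?thesis
        using len unfolding s_def in_set_conv_nth by (metis less_Suc_eq_le)
    qed
    then obtain \<phi> where \<phi>: "\<And>p. p \<le> m0 \<Longrightarrow> \<phi> p \<le> m \<and> s0 p = s (\<phi> p)" by metis
    have "strict_mono_on {..m0} \<phi>"
      using s0 \<phi> less unfolding strict_mono_on_def by (metis atMost_iff)
    with \<phi> show ?thesis by blast
  qed
  obtain \<phi>1 where \<phi>1: "strict_mono_on {..m1} \<phi>1" "\<phi>1 ` {..m1} \<subseteq> {..m}" "\<forall>p\<le>m1. s1 p = s (\<phi>1 p)"
    using ex[OF assms(1)] by (auto simp: S_def)
  obtain \<phi>2 where \<phi>2: "strict_mono_on {..m2} \<phi>2" "\<phi>2 ` {..m2} \<subseteq> {..m}" "\<forall>p\<le>m2. s2 p = s (\<phi>2 p)"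
    using ex[OF assms(2)] by (auto simp: S_def)
  show thesis
    by (rule that[of m s \<phi>1 \<phi>2]) (use sm \<phi>1 \<phi>2 in blast)+
qed

definition nonneg_coeff :: "nat \<Rightarrow> nat \<Rightarrow> ((nat \<Rightarrow> nat) \<Rightarrow> real) \<Rightarrow> bool" where
  "nonneg_coeff n m a \<longleftrightarrow> (\<forall>i \<in> {..<n} \<rightarrow>\<^sub>E {..<m}. 0 \<le> a i)"

text \<open>Puts two step functions on one family of independent increments. The refinement depends
  on the grids alone, hence serves every \<open>B\<close>; that nonnegative coefficients stay
  nonnegative is what the covariance bound for squares relies on.\<close>

lemma common_refinement:
  assumes 1: "off_diagonal n m1 s1 a1" and 2: "off_diagonal n m2 s2 a2"
  obtains m s b1 b2 where "off_diagonal n m s b1" "off_diagonal n m s b2"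
    "step_function n m1 s1 a1 = step_function n m s b1"
    "step_function n m2 s2 a2 = step_function n m s b2"
    "\<And>B :: real \<Rightarrow> 'w \<Rightarrow> real. step_integral B n m1 s1 a1 = step_integral B n m s b1"
    "\<And>B :: real \<Rightarrow> 'w \<Rightarrow> real. step_integral B n m2 s2 a2 = step_integral B n m s b2"
    "nonneg_coeff n m1 a1 \<Longrightarrow> nonneg_coeff n m b1" "nonneg_coeff n m2 a2 \<Longrightarrow> nonneg_coeff n m b2"
proof -
  have sm: "strict_mono_on {..m1} s1" "strict_mono_on {..m2} s2"
    using 1 2 by (auto simp: off_diagonal_def)
  from ex_common_grid[OF this] obtain m :: nat and s \<phi>1 \<phi>2 where s: "strict_mono_on {..m} s"
    and \<phi>1: "strict_mono_on {..m1} \<phi>1" "\<phi>1 ` {..m1} \<subseteq> {..m}" "\<And>p. p \<le> m1 \<Longrightarrow> s1 p = s (\<phi>1 p)"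
    and \<phi>2: "strict_mono_on {..m2} \<phi>2" "\<phi>2 ` {..m2} \<subseteq> {..m}" "\<And>p. p \<le> m2 \<Longrightarrow> s2 p = s (\<phi>2 p)"
    by metis
  have g1: "grid_sum n m1 s1 a W = grid_sum n m s (refine_coeff n m1 \<phi>1 a) W"
    and g2: "grid_sum n m2 s2 a W = grid_sum n m s (refine_coeff n m2 \<phi>2 a) W" for a W
    using \<phi>1 \<phi>2 by (simp_all add: grid_sum_refine)
  show thesis
  proof (rule that)
    show "off_diagonal n m s (refine_coeff n m1 \<phi>1 a1)" "off_diagonal n m s (refine_coeff n m2 \<phi>2 a2)"
      using refine_coeff_off_diagonal[OF \<phi>1(1) 1] refine_coeff_off_diagonal[OF \<phi>2(1) 2] s
      by (auto simp: off_diagonal_def)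
    show "step_function n m1 s1 a1 = step_function n m s (refine_coeff n m1 \<phi>1 a1)"
      "step_function n m2 s2 a2 = step_function n m s (refine_coeff n m2 \<phi>2 a2)"
      by (simp_all add: fun_eq_iff step_function_eq_grid_sum sm s g1 g2)
    show "step_integral B n m1 s1 a1 = step_integral B n m s (refine_coeff n m1 \<phi>1 a1)"
      "step_integral B n m2 s2 a2 = step_integral B n m s (refine_coeff n m2 \<phi>2 a2)"
      for B :: "real \<Rightarrow> 'w \<Rightarrow> real"
      by (simp_all add: fun_eq_iff step_integral_eq_grid_sum g1 g2)
  qed (auto simp: nonneg_coeff_def intro!: refine_coeff_nonneg)
qed

lemma step_function_linear:
  "step_function n m s (\<lambda>i. c * a i + d * b i) y = c * step_function n m s a y + d * step_function n m s b y"
  by (simp add: step_function_def sum_distrib_left sum.distrib algebra_simps)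

lemma step_integral_linear:
  "step_integral B n m s (\<lambda>i. c * a i + d * b i) \<omega> = c * step_integral B n m s a \<omega> + d * step_integral B n m s b \<omega>"
  by (simp add: step_integral_def sum_distrib_left sum.distrib algebra_simps)

lemma off_diagonal_linear:
  assumes "off_diagonal n m s a" "off_diagonal n m s b"
  shows "off_diagonal n m s (\<lambda>i. c * a i + d * b i)"
  using assms by (auto simp: off_diagonal_def)

section \<open>Cauchy-Schwarz and variables with all moments\<close>

lemma integrable_mult_of_squares:
  fixes f g :: "'a \<Rightarrow> real"
  assumes [measurable]: "f \<in> borel_measurable M" "g \<in> borel_measurable M"
    and "integrable M (\<lambda>x. (f x)\<^sup>2)" "integrable M (\<lambda>x. (g x)\<^sup>2)"
  shows "integrable M (\<lambda>x. f x * g x)"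
proof (rule Bochner_Integration.integrable_bound)
  show "integrable M (\<lambda>x. (f x)\<^sup>2 + (g x)\<^sup>2)" using assms by simp
  have "\<bar>a * b\<bar> \<le> a\<^sup>2 + b\<^sup>2" for a b :: real
    using sum_squares_bound[of "\<bar>a\<bar>" "\<bar>b\<bar>"] mult_nonneg_nonneg[of "\<bar>a\<bar>" "\<bar>b\<bar>"]
    unfolding abs_mult power2_abs by linarith
  then show "AE x in M. norm (f x * g x) \<le> norm ((f x)\<^sup>2 + (g x)\<^sup>2)" by simp
qed simp

lemma integral_Cauchy_Schwarz:
  fixes f g :: "'a \<Rightarrow> real"
  assumes meas: "f \<in> borel_measurable M" "g \<in> borel_measurable M"
    and int: "integrable M (\<lambda>x. (f x)\<^sup>2)" "integrable M (\<lambda>x. (g x)\<^sup>2)"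
  shows "(\<integral>x. f x * g x \<partial>M)\<^sup>2 \<le> (\<integral>x. (f x)\<^sup>2 \<partial>M) * (\<integral>x. (g x)\<^sup>2 \<partial>M)"
proof -
  define a b c where "a = (\<integral>x. (f x)\<^sup>2 \<partial>M)" "b = (\<integral>x. f x * g x \<partial>M)" "c = (\<integral>x. (g x)\<^sup>2 \<partial>M)"
  note fg = integrable_mult_of_squares[OF meas int]
  have quad: "0 \<le> a + 2 * t * b + t\<^sup>2 * c" for t
  proof -
    have "0 \<le> (\<integral>x. (f x + t * g x)\<^sup>2 \<partial>M)" by simp
    also have "\<dots> = (\<integral>x. (f x)\<^sup>2 + 2 * t * (f x * g x) + t\<^sup>2 * (g x)\<^sup>2 \<partial>M)"
      by (simp add: power2_eq_square algebra_simps)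
    also have "\<dots> = a + 2 * t * b + t\<^sup>2 * c"
      using int fg by (simp add: a_b_c_def)
    finally show ?thesis .
  qed
  have "0 \<le> c" by (simp add: a_b_c_def)
  have "b\<^sup>2 \<le> a * c"
  proof (cases "c = 0")
    case True
    \<comment> \<open>The quadratic degenerates to \<open>a + 2 * t * b\<close>; at the chosen
      \<open>t\<close> it would equal -1 if \<open>b\<close> were nonzero.\<close>
    then have "b = 0"
      using quad[of "- (a + 1) / (2 * b)"] by (cases "b = 0") (auto simp: field_simps)
    then show ?thesis using True by simp
  next
    case False
    then have "c > 0" using \<open>0 \<le> c\<close> by simp
    have "a + 2 * (- b / c) * b + (- b / c)\<^sup>2 * c = a - b\<^sup>2 / c"
      using \<open>c > 0\<close> by (simp add: field_simps power2_eq_square)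
    then have "b\<^sup>2 / c \<le> a" using quad[of "- b / c"] by simp
    then show ?thesis using \<open>c > 0\<close> by (simp add: field_simps)
  qed
  then show ?thesis by (simp add: a_b_c_def)
qed

text \<open>Membership in every L^p, coded by powers, since even exponents control absolute moments.
  The class is closed under sums and products by Cauchy-Schwarz, so integrability of a polynomial in
  Gaussian variables reduces to that of the variables.\<close>

definition all_moments :: "'a measure \<Rightarrow> ('a \<Rightarrow> real) \<Rightarrow> bool" where
  "all_moments M X \<longleftrightarrow> X \<in> borel_measurable M \<and> (\<forall>k. integrable M (\<lambda>\<omega>. X \<omega> ^ k))"

lemma all_moments_measurable [measurable_dest]: "all_moments M X \<Longrightarrow> X \<in> borel_measurable M"
  by (simp add: all_moments_def)

lemma all_moments_integrable_power: "all_moments M X \<Longrightarrow> integrable M (\<lambda>\<omega>. X \<omega> ^ k)"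
  by (simp add: all_moments_def)

lemma all_moments_integrable: "all_moments M X \<Longrightarrow> integrable M X"
  using all_moments_integrable_power[of M X 1] by simp

lemma all_moments_mult:
  assumes X: "all_moments M X" and Y: "all_moments M Y"
  shows "all_moments M (\<lambda>\<omega>. X \<omega> * Y \<omega>)"
  unfolding all_moments_def
proof (intro conjI allI)
  note [measurable] = X[THEN all_moments_measurable] Y[THEN all_moments_measurable]
  show "(\<lambda>\<omega>. X \<omega> * Y \<omega>) \<in> borel_measurable M" by simp
  show "integrable M (\<lambda>\<omega>. (X \<omega> * Y \<omega>) ^ k)" for k
    unfolding power_mult_distrib
    by (intro integrable_mult_of_squares)
       (auto simp: power_mult[symmetric] intro: X Y all_moments_integrable_power)
qed

lemma (in finite_measure) all_moments_const: "all_moments M (\<lambda>\<omega>. c)"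
  by (simp add: all_moments_def)

lemma all_moments_add:
  assumes X: "all_moments M X" and Y: "all_moments M Y"
  shows "all_moments M (\<lambda>\<omega>. X \<omega> + Y \<omega>)"
  unfolding all_moments_def
proof (intro conjI allI)
  note [measurable] = X[THEN all_moments_measurable] Y[THEN all_moments_measurable]
  show "(\<lambda>\<omega>. X \<omega> + Y \<omega>) \<in> borel_measurable M" by simp
  show "integrable M (\<lambda>\<omega>. (X \<omega> + Y \<omega>) ^ k)" for k
  proof -
    have "integrable M (\<lambda>\<omega>. X \<omega> ^ i * Y \<omega> ^ j)" for i j
      by (intro integrable_mult_of_squares)
         (auto simp: power_mult[symmetric] intro: X Y all_moments_integrable_power)
    then show ?thesis
      by (simp add: binomial_ring mult.assoc)
  qed
qed

context prob_space begin

lemma all_moments_sum: "(\<And>i. i \<in> I \<Longrightarrow> all_moments M (X i)) \<Longrightarrow> all_moments M (\<lambda>\<omega>. \<Sum>i\<in>I. X i \<omega>)"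
  by (induction I rule: infinite_finite_induct) (auto intro: all_moments_add all_moments_const)

lemma all_moments_prod: "(\<And>i. i \<in> I \<Longrightarrow> all_moments M (X i)) \<Longrightarrow> all_moments M (\<lambda>\<omega>. \<Prod>i\<in>I. X i \<omega>)"
  by (induction I rule: infinite_finite_induct) (auto intro: all_moments_mult all_moments_const)

lemma all_moments_power: "all_moments M X \<Longrightarrow> all_moments M (\<lambda>\<omega>. X \<omega> ^ k)"
  by (induction k) (auto intro: all_moments_mult all_moments_const)

lemmas all_moments_intros = all_moments_add all_moments_mult all_moments_sum all_moments_prod
  all_moments_power all_moments_const

end

section \<open>Finite families of independent centred Gaussian variables\<close>

definition gauss_moment :: "real \<Rightarrow> nat \<Rightarrow> real" where
  "gauss_moment v k = (\<integral>x. normal_density 0 (sqrt v) x * x ^ k \<partial>lborel)"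

text \<open>Exponents up to 4 suffice because the highest expectations taken are those of products
  of four square-free polynomials.\<close>

lemma gauss_moment_values:
  assumes "0 < v"
  shows "gauss_moment v 0 = 1" "gauss_moment v (Suc 0) = 0" "gauss_moment v 2 = v"
    "gauss_moment v 3 = 0" "gauss_moment v 4 = 3 * v\<^sup>2"
proof -
  have [simp]: "0 < sqrt v" using assms by simp
  show "gauss_moment v 0 = 1" "gauss_moment v (Suc 0) = 0" "gauss_moment v 2 = v"
    "gauss_moment v 3 = 0"
    using integral_normal_moment_even[of "sqrt v" 0 0] integral_normal_moment_even[of "sqrt v" 0 1]
      integral_normal_moment_odd[of "sqrt v" 0 0] integral_normal_moment_odd[of "sqrt v" 0 1] assms
    by (simp_all add: gauss_moment_def fact_numeral)
  show "gauss_moment v 4 = 3 * v\<^sup>2"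
    using integral_normal_moment_even[of "sqrt v" 0 2] assms
    by (simp add: gauss_moment_def fact_numeral power2_eq_square)
qed

locale gaussian_family = prob_space M for M :: "'w measure" +
  fixes m :: nat and \<xi> :: "nat \<Rightarrow> 'w \<Rightarrow> real" and v :: "nat \<Rightarrow> real"
  assumes indep: "indep_vars (\<lambda>_. borel) \<xi> {..<m}"
    and normal: "\<And>l. l < m \<Longrightarrow> distributed M lborel (\<xi> l) (normal_density 0 (sqrt (v l)))"
    and v_pos: "\<And>l. l < m \<Longrightarrow> 0 < v l"
begin

lemma measurable_\<xi> [measurable]: "l < m \<Longrightarrow> \<xi> l \<in> borel_measurable M"
  using normal[of l] by (auto simp: distributed_def)

lemma all_moments_\<xi>: "l < m \<Longrightarrow> all_moments M (\<xi> l)"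
  using distributed_integrable[OF normal, of l "\<lambda>x. x ^ _"] v_pos[of l]
    integrable_normal_moment[of "sqrt (v l)" 0]
  by (auto simp: all_moments_def)

lemma expectation_power: "l < m \<Longrightarrow> (\<integral>\<omega>. \<xi> l \<omega> ^ k \<partial>M) = gauss_moment (v l) k"
  using distributed_integral[OF normal, of l "\<lambda>x. x ^ k"]
  by (simp add: gauss_moment_def)

lemma expectation_monomial:
  "(\<integral>\<omega>. (\<Prod>l<m. \<xi> l \<omega> ^ k l) \<partial>M) = (\<Prod>l<m. gauss_moment (v l) (k l))"
proof -
  have "(\<integral>\<omega>. (\<Prod>l<m. \<xi> l \<omega> ^ k l) \<partial>M) = (\<Prod>l<m. \<integral>\<omega>. \<xi> l \<omega> ^ k l \<partial>M)"
    using indep_vars_compose2[OF indep, of "\<lambda>l x. x ^ k l" "\<lambda>_. borel"]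
    by (intro indep_vars_lebesgue_integral) (auto intro: all_moments_integrable_power all_moments_\<xi>)
  then show ?thesis by (simp add: expectation_power)
qed

lemma expectation_mult_power:
  assumes L: "L \<subseteq> {..<m}" and x: "x < m" "x \<notin> L"
    and [measurable]: "p \<in> borel_measurable (Pi\<^sub>M L (\<lambda>_. borel))"
    and int: "integrable M (\<lambda>\<omega>. p (\<lambda>l\<in>L. \<xi> l \<omega>))"
  shows "(\<integral>\<omega>. p (\<lambda>l\<in>L. \<xi> l \<omega>) * \<xi> x \<omega> ^ k \<partial>M) = (\<integral>\<omega>. p (\<lambda>l\<in>L. \<xi> l \<omega>) \<partial>M) * gauss_moment (v x) k"
proof -
  have "indep_var (Pi\<^sub>M L (\<lambda>_. borel)) (\<lambda>\<omega>. \<lambda>l\<in>L. \<xi> l \<omega>) (Pi\<^sub>M {x} (\<lambda>_. borel)) (\<lambda>\<omega>. \<lambda>l\<in>{x}. \<xi> l \<omega>)"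
    using L x by (intro indep_var_restrict[OF indep]) auto
  then have "indep_var borel (p \<circ> (\<lambda>\<omega>. \<lambda>l\<in>L. \<xi> l \<omega>)) borel ((\<lambda>z. z x ^ k) \<circ> (\<lambda>\<omega>. \<lambda>l\<in>{x}. \<xi> l \<omega>))"
    by (rule indep_var_compose) measurable
  then have "indep_var borel (\<lambda>\<omega>. p (\<lambda>l\<in>L. \<xi> l \<omega>)) borel (\<lambda>\<omega>. \<xi> x \<omega> ^ k)"
    by (simp add: comp_def)
  from indep_var_lebesgue_integral[OF this int] x show ?thesis
    by (simp add: all_moments_integrable_power all_moments_\<xi> expectation_power)
qed

text \<open>A square-free polynomial. With monomials indexed by sets, removing a variable splits the
  power set into the sets without and with it, and the degree becomes a bound on
  cardinalities.\<close>

definition multilin :: "nat set \<Rightarrow> (nat set \<Rightarrow> real) \<Rightarrow> 'w \<Rightarrow> real" where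
  "multilin L c \<omega> = (\<Sum>A\<in>Pow L. c A * (\<Prod>l\<in>A. \<xi> l \<omega>))"

lemma all_moments_multilin: "L \<subseteq> {..<m} \<Longrightarrow> all_moments M (multilin L c)"
  unfolding multilin_def[abs_def]
  by (intro all_moments_intros all_moments_\<xi>) auto

lemma multilin_insert:
  assumes "finite L" "x \<notin> L"
  shows "multilin (insert x L) c \<omega> = multilin L c \<omega> + multilin L (\<lambda>A. c (insert x A)) \<omega> * \<xi> x \<omega>"
proof -
  have "multilin (insert x L) c \<omega> = multilin L c \<omega> + (\<Sum>A\<in>insert x ` Pow L. c A * (\<Prod>l\<in>A. \<xi> l \<omega>))"
    unfolding multilin_def Pow_insert
    using assms by (intro sum.union_disjoint) auto
  also have "(\<Sum>A\<in>insert x ` Pow L. c A * (\<Prod>l\<in>A. \<xi> l \<omega>)) =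
      (\<Sum>A\<in>Pow L. c (insert x A) * (\<Prod>l\<in>insert x A. \<xi> l \<omega>))"
    using assms by (subst sum.reindex) (auto simp: inj_on_def insert_eq_iff subset_iff)
  also have "\<dots> = multilin L (\<lambda>A. c (insert x A)) \<omega> * \<xi> x \<omega>"
    unfolding multilin_def sum_distrib_right
  proof (intro sum.cong refl)
    fix A assume "A \<in> Pow L"
    then have "finite A" "x \<notin> A" using assms finite_subset by auto
    then show "c (insert x A) * (\<Prod>l\<in>insert x A. \<xi> l \<omega>) = c (insert x A) * (\<Prod>l\<in>A. \<xi> l \<omega>) * \<xi> x \<omega>"
      by simp
  qed
  finally show ?thesis .
qed

lemma expectation_multilin_mult_power:
  assumes L: "L \<subseteq> {..<m}" and x: "x < m" "x \<notin> L"
  shows "(\<integral>\<omega>. multilin L c \<omega> ^ i * multilin L d \<omega> ^ j * \<xi> x \<omega> ^ k \<partial>M) =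
    (\<integral>\<omega>. multilin L c \<omega> ^ i * multilin L d \<omega> ^ j \<partial>M) * gauss_moment (v x) k"
proof -
  define P where "P c z = (\<Sum>A\<in>Pow L. c A * (\<Prod>l\<in>A. z l))" for c :: "nat set \<Rightarrow> real" and z :: "nat \<Rightarrow> real"
  have P: "multilin L c \<omega> = P c (\<lambda>l\<in>L. \<xi> l \<omega>)" for c \<omega>
    unfolding multilin_def P_def by (intro sum.cong prod.cong refl arg_cong2[of _ _ _ _ "(*)"]) auto
  have [measurable]: "P c \<in> borel_measurable (Pi\<^sub>M L (\<lambda>_. borel))" for c
    unfolding P_def
    by (intro borel_measurable_sum borel_measurable_times borel_measurable_const borel_measurable_prod
        measurable_component_singleton) auto
  have "integrable M (\<lambda>\<omega>. multilin L c \<omega> ^ i * multilin L d \<omega> ^ j)"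
    using L by (intro all_moments_integrable all_moments_intros all_moments_multilin)
  then show ?thesis
    unfolding P by (intro expectation_mult_power[OF L x, of "\<lambda>z. P c z ^ i * P d z ^ j"]) auto
qed

text \<open>Induction over the variables: with \<open>F = P + Q \<xi>\<close> for \<open>\<xi>\<close> independent of \<open>P\<close>, \<open>Q\<close>, the odd
  powers of \<open>\<xi>\<close> drop out of \<open>\<E>[F\<^sup>4]\<close>, and \<open>Q\<close> has smaller degree.\<close>

lemma multilin_hypercontractive:
  assumes "finite L" "L \<subseteq> {..<m}" "\<And>A. A \<subseteq> L \<Longrightarrow> n < card A \<Longrightarrow> c A = 0"
  shows "(\<integral>\<omega>. multilin L c \<omega> ^ 4 \<partial>M) \<le> 9 ^ n * (\<integral>\<omega>. (multilin L c \<omega>)\<^sup>2 \<partial>M)\<^sup>2"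
  using assms
proof (induction L arbitrary: n c rule: finite_induct)
  case empty
  have "(c {}) ^ 4 = ((c {})\<^sup>2)\<^sup>2" by simp
  also have "\<dots> \<le> 9 ^ n * ((c {})\<^sup>2)\<^sup>2"
    using one_le_power[of "9::real" n] by (intro mult_le_cancel_right1[THEN iffD2]) auto
  finally show ?case by (simp add: multilin_def prob_space)
next
  case (insert x L)
  define d where "d A = c (insert x A)" for A
  define P Q where "P = multilin L c" "Q = multilin L d"
  define w where "w = v x"
  have x: "x < m" "x \<notin> L" and L: "L \<subseteq> {..<m}" "finite L" using insert by auto
  have w: "0 < w" using x v_pos by (simp add: w_def)
  have mom: "all_moments M P" "all_moments M Q" "all_moments M (\<xi> x)"
    using L x by (auto simp: P_Q_def intro: all_moments_multilin all_moments_\<xi>)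
  have E: "(\<integral>\<omega>. P \<omega> ^ i * Q \<omega> ^ j * \<xi> x \<omega> ^ k \<partial>M) = (\<integral>\<omega>. P \<omega> ^ i * Q \<omega> ^ j \<partial>M) * gauss_moment w k" for i j k
    using expectation_multilin_mult_power[OF L(1) x, of c i d j k] by (simp add: P_Q_def w_def)
  have I: "integrable M (\<lambda>\<omega>. P \<omega> ^ i * Q \<omega> ^ j * \<xi> x \<omega> ^ k)" for i j k
    by (intro all_moments_integrable all_moments_intros mom)
  have F: "multilin (insert x L) c \<omega> = P \<omega> + Q \<omega> * \<xi> x \<omega>" for \<omega>
    using multilin_insert[OF L(2) x(2), of c \<omega>] by (simp add: P_Q_def d_def[abs_def])
  define p q where "p = (\<integral>\<omega>. (P \<omega>)\<^sup>2 \<partial>M)" "q = (\<integral>\<omega>. (Q \<omega>)\<^sup>2 \<partial>M)"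
  have pq: "0 \<le> p" "0 \<le> q" by (auto simp: p_q_def)
  have two: "(\<integral>\<omega>. (multilin (insert x L) c \<omega>)\<^sup>2 \<partial>M) = p + w * q"
  proof -
    have "(\<integral>\<omega>. (multilin (insert x L) c \<omega>)\<^sup>2 \<partial>M) =
      (\<integral>\<omega>. P \<omega> ^ 2 * Q \<omega> ^ 0 * \<xi> x \<omega> ^ 0 + 2 * (P \<omega> ^ 1 * Q \<omega> ^ 1 * \<xi> x \<omega> ^ 1) + P \<omega> ^ 0 * Q \<omega> ^ 2 * \<xi> x \<omega> ^ 2 \<partial>M)"
      by (simp add: F power2_eq_square algebra_simps)
    also have "\<dots> = p + w * q"
      using E[of 2 0 0] E[of 1 1 1] E[of 0 2 2] I[of 2 0 0] I[of 1 1 1] I[of 0 2 2]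
      by (simp add: p_q_def gauss_moment_values[OF w])
    finally show ?thesis .
  qed
  have four: "(\<integral>\<omega>. (multilin (insert x L) c \<omega>) ^ 4 \<partial>M) =
      (\<integral>\<omega>. P \<omega> ^ 4 \<partial>M) + 6 * w * (\<integral>\<omega>. (P \<omega>)\<^sup>2 * (Q \<omega>)\<^sup>2 \<partial>M) + 3 * w\<^sup>2 * (\<integral>\<omega>. Q \<omega> ^ 4 \<partial>M)"
  proof -
    have "(\<integral>\<omega>. (multilin (insert x L) c \<omega>) ^ 4 \<partial>M) =
      (\<integral>\<omega>. P \<omega> ^ 4 * Q \<omega> ^ 0 * \<xi> x \<omega> ^ 0 + 4 * (P \<omega> ^ 3 * Q \<omega> ^ 1 * \<xi> x \<omega> ^ 1)
         + 6 * (P \<omega> ^ 2 * Q \<omega> ^ 2 * \<xi> x \<omega> ^ 2) + 4 * (P \<omega> ^ 1 * Q \<omega> ^ 3 * \<xi> x \<omega> ^ 3)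
         + P \<omega> ^ 0 * Q \<omega> ^ 4 * \<xi> x \<omega> ^ 4 \<partial>M)"
      by (simp add: F power2_eq_square power3_eq_cube power4_eq_xxxx algebra_simps)
    also have "\<dots> = (\<integral>\<omega>. P \<omega> ^ 4 * Q \<omega> ^ 0 * \<xi> x \<omega> ^ 0 \<partial>M) + 4 * (\<integral>\<omega>. P \<omega> ^ 3 * Q \<omega> ^ 1 * \<xi> x \<omega> ^ 1 \<partial>M)
         + 6 * (\<integral>\<omega>. P \<omega> ^ 2 * Q \<omega> ^ 2 * \<xi> x \<omega> ^ 2 \<partial>M) + 4 * (\<integral>\<omega>. P \<omega> ^ 1 * Q \<omega> ^ 3 * \<xi> x \<omega> ^ 3 \<partial>M)
         + (\<integral>\<omega>. P \<omega> ^ 0 * Q \<omega> ^ 4 * \<xi> x \<omega> ^ 4 \<partial>M)"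
      by (simp only: Bochner_Integration.integral_add Bochner_Integration.integrable_add
        integrable_mult_right I integral_mult_right_zero)
    also have "\<dots> = (\<integral>\<omega>. P \<omega> ^ 4 \<partial>M) + 6 * w * (\<integral>\<omega>. (P \<omega>)\<^sup>2 * (Q \<omega>)\<^sup>2 \<partial>M) + 3 * w\<^sup>2 * (\<integral>\<omega>. Q \<omega> ^ 4 \<partial>M)"
      unfolding E by (simp add: gauss_moment_values[OF w])
    finally show ?thesis .
  qed
  have P4: "(\<integral>\<omega>. P \<omega> ^ 4 \<partial>M) \<le> 9 ^ n * p\<^sup>2"
    using insert.IH[of n c] insert.prems by (auto simp: P_Q_def p_q_def)
  \<comment> \<open>\<open>Q\<close> collects the terms containing \<open>\<xi> x\<close>, so its
    degree is one lower and the induction hypothesis gains a factor 9. For \<open>n = 0\<close>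
    there is no lower degree, but then \<open>Q\<close> vanishes.\<close>
  have Q4: "9 * (\<integral>\<omega>. Q \<omega> ^ 4 \<partial>M) \<le> 9 ^ n * q\<^sup>2"
  proof (cases n)
    case 0
    have "d A = 0" if "A \<subseteq> L" for A
    proof -
      have "finite A" using that L finite_subset by auto
      then have "0 < card (insert x A)" by (simp add: card_gt_0_iff)
      then show ?thesis
        using insert.prems(2)[of "insert x A"] 0 that by (auto simp: d_def)
    qed
    then have "Q \<omega> = 0" for \<omega>
      by (auto simp: P_Q_def multilin_def intro!: sum.neutral)
    then show ?thesis by (simp add: p_q_def)
  next
    case (Suc k)
    have "d A = 0" if "A \<subseteq> L" "k < card A" for A
    proof -
      have "finite A" "x \<notin> A" using that L x finite_subset by auto
      then have "n < card (insert x A)" using that Suc by simp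
      then show ?thesis
        using insert.prems(2)[of "insert x A"] that by (auto simp: d_def)
    qed
    then show ?thesis
      using insert.IH[of k d] insert.prems Suc by (auto simp: P_Q_def p_q_def)
  qed
  \<comment> \<open>This is where the base 9 comes from: Cauchy-Schwarz and the gain in
    \<open>Q4\<close> give a factor 1/3, which turns the binomial coefficient \<open>6 * w\<close>
    into the \<open>2 * w\<close> of the mixed term in \<open>(p + w * q)^2\<close>.\<close>
  have PQ: "3 * (\<integral>\<omega>. (P \<omega>)\<^sup>2 * (Q \<omega>)\<^sup>2 \<partial>M) \<le> 9 ^ n * (p * q)"
  proof (rule power2_le_imp_le)
    have "(3 * (\<integral>\<omega>. (P \<omega>)\<^sup>2 * (Q \<omega>)\<^sup>2 \<partial>M))\<^sup>2 \<le> (\<integral>\<omega>. P \<omega> ^ 4 \<partial>M) * (9 * (\<integral>\<omega>. Q \<omega> ^ 4 \<partial>M))"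
      using integral_Cauchy_Schwarz[of "\<lambda>\<omega>. (P \<omega>)\<^sup>2" M "\<lambda>\<omega>. (Q \<omega>)\<^sup>2"] mom
      by (auto simp: power_mult[symmetric] power_mult_distrib all_moments_integrable_power
        dest: all_moments_measurable)
    also have "\<dots> \<le> (9 ^ n * p\<^sup>2) * (9 ^ n * q\<^sup>2)"
      by (intro mult_mono P4 Q4) (auto intro!: mult_nonneg_nonneg)
    finally show "(3 * (\<integral>\<omega>. (P \<omega>)\<^sup>2 * (Q \<omega>)\<^sup>2 \<partial>M))\<^sup>2 \<le> (9 ^ n * (p * q))\<^sup>2"
      by (simp add: power2_eq_square algebra_simps)
  qed (use pq in auto)
  have "(\<integral>\<omega>. (multilin (insert x L) c \<omega>) ^ 4 \<partial>M) \<le> 9 ^ n * p\<^sup>2 + 2 * w * (9 ^ n * (p * q)) + w\<^sup>2 * (9 ^ n * q\<^sup>2)"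
  proof -
    have "6 * w * (\<integral>\<omega>. (P \<omega>)\<^sup>2 * (Q \<omega>)\<^sup>2 \<partial>M) \<le> 2 * w * (9 ^ n * (p * q))"
      using mult_left_mono[OF PQ, of "2 * w"] w by simp
    moreover have "3 * w\<^sup>2 * (\<integral>\<omega>. Q \<omega> ^ 4 \<partial>M) \<le> w\<^sup>2 * (9 ^ n * q\<^sup>2)"
    proof -
      have "3 * (\<integral>\<omega>. Q \<omega> ^ 4 \<partial>M) \<le> 9 * (\<integral>\<omega>. Q \<omega> ^ 4 \<partial>M)" by simp
      also note Q4
      finally show ?thesis using mult_left_mono[of _ _ "w\<^sup>2"] by fastforce
    qed
    ultimately show ?thesis using P4 four by linarith
  qed
  also have "\<dots> = 9 ^ n * (p + w * q)\<^sup>2" by (simp add: power2_eq_square algebra_simps)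
  finally show ?case by (simp add: two)
qed

end

section \<open>Second and fourth moments of homogeneous sums\<close>

definition inj_tuples :: "nat \<Rightarrow> nat \<Rightarrow> (nat \<Rightarrow> nat) set" where
  "inj_tuples n m = {i \<in> {..<n} \<rightarrow>\<^sub>E {..<m}. inj_on i {..<n}}"

definition occ :: "nat \<Rightarrow> (nat \<Rightarrow> nat) \<Rightarrow> nat \<Rightarrow> nat" where
  "occ n i l = of_bool (l \<in> i ` {..<n})"

lemma finite_inj_tuples [simp]: "finite (inj_tuples n m)"
  by (simp add: inj_tuples_def finite_PiE)

lemma inj_tuples_less: "i \<in> inj_tuples n m \<Longrightarrow> l < n \<Longrightarrow> i l < m"
  by (auto simp: inj_tuples_def PiE_iff)

lemma inj_tuples_eq_iff: "i \<in> inj_tuples n m \<Longrightarrow> l < n \<Longrightarrow> l' < n \<Longrightarrow> i l = i l' \<longleftrightarrow> l = l'"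
  by (auto simp: inj_tuples_def inj_on_def)

lemma inj_tuples_last_notin: "i \<in> inj_tuples (Suc p) m \<Longrightarrow> i p \<notin> i ` {..<p}"
proof
  assume i: "i \<in> inj_tuples (Suc p) m" and "i p \<in> i ` {..<p}"
  then obtain l where "l < p" "i p = i l" by auto
  then show False using inj_tuples_eq_iff[OF i, of p l] by simp
qed

lemma inj_tuples_eqI:
  "i \<in> inj_tuples n m \<Longrightarrow> j \<in> inj_tuples n m \<Longrightarrow> (\<And>l. l < n \<Longrightarrow> i l = j l) \<Longrightarrow> i = j"
  by (auto simp: inj_tuples_def intro: PiE_ext)

lemma inj_tuples_comp_permutes:
  "i \<in> inj_tuples n m \<Longrightarrow> \<sigma> permutes {..<n} \<Longrightarrow> i \<circ> \<sigma> \<in> inj_tuples n m"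
  by (auto simp: inj_tuples_def PiE_iff extensional_def permutes_inj_on permutes_image
      permutes_in_image[of \<sigma> "{..<n}", simplified] intro!: comp_inj_on)

text \<open>Turns a product along a tuple into a monomial over all \<open>m\<close> variables, the
  form in which independence factorises expectations. The prefix length \<open>k\<close> is there
  for the contracted slots \<open>l < p\<close> of a tuple of length \<open>Suc p\<close>.\<close>

lemma prod_tuple_eq:
  fixes f :: "nat \<Rightarrow> 'a :: comm_monoid_mult"
  assumes "i \<in> inj_tuples n m" "k \<le> n"
  shows "(\<Prod>l<k. f (i l)) = (\<Prod>l<m. f l ^ occ k i l)"
proof -
  have inj: "inj_on i {..<k}" and sub: "i ` {..<k} \<subseteq> {..<m}"
    using assms by (auto simp: inj_tuples_def PiE_iff inj_on_def)
  have "(\<Prod>l<k. f (i l)) = (\<Prod>l\<in>i ` {..<k}. f l)"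
    using inj by (simp add: prod.reindex)
  also have "\<dots> = (\<Prod>l<m. f l ^ occ k i l)"
    using sub by (intro prod.mono_neutral_cong_left) (auto simp: occ_def)
  finally show ?thesis .
qed

lemma occ_le: "occ n i l \<le> 1"
  by (simp add: occ_def)

lemma gauss_moment_nonneg:
  assumes "0 < v" "a \<le> 1" "b \<le> 1"
  shows "0 \<le> gauss_moment v (a + b)"
proof -
  have "a + b = 0 \<or> a + b = Suc 0 \<or> a + b = 2" using assms(2,3) by arith
  then show ?thesis using assms(1) by (auto simp: gauss_moment_values)
qed

text \<open>Only two cases are strict: exponents 1 and 1 give 0 against \<open>v\<close>, and 2 and
  2 give the square of \<open>v\<close> against three times it. Applied variable by variable, this
  compares the product of second moments with the fourth moment.\<close>

lemma gauss_moment_superadditive: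
  assumes "0 < v" "a \<le> 1" "b \<le> 1" "c \<le> 1" "d \<le> 1"
  shows "gauss_moment v (a + b) * gauss_moment v (c + d) \<le> gauss_moment v (a + b + c + d)"
proof -
  have "a + b = 0 \<or> a + b = Suc 0 \<or> a + b = 2" "c + d = 0 \<or> c + d = Suc 0 \<or> c + d = 2"
    using assms(2-) by arith+
  moreover have "gauss_moment v (Suc 2) = 0" "gauss_moment v (Suc (Suc (Suc 0))) = 0" "gauss_moment v (Suc (Suc 0)) = v"
    "gauss_moment v (2 + Suc 0) = 0" "gauss_moment v (2 + 2) = 3 * v\<^sup>2"
    using gauss_moment_values[OF assms(1)] by (simp_all add: numeral_eq_Suc)
  ultimately show ?thesis
    using gauss_moment_values[OF assms(1)] assms(1)
    by (elim disjE) (simp_all add: add.assoc power2_eq_square)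
qed

lemma gauss_moment_double:
  assumes "0 < v" "e \<le> 2"
  shows "v ^ e \<le> gauss_moment v (2 * e)"
proof -
  have "e = 0 \<or> e = 1 \<or> e = 2" using assms by auto
  then show ?thesis using assms by (auto simp: gauss_moment_values)
qed

lemma double_sum_product:
  fixes f g :: "'a \<Rightarrow> 'a \<Rightarrow> 'b :: semiring_0"
  shows "(\<Sum>i\<in>A. \<Sum>i'\<in>A. f i i') * (\<Sum>j\<in>A. \<Sum>j'\<in>A. g j j') =
    (\<Sum>i\<in>A. \<Sum>i'\<in>A. \<Sum>j\<in>A. \<Sum>j'\<in>A. f i i' * g j j')"
proof -
  have *: "(\<Sum>i\<in>A. \<Sum>i'\<in>A. f i i') * S = (\<Sum>i\<in>A. \<Sum>i'\<in>A. f i i' * S)" for S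
    by (simp only: sum_distrib_right)
  show ?thesis unfolding * by (simp only: sum_distrib_left)
qed

text \<open>The index form of one pairing among four copies of kernels: \<open>i\<close>,
  \<open>i'\<close> belong to the first kernel, \<open>j\<close>, \<open>j'\<close> to the second.
  Fixing the slots that are paired, instead of summing over all equivalent choices, only costs a
  constant factor.\<close>

definition linked :: "nat \<Rightarrow> (nat \<Rightarrow> nat) \<Rightarrow> (nat \<Rightarrow> nat) \<Rightarrow> (nat \<Rightarrow> nat) \<Rightarrow> (nat \<Rightarrow> nat) \<Rightarrow> bool" where
  "linked p i i' j j' \<longleftrightarrow> (\<forall>l<p. i l = i' l) \<and> (\<forall>l<p. j l = j' l) \<and> i p = j p \<and> i' p = j' p"

definition link_sum ::
  "nat \<Rightarrow> nat \<Rightarrow> (nat \<Rightarrow> real) \<Rightarrow> ((nat \<Rightarrow> nat) \<Rightarrow> real) \<Rightarrow> ((nat \<Rightarrow> nat) \<Rightarrow> real) \<Rightarrow> real" where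
  "link_sum p m v a b =
     (\<Sum>i\<in>inj_tuples (Suc p) m. \<Sum>i'\<in>inj_tuples (Suc p) m. \<Sum>j\<in>inj_tuples (Suc p) m. \<Sum>j'\<in>inj_tuples (Suc p) m.
        a i * a i' * b j * b j' *
        (of_bool (linked p i i' j j') * (v (i p) * v (i' p) * (\<Prod>l<p. v (i l)) * (\<Prod>l<p. v (j l)))))"

context gaussian_family begin

definition homogeneous_sum :: "nat \<Rightarrow> ((nat \<Rightarrow> nat) \<Rightarrow> real) \<Rightarrow> 'w \<Rightarrow> real" where
  "homogeneous_sum n a \<omega> = (\<Sum>i\<in>inj_tuples n m. a i * (\<Prod>l<n. \<xi> (i l) \<omega>))"

definition moment2 :: "nat \<Rightarrow> (nat \<Rightarrow> nat) \<Rightarrow> (nat \<Rightarrow> nat) \<Rightarrow> real" where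
  "moment2 n i j = (\<Prod>l<m. gauss_moment (v l) (occ n i l + occ n j l))"

definition moment4 ::
  "nat \<Rightarrow> (nat \<Rightarrow> nat) \<Rightarrow> (nat \<Rightarrow> nat) \<Rightarrow> (nat \<Rightarrow> nat) \<Rightarrow> (nat \<Rightarrow> nat) \<Rightarrow> real" where
  "moment4 n i i' j j' = (\<Prod>l<m. gauss_moment (v l) (occ n i l + occ n i' l + occ n j l + occ n j' l))"

lemma prod_\<xi>_tuple:
  "i \<in> inj_tuples n m \<Longrightarrow> (\<Prod>l<n. \<xi> (i l) \<omega>) = (\<Prod>l<m. \<xi> l \<omega> ^ occ n i l)"
  using prod_tuple_eq[of i n m n "\<lambda>l. \<xi> l \<omega>"] by simp

lemma expectation_tuple2:
  assumes "i \<in> inj_tuples n m" "j \<in> inj_tuples n m"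
  shows "(\<integral>\<omega>. (\<Prod>l<n. \<xi> (i l) \<omega>) * (\<Prod>l<n. \<xi> (j l) \<omega>) \<partial>M) = moment2 n i j"
  using assms expectation_monomial[of "\<lambda>l. occ n i l + occ n j l"]
  by (simp add: prod_\<xi>_tuple power_add prod.distrib moment2_def)

lemma expectation_tuple4:
  assumes "i \<in> inj_tuples n m" "i' \<in> inj_tuples n m" "j \<in> inj_tuples n m" "j' \<in> inj_tuples n m"
  shows "(\<integral>\<omega>. (\<Prod>l<n. \<xi> (i l) \<omega>) * (\<Prod>l<n. \<xi> (i' l) \<omega>) * (\<Prod>l<n. \<xi> (j l) \<omega>) * (\<Prod>l<n. \<xi> (j' l) \<omega>) \<partial>M)
    = moment4 n i i' j j'"
  using assms expectation_monomial[of "\<lambda>l. occ n i l + occ n i' l + occ n j l + occ n j' l"]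
  by (simp add: prod_\<xi>_tuple power_add prod.distrib moment4_def)

lemma moment2_same_range:
  assumes "i \<in> inj_tuples n m" "i ` {..<n} = j ` {..<n}"
  shows "moment2 n i j = (\<Prod>l<n. v (i l))"
proof -
  have "occ n j = occ n i" using assms by (simp add: occ_def fun_eq_iff)
  then have "moment2 n i j = (\<Prod>l<m. v l ^ occ n i l)"
    unfolding moment2_def using v_pos
    by (intro prod.cong refl) (auto simp: occ_def gauss_moment_values simp flip: numeral_2_eq_2)
  then show ?thesis using prod_tuple_eq[OF assms(1), of n v] by simp
qed

lemma moment2_eq_0:
  assumes "l < m" "l \<in> i ` {..<n} \<longleftrightarrow> l \<notin> j ` {..<n}"
  shows "moment2 n i j = 0"
  unfolding moment2_def
proof (rule prod_zero)
  show "\<exists>l\<in>{..<m}. gauss_moment (v l) (occ n i l + occ n j l) = 0"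
    using assms v_pos[OF assms(1)] by (intro bexI[of _ l]) (auto simp: occ_def gauss_moment_values)
qed simp

lemma moment2_mult_le_moment4: "moment2 n i i' * moment2 n j j' \<le> moment4 n i i' j j'"
  unfolding moment2_def moment4_def prod.distrib[symmetric]
  by (intro prod_mono conjI mult_nonneg_nonneg gauss_moment_nonneg gauss_moment_superadditive v_pos occ_le) auto

text \<open>The linked pairing must be gained on top of the disconnected one, because the covariance
  subtracts the latter. If \<open>i p\<close> differs from \<open>i' p\<close>, the variable
  \<open>i p\<close> occurs in \<open>i\<close> but not in \<open>i'\<close>, so the disconnected
  term is 0 and there is nothing to add to the link.\<close>

lemma moment4_linked:
  assumes i: "i \<in> inj_tuples (Suc p) m" "i' \<in> inj_tuples (Suc p) m"
    and j: "j \<in> inj_tuples (Suc p) m" "j' \<in> inj_tuples (Suc p) m"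
    and lnk: "linked p i i' j j'"
  shows "moment2 (Suc p) i i' * moment2 (Suc p) j j' +
      v (i p) * v (i' p) * (\<Prod>l<p. v (i l)) * (\<Prod>l<p. v (j l)) \<le> moment4 (Suc p) i i' j j'"
proof (cases "i p = i' p")
  case False
  have img: "i' ` {..<p} = i ` {..<p}" "j' ` {..<p} = j ` {..<p}"
    using lnk by (auto simp: linked_def image_iff)
  have notin: "i p \<notin> i ` {..<p}" "i' p \<notin> i ` {..<p}" "i p \<notin> j ` {..<p}" "i' p \<notin> j ` {..<p}"
    using inj_tuples_last_notin[OF i(1)] inj_tuples_last_notin[OF i(2)] inj_tuples_last_notin[OF j(1)]
      inj_tuples_last_notin[OF j(2)] lnk unfolding img linked_def by metis+
  have ps: "i p < m" "i' p < m" using i by (auto intro: inj_tuples_less)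
  have "moment2 (Suc p) i i' = 0"
    using False notin img ps by (intro moment2_eq_0[of "i p"]) (auto simp: lessThan_Suc)
  \<comment> \<open>Half the exponent of variable \<open>l\<close> in the four tuples: the last
    slots agree crosswise and each prefix occurs twice. It is at most 2, since \<open>i p\<close>
    and \<open>i' p\<close> are distinct and lie outside both prefixes.\<close>
  moreover define e where "e l = of_bool (l = i p) + of_bool (l = i' p) + occ p i l + occ p j l" for l
  have "v (i p) * v (i' p) * (\<Prod>l<p. v (i l)) * (\<Prod>l<p. v (j l)) = (\<Prod>l<m. v l ^ e l)"
  proof -
    have "v x = (\<Prod>l<m. v l ^ of_bool (l = x))" if "x < m" for x
      using that prod.delta[of "{..<m}" x v] by (simp add: if_distrib[of "\<lambda>k. _ ^ k"] of_bool_def cong: if_cong)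
    then show ?thesis
      using prod_tuple_eq[OF i(1), of p v] prod_tuple_eq[OF j(1), of p v] ps
      by (simp add: e_def power_add prod.distrib)
  qed
  moreover have "(\<Prod>l<m. v l ^ e l) \<le> moment4 (Suc p) i i' j j'"
    unfolding moment4_def
  proof (rule prod_mono)
    fix l assume "l \<in> {..<m}"
    then have l: "0 < v l" using v_pos by auto
    have split: "occ (Suc p) f l = of_bool (l = f p) + occ p f l" if "f p \<notin> f ` {..<p}" for f
      using that by (cases "l = f p") (simp_all add: occ_def lessThan_Suc)
    have "occ p i' l = occ p i l" "occ p j' l = occ p j l" "j p = i p" "j' p = i' p"
      using img lnk by (auto simp: occ_def linked_def)
    then have "occ (Suc p) i l + occ (Suc p) i' l + occ (Suc p) j l + occ (Suc p) j' l = 2 * e l"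
      using split[of i] split[of i'] split[of j] split[of j'] notin img by (simp add: e_def)
    moreover have "e l \<le> 2"
    proof (cases "l = i p \<or> l = i' p")
      case True
      then have "occ p i l = 0" "occ p j l = 0" using notin unfolding occ_def by (elim disjE; simp only: of_bool_eq)+
      then show ?thesis using False by (simp add: e_def)
    next
      case False
      then show ?thesis using occ_le[of p i l] occ_le[of p j l] by (simp add: e_def)
    qed
    ultimately show "0 \<le> v l ^ e l \<and> v l ^ e l \<le> gauss_moment (v l)
        (occ (Suc p) i l + occ (Suc p) i' l + occ (Suc p) j l + occ (Suc p) j' l)"
      using gauss_moment_double[OF l] l by simp
  qed
  ultimately show ?thesis by simp
next
  \<comment> \<open>The link is now a diagonal term; it is paid for by the factor \<open>3\<close> in the fourth moment of \<open>\<xi> (i p)\<close>.\<close>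
  case True
  have eq: "i' = i" "j' = j"
    using True lnk i j by (auto simp: linked_def less_Suc_eq intro!: inj_tuples_eqI)
  define x where "x = i p"
  have x: "x < m" "x = j p" using lnk inj_tuples_less[OF i(1), of p] by (auto simp: x_def linked_def)
  have occx: "occ (Suc p) i x = 1" "occ (Suc p) j x = 1"
    using x(2) by (auto simp: occ_def x_def lessThan_Suc)
  have W: "v (i p) * v (i' p) * (\<Prod>l<p. v (i l)) * (\<Prod>l<p. v (j l)) = (\<Prod>l<Suc p. v (i l)) * (\<Prod>l<Suc p. v (j l))"
    using True x by (simp add: x_def)
  also have "\<dots> = (\<Prod>l<m. v l ^ (occ (Suc p) i l + occ (Suc p) j l))"
    using prod_tuple_eq[OF i(1), of "Suc p" v] prod_tuple_eq[OF j(1), of "Suc p" v]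
    by (simp add: power_add prod.distrib)
  also have "\<dots> = v x ^ 2 * (\<Prod>l\<in>{..<m}-{x}. v l ^ (occ (Suc p) i l + occ (Suc p) j l))"
    using x(1) by (subst prod.remove[of _ x]) (auto simp: occx numeral_2_eq_2)
  finally have P: "v (i p) * v (i' p) * (\<Prod>l<p. v (i l)) * (\<Prod>l<p. v (j l)) =
    v x ^ 2 * (\<Prod>l\<in>{..<m}-{x}. v l ^ (occ (Suc p) i l + occ (Suc p) j l))" .
  have "moment4 (Suc p) i i' j j' = (\<Prod>l<m. gauss_moment (v l) (2 * (occ (Suc p) i l + occ (Suc p) j l)))"
    by (simp add: moment4_def eq mult_2 add.assoc)
  also have "\<dots> = 3 * (v x)\<^sup>2 * (\<Prod>l\<in>{..<m}-{x}. gauss_moment (v l) (2 * (occ (Suc p) i l + occ (Suc p) j l)))"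
    using x(1) v_pos[of x] by (subst prod.remove[of _ x]) (auto simp: occx gauss_moment_values)
  also have "\<dots> \<ge> 3 * (v x)\<^sup>2 * (\<Prod>l\<in>{..<m}-{x}. v l ^ (occ (Suc p) i l + occ (Suc p) j l))"
    using v_pos by (intro mult_left_mono prod_mono conjI gauss_moment_double zero_le_power) (auto simp: occ_def less_imp_le)
  finally have "3 * (v (i p) * v (i' p) * (\<Prod>l<p. v (i l)) * (\<Prod>l<p. v (j l))) \<le> moment4 (Suc p) i i' j j'"
    unfolding P by (simp add: mult.assoc)
  moreover have "moment2 (Suc p) i i' * moment2 (Suc p) j j' =
      v (i p) * v (i' p) * (\<Prod>l<p. v (i l)) * (\<Prod>l<p. v (j l))"
    unfolding W unfolding eq by (simp only: moment2_same_range[OF i(1) refl] moment2_same_range[OF j(1) refl])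
  moreover have "0 \<le> v (i p) * v (i' p) * (\<Prod>l<p. v (i l)) * (\<Prod>l<p. v (j l))"
    unfolding P using v_pos x(1) by (intro mult_nonneg_nonneg prod_nonneg zero_le_power) (auto simp: less_imp_le)
  ultimately show ?thesis by linarith
qed

lemma all_moments_homogeneous_sum: "all_moments M (homogeneous_sum n a)"
  unfolding homogeneous_sum_def[abs_def]
  by (intro all_moments_intros all_moments_\<xi>) (auto intro: inj_tuples_less)

lemma expectation_homogeneous2:
  "(\<integral>\<omega>. homogeneous_sum n a \<omega> * homogeneous_sum n b \<omega> \<partial>M) =
     (\<Sum>i\<in>inj_tuples n m. \<Sum>j\<in>inj_tuples n m. a i * b j * moment2 n i j)"
proof -
  have int: "integrable M (\<lambda>\<omega>. (\<Prod>l<n. \<xi> (i l) \<omega>) * (\<Prod>l<n. \<xi> (j l) \<omega>))"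
    if "i \<in> inj_tuples n m" "j \<in> inj_tuples n m" for i j
    using that by (intro all_moments_integrable all_moments_intros all_moments_\<xi>) (auto intro: inj_tuples_less)
  have "homogeneous_sum n a \<omega> * homogeneous_sum n b \<omega> = (\<Sum>i\<in>inj_tuples n m. \<Sum>j\<in>inj_tuples n m.
      a i * b j * ((\<Prod>l<n. \<xi> (i l) \<omega>) * (\<Prod>l<n. \<xi> (j l) \<omega>)))" for \<omega>
    unfolding homogeneous_sum_def sum_product by (simp add: mult_ac)
  then show ?thesis
    using int by (simp add: expectation_tuple2)
qed

lemma expectation_homogeneous4:
  "(\<integral>\<omega>. (homogeneous_sum n a \<omega>)\<^sup>2 * (homogeneous_sum n b \<omega>)\<^sup>2 \<partial>M) =
     (\<Sum>i\<in>inj_tuples n m. \<Sum>i'\<in>inj_tuples n m. \<Sum>j\<in>inj_tuples n m. \<Sum>j'\<in>inj_tuples n m.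
        a i * a i' * b j * b j' * moment4 n i i' j j')"
proof -
  have int: "integrable M (\<lambda>\<omega>. (\<Prod>l<n. \<xi> (i l) \<omega>) * (\<Prod>l<n. \<xi> (i' l) \<omega>) * (\<Prod>l<n. \<xi> (j l) \<omega>) * (\<Prod>l<n. \<xi> (j' l) \<omega>))"
    if "i \<in> inj_tuples n m" "i' \<in> inj_tuples n m" "j \<in> inj_tuples n m" "j' \<in> inj_tuples n m" for i i' j j'
    using that by (intro all_moments_integrable all_moments_intros all_moments_\<xi>) (auto intro: inj_tuples_less)
  have sq: "(homogeneous_sum n a \<omega>)\<^sup>2 = (\<Sum>i\<in>inj_tuples n m. \<Sum>i'\<in>inj_tuples n m.
      a i * (\<Prod>l<n. \<xi> (i l) \<omega>) * (a i' * (\<Prod>l<n. \<xi> (i' l) \<omega>)))" for a \<omega>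
    by (simp only: homogeneous_sum_def power2_eq_square sum_product)
  have "(homogeneous_sum n a \<omega>)\<^sup>2 * (homogeneous_sum n b \<omega>)\<^sup>2 =
      (\<Sum>i\<in>inj_tuples n m. \<Sum>i'\<in>inj_tuples n m. \<Sum>j\<in>inj_tuples n m. \<Sum>j'\<in>inj_tuples n m.
      a i * a i' * b j * b j' *
        ((\<Prod>l<n. \<xi> (i l) \<omega>) * (\<Prod>l<n. \<xi> (i' l) \<omega>) * (\<Prod>l<n. \<xi> (j l) \<omega>) * (\<Prod>l<n. \<xi> (j' l) \<omega>)))" for \<omega>
    unfolding sq double_sum_product by (simp add: mult_ac)
  then show ?thesis
    using int by (simp add: expectation_tuple4)
qed

lemma homogeneous_sum_covariance:
  assumes a: "\<And>i. i \<in> inj_tuples (Suc p) m \<Longrightarrow> 0 \<le> a i" and b: "\<And>i. i \<in> inj_tuples (Suc p) m \<Longrightarrow> 0 \<le> b i"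
  shows "(\<integral>\<omega>. (homogeneous_sum (Suc p) a \<omega>)\<^sup>2 \<partial>M) * (\<integral>\<omega>. (homogeneous_sum (Suc p) b \<omega>)\<^sup>2 \<partial>M) + link_sum p m v a b
    \<le> (\<integral>\<omega>. (homogeneous_sum (Suc p) a \<omega>)\<^sup>2 * (homogeneous_sum (Suc p) b \<omega>)\<^sup>2 \<partial>M)"
proof -
  let ?T = "inj_tuples (Suc p) m"
  have "(\<integral>\<omega>. (homogeneous_sum (Suc p) a \<omega>)\<^sup>2 \<partial>M) * (\<integral>\<omega>. (homogeneous_sum (Suc p) b \<omega>)\<^sup>2 \<partial>M) =
      (\<Sum>i\<in>?T. \<Sum>i'\<in>?T. \<Sum>j\<in>?T. \<Sum>j'\<in>?T. a i * a i' * b j * b j' * (moment2 (Suc p) i i' * moment2 (Suc p) j j'))"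
    unfolding power2_eq_square expectation_homogeneous2 double_sum_product
    by (simp add: mult_ac)
  then have "(\<integral>\<omega>. (homogeneous_sum (Suc p) a \<omega>)\<^sup>2 \<partial>M) * (\<integral>\<omega>. (homogeneous_sum (Suc p) b \<omega>)\<^sup>2 \<partial>M) + link_sum p m v a b =
      (\<Sum>i\<in>?T. \<Sum>i'\<in>?T. \<Sum>j\<in>?T. \<Sum>j'\<in>?T. a i * a i' * b j * b j' * (moment2 (Suc p) i i' * moment2 (Suc p) j j' +
        of_bool (linked p i i' j j') * (v (i p) * v (i' p) * (\<Prod>l<p. v (i l)) * (\<Prod>l<p. v (j l)))))"
    by (simp add: link_sum_def sum.distrib[symmetric] distrib_left)
  also have "\<dots> \<le> (\<Sum>i\<in>?T. \<Sum>i'\<in>?T. \<Sum>j\<in>?T. \<Sum>j'\<in>?T. a i * a i' * b j * b j' * moment4 (Suc p) i i' j j')"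
  proof (intro sum_mono mult_left_mono)
    fix i i' j j' assume *: "i \<in> ?T" "i' \<in> ?T" "j \<in> ?T" "j' \<in> ?T"
    show "moment2 (Suc p) i i' * moment2 (Suc p) j j' +
        of_bool (linked p i i' j j') * (v (i p) * v (i' p) * (\<Prod>l<p. v (i l)) * (\<Prod>l<p. v (j l)))
        \<le> moment4 (Suc p) i i' j j'"
      using moment4_linked[OF *] moment2_mult_le_moment4 by (cases "linked p i i' j j'") auto
    show "0 \<le> a i * a i' * b j * b j'" using * a b by simp
  qed
  finally show ?thesis by (simp add: expectation_homogeneous4)
qed

text \<open>Injective tuples with the same range differ by exactly one permutation, so the sum of
  indicators is 1; otherwise some variable occurs in just one of them and its mean is 0. In this
  form the isometry becomes a sum over permuted kernels.\<close>

lemma moment2_eq_permutations: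
  assumes i: "i \<in> inj_tuples n m" and j: "j \<in> inj_tuples n m"
  shows "moment2 n i j = (\<Sum>\<sigma> | \<sigma> permutes {..<n}. of_bool (j = i \<circ> \<sigma>)) * (\<Prod>l<n. v (i l))"
proof (cases "i ` {..<n} = j ` {..<n}")
  case True
  define \<sigma> where "\<sigma> l = (if l < n then inv_into {..<n} i (j l) else l)" for l
  have inj: "inj_on i {..<n}" "inj_on j {..<n}" using i j by (auto simp: inj_tuples_def)
  have mem: "j l \<in> i ` {..<n}" if "l < n" for l using True that by auto
  have "\<sigma> permutes {..<n}"
  proof (rule bij_imp_permutes)
    have "inj_on \<sigma> {..<n}"
      using inj mem by (auto simp: inj_on_def \<sigma>_def inv_into_injective dest!: inv_into_injective)
    moreover have "\<sigma> ` {..<n} \<subseteq> {..<n}"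
      using mem inv_into_into[of _ i "{..<n}"] by (auto simp: \<sigma>_def)
    ultimately show "bij_betw \<sigma> {..<n} {..<n}"
      by (simp add: bij_betw_def endo_inj_surj)
  qed (auto simp: \<sigma>_def)
  moreover have "j = i \<circ> \<sigma>"
    using \<open>\<sigma> permutes {..<n}\<close> i j mem
    by (intro inj_tuples_eqI[OF j inj_tuples_comp_permutes]) (auto simp: \<sigma>_def f_inv_into_f)
  moreover have "\<tau> = \<sigma>" if "\<tau> permutes {..<n}" "j = i \<circ> \<tau>" for \<tau>
  proof
    fix l
    show "\<tau> l = \<sigma> l"
    proof (cases "l < n")
      case True
      have "i (\<tau> l) = i (\<sigma> l)" using that \<open>j = i \<circ> \<sigma>\<close> by (metis comp_apply)
      moreover have "\<tau> l < n" "\<sigma> l < n"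
        using True that \<open>\<sigma> permutes {..<n}\<close> permutes_in_image by fastforce+
      ultimately show ?thesis using inj_tuples_eq_iff[OF i] by simp
    next
      case False
      then show ?thesis using that by (auto simp: \<sigma>_def permutes_def)
    qed
  qed
  ultimately have "{\<sigma>. \<sigma> permutes {..<n} \<and> j = i \<circ> \<sigma>} = {\<sigma>}" by blast
  then have "(\<Sum>\<sigma> | \<sigma> permutes {..<n}. of_bool (j = i \<circ> \<sigma>)) = (1::real)"
    by (simp add: finite_permutations sum.If_cases of_bool_def Int_def)
  then show ?thesis using moment2_same_range[OF i True] by simp
next
  case False
  then obtain l where l: "l \<in> i ` {..<n} \<longleftrightarrow> l \<notin> j ` {..<n}" by blast
  then have "l < m" using i j by (auto intro: inj_tuples_less)
  with l have "moment2 n i j = 0" by (rule moment2_eq_0[rotated])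
  moreover have "j \<noteq> i \<circ> \<sigma>" if "\<sigma> permutes {..<n}" for \<sigma>
    using False permutes_image[OF that] by (metis image_comp)
  ultimately show ?thesis by (auto intro!: sum.neutral)
qed

lemma homogeneous_sum_isometry:
  "(\<integral>\<omega>. homogeneous_sum n a \<omega> * homogeneous_sum n b \<omega> \<partial>M) =
     (\<Sum>\<sigma> | \<sigma> permutes {..<n}. \<Sum>i\<in>inj_tuples n m. a i * b (i \<circ> \<sigma>) * (\<Prod>l<n. v (i l)))"
proof -
  have "(\<Sum>j\<in>inj_tuples n m. a i * b j * moment2 n i j) =
      (\<Sum>\<sigma> | \<sigma> permutes {..<n}. a i * b (i \<circ> \<sigma>) * (\<Prod>l<n. v (i l)))" if i: "i \<in> inj_tuples n m" for i
  proof -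
    have "(\<Sum>j\<in>inj_tuples n m. a i * b j * moment2 n i j) =
      (\<Sum>j\<in>inj_tuples n m. \<Sum>\<sigma> | \<sigma> permutes {..<n}. if j = i \<circ> \<sigma> then a i * b j * (\<Prod>l<n. v (i l)) else 0)"
      using i by (simp add: moment2_eq_permutations sum_distrib_left sum_distrib_right of_bool_def
          if_distrib[of "\<lambda>x. _ * x"] if_distrib[of "\<lambda>x. x * _"] mult.assoc cong: if_cong sum.cong)
    also have "\<dots> = (\<Sum>\<sigma> | \<sigma> permutes {..<n}. \<Sum>j\<in>inj_tuples n m. if j = i \<circ> \<sigma> then a i * b j * (\<Prod>l<n. v (i l)) else 0)"
      by (rule sum.swap)
    also have "\<dots> = (\<Sum>\<sigma> | \<sigma> permutes {..<n}. a i * b (i \<circ> \<sigma>) * (\<Prod>l<n. v (i l)))"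
      using i by (intro sum.cong refl) (simp add: inj_tuples_comp_permutes)
    finally show ?thesis .
  qed
  then have "(\<integral>\<omega>. homogeneous_sum n a \<omega> * homogeneous_sum n b \<omega> \<partial>M) =
      (\<Sum>i\<in>inj_tuples n m. \<Sum>\<sigma> | \<sigma> permutes {..<n}. a i * b (i \<circ> \<sigma>) * (\<Prod>l<n. v (i l)))"
    by (simp add: expectation_homogeneous2)
  also have "\<dots> = (\<Sum>\<sigma> | \<sigma> permutes {..<n}. \<Sum>i\<in>inj_tuples n m. a i * b (i \<circ> \<sigma>) * (\<Prod>l<n. v (i l)))"
    by (rule sum.swap)
  finally show ?thesis .
qed

lemma homogeneous_sum_hypercontractive:
  "(\<integral>\<omega>. homogeneous_sum n a \<omega> ^ 4 \<partial>M) \<le> 9 ^ n * (\<integral>\<omega>. (homogeneous_sum n a \<omega>)\<^sup>2 \<partial>M)\<^sup>2"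
proof -
  \<comment> \<open>Tuples with the same range give the same monomial; collecting them yields a
    square-free polynomial of degree at most \<open>n\<close>.\<close>
  define c where "c A = (\<Sum>i | i \<in> inj_tuples n m \<and> i ` {..<n} = A. a i)" for A
  have "homogeneous_sum n a \<omega> = multilin {..<m} c \<omega>" for \<omega>
  proof -
    have img: "(\<lambda>i. i ` {..<n}) ` inj_tuples n m \<subseteq> Pow {..<m}"
      by (auto intro: inj_tuples_less)
    have "homogeneous_sum n a \<omega> = (\<Sum>A\<in>Pow {..<m}. \<Sum>i | i \<in> inj_tuples n m \<and> i ` {..<n} = A. a i * (\<Prod>l<n. \<xi> (i l) \<omega>))"
      unfolding homogeneous_sum_def using img by (subst sum.group) auto
    also have "\<dots> = multilin {..<m} c \<omega>"
      unfolding multilin_def c_def sum_distrib_right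
      by (intro sum.cong refl arg_cong2[of _ _ _ _ "(*)"])
         (auto simp: inj_tuples_def prod.reindex)
    finally show ?thesis .
  qed
  moreover have "c A = 0" if "n < card A" for A
  proof -
    have "{i. i \<in> inj_tuples n m \<and> i ` {..<n} = A} = {}"
      using that card_image_le[of "{..<n}"] by (auto simp: not_le[symmetric])
    then show ?thesis unfolding c_def by (auto intro!: sum.neutral)
  qed
  ultimately show ?thesis
    using multilin_hypercontractive[of "{..<m}" n c] by simp
qed

end

section \<open>Integrals of step functions\<close>

lemma (in brownian_motion) gaussian_family_increments:
  assumes "strict_mono_on {..m} s"
  shows "gaussian_family M m (\<lambda>l \<omega>. B (s (Suc l)) \<omega> - B (s l) \<omega>) (\<lambda>l. s (Suc l) - s l)"
proof unfold_locales
  have less: "s l < s (Suc l)" if "l < m" for l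
    using assms that by (auto simp: strict_mono_on_def)
  show "indep_vars (\<lambda>_. borel) (\<lambda>l \<omega>. B (s (Suc l)) \<omega> - B (s l) \<omega>) {..<m}"
    using assms by (rule indep_increments)
  show "distributed M lborel (\<lambda>\<omega>. B (s (Suc l)) \<omega> - B (s l) \<omega>) (normal_density 0 (sqrt (s (Suc l) - s l)))"
    if "l < m" for l using normal_increments[OF less[OF that]] .
  show "0 < s (Suc l) - s l" if "l < m" for l using less[OF that] by simp
qed

lemma sum_off_diagonal:
  assumes "off_diagonal n m s a"
  shows "(\<Sum>i \<in> {..<n} \<rightarrow>\<^sub>E {..<m}. a i * f i) = (\<Sum>i\<in>inj_tuples n m. a i * f i)"
  using assms
  by (intro sum.mono_neutral_right) (auto simp: off_diagonal_def inj_tuples_def finite_PiE)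

lemma (in brownian_motion) step_integral_eq_homogeneous_sum:
  assumes "off_diagonal n m s a"
  shows "step_integral B n m s a = gaussian_family.homogeneous_sum m (\<lambda>l \<omega>. B (s (Suc l)) \<omega> - B (s l) \<omega>) n a"
proof -
  interpret gaussian_family M m "\<lambda>l \<omega>. B (s (Suc l)) \<omega> - B (s l) \<omega>" "\<lambda>l. s (Suc l) - s l"
    using assms by (intro gaussian_family_increments) (simp add: off_diagonal_def)
  show ?thesis
    unfolding homogeneous_sum_def[abs_def] step_integral_def[abs_def] fun_eq_iff
    using sum_off_diagonal[OF assms] by simp
qed

section \<open>Step functions as elements of L^2 and permutations of coordinates\<close>

interpretation lborel_pow: product_sigma_finite "\<lambda>_::nat. lborel :: real measure"
  by standard

definition cell :: "nat \<Rightarrow> (nat \<Rightarrow> real) \<Rightarrow> (nat \<Rightarrow> nat) \<Rightarrow> (nat \<Rightarrow> real) \<Rightarrow> real" where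
  "cell n s i y = (\<Prod>l<n. indicator {s (i l)<..s (Suc (i l))} (y l))"

lemma step_function_eq_cells:
  "off_diagonal n m s a \<Longrightarrow> step_function n m s a y = (\<Sum>i\<in>inj_tuples n m. a i * cell n s i y)"
  by (simp add: step_function_def cell_def sum_off_diagonal)

lemma cell_measurable [measurable]: "cell n s i \<in> borel_measurable (lborel_pow n)"
  unfolding cell_def[abs_def] by measurable

lemma step_function_measurable [measurable]: "step_function n m s a \<in> borel_measurable (lborel_pow n)"
  unfolding step_function_def[abs_def] by measurable

lemma interval_indicator_mult:
  fixes s :: "nat \<Rightarrow> real"
  assumes s: "strict_mono_on {..m} s" and pq: "p < m" "q < m"
  shows "indicator {s p<..s (Suc p)} x * indicator {s q<..s (Suc q)} x =
    (of_bool (p = q) * indicator {s p<..s (Suc p)} x :: 'a :: linordered_semidom)"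
proof -
  have "s (Suc p) \<le> s q" if "p < q" using that strict_mono_on_leD[OF s] pq by simp
  moreover have "s (Suc q) \<le> s p" if "q < p" using that strict_mono_on_leD[OF s] pq by simp
  ultimately show ?thesis
    by (cases p q rule: linorder_cases) (auto simp: indicator_def)
qed

lemma cell_mult:
  assumes s: "strict_mono_on {..m} s" and i: "i \<in> inj_tuples n m" and j: "j \<in> inj_tuples n m"
  shows "cell n s i y * cell n s j y = of_bool (i = j) * cell n s i y"
proof (cases "i = j")
  case True
  then show ?thesis
    by (simp add: cell_def prod.distrib[symmetric] indicator_inter_arith[symmetric])
next
  case False
  then obtain l where l: "l < n" "i l \<noteq> j l"
    using inj_tuples_eqI[OF i j] by blast
  have "(indicator {s (i l)<..s (Suc (i l))} (y l) * indicator {s (j l)<..s (Suc (j l))} (y l) :: real) = 0"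
    using l i j by (subst interval_indicator_mult[OF s]) (auto intro: inj_tuples_less)
  then show ?thesis
    unfolding cell_def prod.distrib[symmetric] using l(1) False by (auto intro!: prod_zero)
qed

lemma cell_integral:
  assumes s: "strict_mono_on {..m} s" and i: "i \<in> inj_tuples n m"
  shows "has_bochner_integral (lborel_pow n) (cell n s i) (\<Prod>l<n. s (Suc (i l)) - s (i l))"
proof -
  have le: "s (i l) \<le> s (Suc (i l))" if "l < n" for l
    using strict_mono_on_leD[OF s] inj_tuples_less[OF i that] by simp
  have "(\<integral>\<^sup>+y. ennreal (cell n s i y) \<partial>lborel_pow n) =
      (\<integral>\<^sup>+y. (\<Prod>l<n. indicator {s (i l)<..s (Suc (i l))} (y l)) \<partial>lborel_pow n)"
    by (simp add: cell_def prod_ennreal[symmetric] ennreal_indicator)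
  also have "\<dots> = (\<Prod>l<n. \<integral>\<^sup>+x. indicator {s (i l)<..s (Suc (i l))} x \<partial>lborel)"
    by (subst lborel_pow.product_nn_integral_prod) auto
  also have "\<dots> = ennreal (\<Prod>l<n. s (Suc (i l)) - s (i l))"
    using le by (subst prod_ennreal[symmetric]) auto
  finally show ?thesis
    using le by (intro has_bochner_integral_nn_integral) (auto simp: cell_def intro!: prod_nonneg)
qed

lemma step_function_inner:
  assumes a: "off_diagonal n m s a" and b: "off_diagonal n m s b"
  shows "has_bochner_integral (lborel_pow n) (\<lambda>y. step_function n m s a y * step_function n m s b y)
    (\<Sum>i\<in>inj_tuples n m. a i * b i * (\<Prod>l<n. s (Suc (i l)) - s (i l)))"
proof -
  have s: "strict_mono_on {..m} s" using a by (simp add: off_diagonal_def)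
  have "step_function n m s a y * step_function n m s b y = (\<Sum>i\<in>inj_tuples n m. a i * b i * cell n s i y)" for y
  proof -
    have "step_function n m s a y * step_function n m s b y =
      (\<Sum>i\<in>inj_tuples n m. \<Sum>j\<in>inj_tuples n m. a i * b j * (cell n s i y * cell n s j y))"
      unfolding step_function_eq_cells[OF a] step_function_eq_cells[OF b] sum_product by (simp add: mult_ac)
    also have "\<dots> = (\<Sum>i\<in>inj_tuples n m. \<Sum>j\<in>inj_tuples n m. if i = j then a i * b i * cell n s i y else 0)"
      by (intro sum.cong refl) (auto simp: cell_mult[OF s])
    finally show ?thesis by simp
  qed
  then show ?thesis
    using cell_integral[OF s] by (auto intro!: has_bochner_integral_sum has_bochner_integral_mult_right)
qed

lemma square_integrable_step_function:
  "off_diagonal n m s a \<Longrightarrow> square_integrable (lborel_pow n) (step_function n m s a)"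
  using step_function_inner[of n m s a a] by (auto simp: square_integrable_def power2_eq_square integrable.simps)

text \<open>Enough to check on boxes: the preimage of a box is the box with its sides permuted by
  \<open>inv \<sigma>\<close>.\<close>

lemma distr_permute_lborel_pow:
  assumes \<sigma>: "\<sigma> permutes {..<n}"
  shows "distr (lborel_pow n) (lborel_pow n) (\<lambda>y. y \<circ> \<sigma>) = lborel_pow n"
proof (rule lborel_pow.PiM_eqI)
  have [measurable]: "(\<lambda>y. y \<circ> \<sigma>) \<in> measurable (lborel_pow n) (lborel_pow n)"
  proof (rule measurable_PiM_single')
    show "(\<lambda>y. y \<circ> \<sigma>) \<in> space (lborel_pow n) \<rightarrow> {..<n} \<rightarrow>\<^sub>E space lborel"
      using \<sigma> by (auto simp: space_PiM PiE_iff extensional_def permutes_def)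
  qed (use permutes_in_image[OF \<sigma>] in auto)
  fix A :: "nat \<Rightarrow> real set" assume A: "\<And>l. l \<in> {..<n} \<Longrightarrow> A l \<in> sets lborel"
  have inv: "inv \<sigma> permutes {..<n}" using \<sigma> by (rule permutes_inv)
  have A': "A (inv \<sigma> l) \<in> sets lborel" if "l < n" for l
    using A permutes_in_image[OF inv] that by auto
  have "(\<lambda>y. y \<circ> \<sigma>) -` Pi\<^sub>E {..<n} A \<inter> space (lborel_pow n) = (\<Pi>\<^sub>E l\<in>{..<n}. A (inv \<sigma> l))"
  proof (intro set_eqI iffI)
    fix y assume y: "y \<in> (\<lambda>y. y \<circ> \<sigma>) -` Pi\<^sub>E {..<n} A \<inter> space (lborel_pow n)"
    have "y l \<in> A (inv \<sigma> l)" if "l < n" for l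
    proof -
      have "(y \<circ> \<sigma>) (inv \<sigma> l) \<in> A (inv \<sigma> l)"
        using y permutes_in_image[OF inv] that by (auto simp: PiE_iff)
      then show ?thesis using permutes_inverses(1)[OF \<sigma>] by simp
    qed
    then show "y \<in> (\<Pi>\<^sub>E l\<in>{..<n}. A (inv \<sigma> l))" using y by (auto simp: space_PiM PiE_iff)
  next
    fix y assume y: "y \<in> (\<Pi>\<^sub>E l\<in>{..<n}. A (inv \<sigma> l))"
    have "y (\<sigma> l) \<in> A l" if "l < n" for l
    proof -
      have "y (\<sigma> l) \<in> A (inv \<sigma> (\<sigma> l))"
        using y permutes_in_image[OF \<sigma>, of l] that by (auto simp del: permutes_inverses simp: PiE_iff)
      then show ?thesis using permutes_inverses(2)[OF \<sigma>, of l] by simp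
    qed
    then show "y \<in> (\<lambda>y. y \<circ> \<sigma>) -` Pi\<^sub>E {..<n} A \<inter> space (lborel_pow n)"
      using y \<sigma> by (auto simp: space_PiM PiE_iff extensional_def permutes_def)
  qed
  moreover have box: "emeasure (lborel_pow n) (\<Pi>\<^sub>E l\<in>{..<n}. A (inv \<sigma> l)) = (\<Prod>l<n. emeasure lborel (A (inv \<sigma> l)))"
    by (rule lborel_pow.emeasure_PiM) (use A' in auto)
  ultimately have "emeasure (distr (lborel_pow n) (lborel_pow n) (\<lambda>y. y \<circ> \<sigma>)) (Pi\<^sub>E {..<n} A) =
      (\<Prod>l<n. emeasure lborel (A (inv \<sigma> l)))"
    using A A' by (subst emeasure_distr) (auto simp: sets_PiM_I_finite box)
  also have "\<dots> = (\<Prod>l<n. emeasure lborel (A l))"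
    using prod.permute[OF inv, of "\<lambda>l. emeasure lborel (A l)"] by (simp add: comp_def)
  finally show "emeasure (distr (lborel_pow n) (lborel_pow n) (\<lambda>y. y \<circ> \<sigma>)) (Pi\<^sub>E {..<n} A) =
      (\<Prod>l<n. emeasure lborel (A l))" .
qed auto

lemma measurable_permute_lborel_pow:
  assumes \<sigma>: "\<sigma> permutes {..<n}"
  shows "(\<lambda>y. y \<circ> \<sigma>) \<in> measurable (lborel_pow n) (lborel_pow n)"
proof (rule measurable_PiM_single')
  show "(\<lambda>y. y \<circ> \<sigma>) \<in> space (lborel_pow n) \<rightarrow> {..<n} \<rightarrow>\<^sub>E space lborel"
    using \<sigma> by (auto simp: space_PiM PiE_iff extensional_def permutes_def)
qed (use permutes_in_image[OF \<sigma>] in auto)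

lemma off_diagonal_permute:
  assumes "off_diagonal n m s a" and \<sigma>: "\<sigma> permutes {..<n}"
  shows "off_diagonal n m s (\<lambda>i. a (i \<circ> \<sigma>))"
proof -
  have "i \<circ> \<sigma> \<in> {..<n} \<rightarrow>\<^sub>E {..<m}" if "i \<in> {..<n} \<rightarrow>\<^sub>E {..<m}" for i
    using that \<sigma> permutes_in_image[OF \<sigma>] by (auto simp: PiE_iff extensional_def permutes_def)
  moreover have "inj_on i {..<n}" if "inj_on (i \<circ> \<sigma>) {..<n}" for i :: "nat \<Rightarrow> nat"
    using that inj_on_imageI[of i \<sigma> "{..<n}"] permutes_image[OF \<sigma>] by simp
  ultimately show ?thesis
    using assms unfolding off_diagonal_def by metis
qed

lemma step_function_permute:
  assumes a: "off_diagonal n m s a" and \<sigma>: "\<sigma> permutes {..<n}"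
  shows "step_function n m s (\<lambda>i. a (i \<circ> \<sigma>)) y = step_function n m s a (y \<circ> \<sigma>)"
proof -
  have inv: "inv \<sigma> permutes {..<n}" using \<sigma> by (rule permutes_inv)
  have comp: "\<sigma> \<circ> inv \<sigma> = id" "inv \<sigma> \<circ> \<sigma> = id" using permutes_inv_o[OF \<sigma>] by auto
  have "(\<Sum>i\<in>inj_tuples n m. a (i \<circ> \<sigma>) * cell n s i y) = (\<Sum>i\<in>inj_tuples n m. a i * cell n s (i \<circ> inv \<sigma>) y)"
    by (rule sum.reindex_bij_witness[of _ "\<lambda>i. i \<circ> inv \<sigma>" "\<lambda>i. i \<circ> \<sigma>"])
       (auto simp: comp inj_tuples_comp_permutes[OF _ \<sigma>] inj_tuples_comp_permutes[OF _ inv] comp_assoc)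
  moreover have "cell n s (i \<circ> inv \<sigma>) y = cell n s i (y \<circ> \<sigma>)" for i
    unfolding cell_def
    using prod.permute[OF \<sigma>, of "\<lambda>l. indicator {s ((i \<circ> inv \<sigma>) l)<..s (Suc ((i \<circ> inv \<sigma>) l))} (y l) :: real"]
    by (simp add: comp_def permutes_inverses[OF \<sigma>])
  ultimately show ?thesis
    by (simp add: step_function_eq_cells[OF a] step_function_eq_cells[OF off_diagonal_permute[OF a \<sigma>]])
qed

section \<open>The linked product of two kernels\<close>

text \<open>For symmetric \<open>f\<close>, \<open>g\<close> this is \<open>\<langle>f \<otimes>\<^sub>p f, g \<otimes>\<^sub>p g\<rangle>\<close>, the contraction over \<open>p\<close> of the
  \<open>p + 1\<close> variables.\<close>

definition linked_product :: "nat \<Rightarrow> ((nat \<Rightarrow> real) \<Rightarrow> real) \<Rightarrow> ((nat \<Rightarrow> real) \<Rightarrow> real) \<Rightarrow> ennreal" where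
  "linked_product p f g =
     (\<integral>\<^sup>+x. \<integral>\<^sup>+x'. (\<integral>\<^sup>+r. ennreal (f (r(p := x))) * ennreal (f (r(p := x'))) \<partial>lborel_pow p) *
        (\<integral>\<^sup>+r. ennreal (g (r(p := x))) * ennreal (g (r(p := x'))) \<partial>lborel_pow p) \<partial>lborel \<partial>lborel)"

lemma nn_integral_interval_indicator_mult:
  fixes s :: "nat \<Rightarrow> real"
  assumes s: "strict_mono_on {..m} s" and pq: "p < m" "q < m"
  shows "(\<integral>\<^sup>+x. indicator {s p<..s (Suc p)} x * indicator {s q<..s (Suc q)} x \<partial>lborel)
    = of_bool (p = q) * ennreal (s (Suc p) - s p)"
proof -
  have "indicator {s p<..s (Suc p)} x * indicator {s q<..s (Suc q)} x =
      (of_bool (p = q) * indicator {s p<..s (Suc p)} x :: ennreal)" for x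
    using interval_indicator_mult[OF s pq, of x, where 'a = real] by (auto simp: indicator_def split: if_splits)
  moreover have "s p \<le> s (Suc p)" using strict_mono_on_leD[OF s] pq by simp
  ultimately show ?thesis by (simp add: nn_integral_cmult)
qed

text \<open>Cells of one grid are orthogonal. The inner integrals over the \<open>p\<close> shared
  variables therefore match the prefixes of \<open>i\<close>, \<open>i'\<close> and of
  \<open>j\<close>, \<open>j'\<close>, and the outer integrals over \<open>x\<close> and
  \<open>x'\<close> match the last slots crosswise; together this is \<open>linked\<close>.\<close>

lemma linked_product_step:
  assumes a: "off_diagonal (Suc p) m s a" "nonneg_coeff (Suc p) m a"
    and b: "off_diagonal (Suc p) m s b" "nonneg_coeff (Suc p) m b"
  shows "linked_product p (step_function (Suc p) m s a) (step_function (Suc p) m s b)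
    = ennreal (link_sum p m (\<lambda>l. s (Suc l) - s l) a b)"
proof -
  define T where "T = inj_tuples (Suc p) m"
  define v where "v l = s (Suc l) - s l" for l
  define J where "J k = (indicator {s k<..s (Suc k)} :: real \<Rightarrow> ennreal)" for k
  have s: "strict_mono_on {..m} s" using a by (simp add: off_diagonal_def)
  have v: "0 \<le> v k" if "k < m" for k using strict_mono_on_leD[OF s] that by (simp add: v_def)
  have lt: "i l < m" if "i \<in> T" "l \<le> p" for i l using that by (auto simp: T_def intro: inj_tuples_less)
  have [measurable]: "J k \<in> borel_measurable borel" for k by (simp add: J_def)
  have JJ: "(\<integral>\<^sup>+x. J k x * J k' x \<partial>lborel) = of_bool (k = k') * ennreal (v k)" if "k < m" "k' < m" for k k'
    unfolding J_def v_def using that by (rule nn_integral_interval_indicator_mult[OF s])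
  have step: "ennreal (step_function (Suc p) m s c (r(p := x))) = (\<Sum>i\<in>T. ennreal (c i) * (\<Prod>l<p. J (i l) (r l)) * J (i p) x)"
    if "off_diagonal (Suc p) m s c" and c: "nonneg_coeff (Suc p) m c" for c r x
  proof -
    have "cell (Suc p) s i (r(p := x)) = (\<Prod>l<p. indicator {s (i l)<..s (Suc (i l))} (r l)) * indicator {s (i p)<..s (Suc (i p))} x" for i
      by (simp add: cell_def)
    moreover have "0 \<le> c i" if "i \<in> T" for i
      using c that by (auto simp: nonneg_coeff_def T_def inj_tuples_def)
    ultimately show ?thesis
      unfolding step_function_eq_cells[OF that(1)] T_def[symmetric]
      by (subst sum_ennreal[symmetric])
         (auto simp: ennreal_mult' prod_nonneg J_def prod_ennreal[symmetric] ennreal_indicator mult.assoc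
            intro!: sum.cong mult_nonneg_nonneg)
  qed
  have inner: "(\<integral>\<^sup>+r. ennreal (step_function (Suc p) m s c (r(p := x))) * ennreal (step_function (Suc p) m s c (r(p := x'))) \<partial>lborel_pow p)
      = (\<Sum>i\<in>T. \<Sum>i'\<in>T. ennreal (c i) * ennreal (c i') * (of_bool (\<forall>l<p. i l = i' l) * (\<Prod>l<p. ennreal (v (i l)))) * (J (i p) x * J (i' p) x'))"
    if "off_diagonal (Suc p) m s c" "nonneg_coeff (Suc p) m c" for c x x'
  proof -
    have "ennreal (step_function (Suc p) m s c (r(p := x))) * ennreal (step_function (Suc p) m s c (r(p := x'))) =
      (\<Sum>i\<in>T. \<Sum>i'\<in>T. (ennreal (c i) * ennreal (c i') * (J (i p) x * J (i' p) x')) * (\<Prod>l<p. J (i l) (r l) * J (i' l) (r l)))" for r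
      unfolding step[OF that] sum_product by (simp add: prod.distrib mult_ac)
    then have "(\<integral>\<^sup>+r. ennreal (step_function (Suc p) m s c (r(p := x))) * ennreal (step_function (Suc p) m s c (r(p := x'))) \<partial>lborel_pow p)
      = (\<Sum>i\<in>T. \<Sum>i'\<in>T. (ennreal (c i) * ennreal (c i') * (J (i p) x * J (i' p) x')) *
          (\<integral>\<^sup>+r. (\<Prod>l<p. J (i l) (r l) * J (i' l) (r l)) \<partial>lborel_pow p))"
      by (simp add: nn_integral_sum nn_integral_cmult)
    also have "\<dots> = (\<Sum>i\<in>T. \<Sum>i'\<in>T. (ennreal (c i) * ennreal (c i') * (J (i p) x * J (i' p) x')) *
          (of_bool (\<forall>l<p. i l = i' l) * (\<Prod>l<p. ennreal (v (i l)))))"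
    proof (intro sum.cong refl arg_cong2[of _ _ _ _ "(*)"])
      fix i i' assume i: "i \<in> T" "i' \<in> T"
      have "(\<integral>\<^sup>+r. (\<Prod>l<p. J (i l) (r l) * J (i' l) (r l)) \<partial>lborel_pow p) = (\<Prod>l<p. of_bool (i l = i' l) * ennreal (v (i l)))"
        using lt i by (subst lborel_pow.product_nn_integral_prod) (auto intro!: prod.cong JJ)
      also have "\<dots> = of_bool (\<forall>l<p. i l = i' l) * (\<Prod>l<p. ennreal (v (i l)))"
        by (auto simp: prod.distrib intro!: prod_zero)
      finally show "(\<integral>\<^sup>+r. (\<Prod>l<p. J (i l) (r l) * J (i' l) (r l)) \<partial>lborel_pow p) =
          of_bool (\<forall>l<p. i l = i' l) * (\<Prod>l<p. ennreal (v (i l)))" .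
    qed
    finally show ?thesis by (simp add: mult_ac)
  qed
  have "linked_product p (step_function (Suc p) m s a) (step_function (Suc p) m s b) =
      (\<integral>\<^sup>+x. \<integral>\<^sup>+x'. (\<Sum>i\<in>T. \<Sum>i'\<in>T. \<Sum>j\<in>T. \<Sum>j'\<in>T.
        (ennreal (a i) * ennreal (a i') * (of_bool (\<forall>l<p. i l = i' l) * (\<Prod>l<p. ennreal (v (i l)))) *
        (ennreal (b j) * ennreal (b j') * (of_bool (\<forall>l<p. j l = j' l) * (\<Prod>l<p. ennreal (v (j l)))))) *
        ((J (i p) x * J (j p) x) * (J (i' p) x' * J (j' p) x'))) \<partial>lborel \<partial>lborel)"
    unfolding linked_product_def inner[OF a] inner[OF b] double_sum_product by (simp only: mult_ac)
  also have "\<dots> = (\<Sum>i\<in>T. \<Sum>i'\<in>T. \<Sum>j\<in>T. \<Sum>j'\<in>T.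
        (ennreal (a i) * ennreal (a i') * (of_bool (\<forall>l<p. i l = i' l) * (\<Prod>l<p. ennreal (v (i l)))) *
        (ennreal (b j) * ennreal (b j') * (of_bool (\<forall>l<p. j l = j' l) * (\<Prod>l<p. ennreal (v (j l)))))) *
        ((\<integral>\<^sup>+x. J (i p) x * J (j p) x \<partial>lborel) * (\<integral>\<^sup>+x. J (i' p) x * J (j' p) x \<partial>lborel)))"
    by (simp add: nn_integral_sum nn_integral_cmult nn_integral_multc)
  also have "\<dots> = (\<Sum>i\<in>T. \<Sum>i'\<in>T. \<Sum>j\<in>T. \<Sum>j'\<in>T. ennreal (a i * a i' * b j * b j' *
        (of_bool (linked p i i' j j') * (v (i p) * v (i' p) * (\<Prod>l<p. v (i l)) * (\<Prod>l<p. v (j l))))))"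
  proof (intro sum.cong refl)
    fix i i' j j' assume *: "i \<in> T" "i' \<in> T" "j \<in> T" "j' \<in> T"
    then have nn: "0 \<le> a i" "0 \<le> a i'" "0 \<le> b j" "0 \<le> b j'"
      using a b by (auto simp: nonneg_coeff_def T_def inj_tuples_def)
    have vv: "0 \<le> v (i p)" "0 \<le> v (i' p)" "0 \<le> (\<Prod>l<p. v (i l))" "0 \<le> (\<Prod>l<p. v (j l))"
      using * lt v by (auto intro!: prod_nonneg)
    have pp: "(\<Prod>l<p. ennreal (v (i l))) = ennreal (\<Prod>l<p. v (i l))" "(\<Prod>l<p. ennreal (v (j l))) = ennreal (\<Prod>l<p. v (j l))"
      using * lt v by (auto intro!: prod_ennreal)
    show "(ennreal (a i) * ennreal (a i') * (of_bool (\<forall>l<p. i l = i' l) * (\<Prod>l<p. ennreal (v (i l)))) *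
        (ennreal (b j) * ennreal (b j') * (of_bool (\<forall>l<p. j l = j' l) * (\<Prod>l<p. ennreal (v (j l)))))) *
        ((\<integral>\<^sup>+x. J (i p) x * J (j p) x \<partial>lborel) * (\<integral>\<^sup>+x. J (i' p) x * J (j' p) x \<partial>lborel)) =
      ennreal (a i * a i' * b j * b j' *
        (of_bool (linked p i i' j j') * (v (i p) * v (i' p) * (\<Prod>l<p. v (i l)) * (\<Prod>l<p. v (j l)))))"
    proof (cases "linked p i i' j j'")
      case True
      then have "\<forall>l<p. i l = i' l" "\<forall>l<p. j l = j' l" "i p = j p" "i' p = j' p" by (auto simp: linked_def)
      moreover have "(\<integral>\<^sup>+x. J (i p) x * J (j p) x \<partial>lborel) = of_bool (i p = j p) * ennreal (v (i p))"
        "(\<integral>\<^sup>+x. J (i' p) x * J (j' p) x \<partial>lborel) = of_bool (i' p = j' p) * ennreal (v (i' p))"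
        using * lt by (intro JJ; simp)+
      moreover define P Q where "P = (\<Prod>l<p. v (i l))" "Q = (\<Prod>l<p. v (j l))"
      ultimately show ?thesis
        unfolding pp P_Q_def[symmetric] using True nn vv[folded P_Q_def]
        by (simp add: ennreal_mult[symmetric] mult_ac)
    next
      case False
      then show ?thesis
        using * lt by (auto simp: JJ linked_def)
    qed
  qed
  also have "\<dots> = ennreal (link_sum p m v a b)"
  proof -
    have nn: "0 \<le> a i * a i' * b j * b j' *
        (of_bool (linked p i i' j j') * (v (i p) * v (i' p) * (\<Prod>l<p. v (i l)) * (\<Prod>l<p. v (j l))))"
      if "i \<in> T" "i' \<in> T" "j \<in> T" "j' \<in> T" for i i' j j'
      using that a b lt v
      by (intro mult_nonneg_nonneg prod_nonneg) (auto simp: nonneg_coeff_def T_def inj_tuples_def)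
    show ?thesis
      unfolding link_sum_def T_def[symmetric] using nn by (simp add: sum_ennreal sum_nonneg)
  qed
  finally show ?thesis by (simp add: v_def[abs_def])
qed

section \<open>Limits in \<open>L\<^sup>2\<close>\<close>

lemma tendsto_0_squeeze:
  fixes f g :: "nat \<Rightarrow> real"
  assumes "\<And>k. f k \<le> g k" "g \<longlonglongrightarrow> 0" "\<And>k. 0 \<le> f k"
  shows "f \<longlonglongrightarrow> 0"
  by (rule tendsto_sandwich[of "\<lambda>_. 0" f sequentially g]) (use assms in auto)

lemma tendsto_0_if_square:
  fixes f :: "nat \<Rightarrow> real"
  assumes "(\<lambda>k. (f k)\<^sup>2) \<longlonglongrightarrow> 0"
  shows "f \<longlonglongrightarrow> 0"
  using tendsto_real_sqrt[OF assms] by (simp add: tendsto_rabs_zero_iff)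

lemma square_integrable_linear:
  assumes f: "square_integrable M f" and g: "square_integrable M g"
  shows "square_integrable M (\<lambda>x. c * f x + d * g x)"
  unfolding square_integrable_def
proof
  have m: "f \<in> borel_measurable M" "g \<in> borel_measurable M"
    and i: "integrable M (\<lambda>x. (f x)\<^sup>2)" "integrable M (\<lambda>x. (g x)\<^sup>2)"
    using f g by (auto simp: square_integrable_def)
  show "(\<lambda>x. c * f x + d * g x) \<in> borel_measurable M" using m by simp
  have "(c * f x + d * g x)\<^sup>2 = c\<^sup>2 * (f x)\<^sup>2 + 2 * c * d * (f x * g x) + d\<^sup>2 * (g x)\<^sup>2" for x
    by (simp add: power2_eq_square algebra_simps)
  then show "integrable M (\<lambda>x. (c * f x + d * g x)\<^sup>2)"
    using i integrable_mult_of_squares[OF m i] by simp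
qed

lemma square_integrable_diff:
  "square_integrable M f \<Longrightarrow> square_integrable M g \<Longrightarrow> square_integrable M (\<lambda>x. f x - g x)"
  using square_integrable_linear[of M f g 1 "-1"] by simp

lemma square_integrable_inner:
  "square_integrable M f \<Longrightarrow> square_integrable M g \<Longrightarrow> integrable M (\<lambda>x. f x * g x)"
  by (auto simp: square_integrable_def intro: integrable_mult_of_squares)

lemma integral_sum_square_le:
  fixes f g :: "'a \<Rightarrow> real"
  assumes f: "square_integrable M f" and g: "square_integrable M g"
  shows "(\<integral>x. (f x + g x)\<^sup>2 \<partial>M) \<le> 2 * (\<integral>x. (f x)\<^sup>2 \<partial>M) + 2 * (\<integral>x. (g x)\<^sup>2 \<partial>M)"
proof -
  have "(\<integral>x. (f x + g x)\<^sup>2 \<partial>M) \<le> (\<integral>x. 2 * (f x)\<^sup>2 + 2 * (g x)\<^sup>2 \<partial>M)"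
  proof (rule integral_mono)
    show "integrable M (\<lambda>x. (f x + g x)\<^sup>2)"
      using square_integrable_linear[OF f g, of 1 1] by (simp add: square_integrable_def)
    show "integrable M (\<lambda>x. 2 * (f x)\<^sup>2 + 2 * (g x)\<^sup>2)" using f g by (auto simp: square_integrable_def)
    fix x show "(f x + g x)\<^sup>2 \<le> 2 * (f x)\<^sup>2 + 2 * (g x)\<^sup>2"
      using zero_le_power2[of "f x - g x"] unfolding power2_eq_square by (simp add: algebra_simps)
  qed
  then show ?thesis using f g by (simp add: square_integrable_def)
qed

lemma L2_tendsto_linear:
  assumes F: "L2_tendsto M F f" and G: "L2_tendsto M G g"
  shows "L2_tendsto M (\<lambda>k x. c * F k x + d * G k x) (\<lambda>x. c * f x + d * g x)"
  unfolding L2_tendsto_def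
proof (intro conjI allI)
  note si = F[unfolded L2_tendsto_def, THEN conjunct1, rule_format] F[unfolded L2_tendsto_def, THEN conjunct2, THEN conjunct1]
    G[unfolded L2_tendsto_def, THEN conjunct1, rule_format] G[unfolded L2_tendsto_def, THEN conjunct2, THEN conjunct1]
  show "square_integrable M (\<lambda>x. c * F k x + d * G k x)" "square_integrable M (\<lambda>x. c * f x + d * g x)" for k
    using si by (auto intro: square_integrable_linear)
  have "(\<integral>x. (c * F k x + d * G k x - (c * f x + d * g x))\<^sup>2 \<partial>M) \<le>
      2 * (c\<^sup>2 * (\<integral>x. (F k x - f x)\<^sup>2 \<partial>M)) + 2 * (d\<^sup>2 * (\<integral>x. (G k x - g x)\<^sup>2 \<partial>M))" for k
  proof -
    have "square_integrable M (\<lambda>x. c * (F k x - f x))" "square_integrable M (\<lambda>x. d * (G k x - g x))"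
      using square_integrable_linear[OF square_integrable_diff square_integrable_diff, of M "F k" f "F k" f c 0]
        square_integrable_linear[OF square_integrable_diff square_integrable_diff, of M "G k" g "G k" g d 0] si by auto
    from integral_sum_square_le[OF this] show ?thesis
      by (simp only: add_diff_add right_diff_distrib[symmetric] power_mult_distrib integral_mult_right_zero)
  qed
  moreover have "(\<lambda>k. 2 * (c\<^sup>2 * (\<integral>x. (F k x - f x)\<^sup>2 \<partial>M)) + 2 * (d\<^sup>2 * (\<integral>x. (G k x - g x)\<^sup>2 \<partial>M))) \<longlonglongrightarrow> 0"
    using F G by (auto simp: L2_tendsto_def intro!: tendsto_eq_intros)
  ultimately show "(\<lambda>k. \<integral>x. (c * F k x + d * G k x - (c * f x + d * g x))\<^sup>2 \<partial>M) \<longlonglongrightarrow> 0"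
    by (rule tendsto_0_squeeze) auto
qed

lemma integral_mult_tendsto_0:
  fixes u w :: "nat \<Rightarrow> 'a \<Rightarrow> real"
  assumes u: "\<And>k. square_integrable M (u k)" "(\<lambda>k. \<integral>x. (u k x)\<^sup>2 \<partial>M) \<longlonglongrightarrow> 0"
    and w: "\<And>k. square_integrable M (w k)" "\<And>k. (\<integral>x. (w k x)\<^sup>2 \<partial>M) \<le> C"
  shows "(\<lambda>k. \<integral>x. u k x * w k x \<partial>M) \<longlonglongrightarrow> 0"
proof -
  have "(\<integral>x. u k x * w k x \<partial>M)\<^sup>2 \<le> (\<integral>x. (u k x)\<^sup>2 \<partial>M) * C" for k
  proof -
    have "(\<integral>x. u k x * w k x \<partial>M)\<^sup>2 \<le> (\<integral>x. (u k x)\<^sup>2 \<partial>M) * (\<integral>x. (w k x)\<^sup>2 \<partial>M)"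
      using u(1)[of k] w(1)[of k] by (intro integral_Cauchy_Schwarz) (auto simp: square_integrable_def)
    also have "\<dots> \<le> (\<integral>x. (u k x)\<^sup>2 \<partial>M) * C" using w(2) by (intro mult_left_mono) auto
    finally show ?thesis .
  qed
  moreover have "(\<lambda>k. (\<integral>x. (u k x)\<^sup>2 \<partial>M) * C) \<longlonglongrightarrow> 0" using u(2) by (auto intro!: tendsto_eq_intros)
  ultimately have "(\<lambda>k. (\<integral>x. u k x * w k x \<partial>M)\<^sup>2) \<longlonglongrightarrow> 0"
    by (rule tendsto_0_squeeze) auto
  then show ?thesis by (rule tendsto_0_if_square)
qed

lemma L2_tendstoD:
  assumes "L2_tendsto M F f"
  shows "square_integrable M (F k)" "square_integrable M f" "(\<lambda>k. \<integral>x. (F k x - f x)\<^sup>2 \<partial>M) \<longlonglongrightarrow> 0"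
    "F k \<in> borel_measurable M" "f \<in> borel_measurable M"
    "integrable M (\<lambda>x. (F k x)\<^sup>2)" "integrable M (\<lambda>x. (f x)\<^sup>2)"
  using assms by (auto simp: L2_tendsto_def square_integrable_def)

lemma L2_tendsto_bounded:
  assumes "L2_tendsto M F f"
  obtains C where "\<forall>k. (\<integral>x. (F k x)\<^sup>2 \<partial>M) \<le> C"
proof -
  note D = L2_tendstoD[OF assms]
  have "Bseq (\<lambda>k. \<integral>x. (F k x - f x)\<^sup>2 \<partial>M)" using D(3) by (intro convergent_imp_Bseq convergentI)
  then obtain K where K: "\<And>k. norm (\<integral>x. (F k x - f x)\<^sup>2 \<partial>M) \<le> K" by (auto simp: Bseq_def)
  have "(\<integral>x. (F k x)\<^sup>2 \<partial>M) \<le> 2 * K + 2 * (\<integral>x. (f x)\<^sup>2 \<partial>M)" for k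
    using integral_sum_square_le[OF square_integrable_diff[OF D(1)[of k] D(2)] D(2)] K[of k] by simp
  then show thesis using that by blast
qed

lemma L2_tendsto_inner:
  assumes F: "L2_tendsto M F f" and G: "L2_tendsto M G g"
  shows "(\<lambda>k. \<integral>x. F k x * G k x \<partial>M) \<longlonglongrightarrow> (\<integral>x. f x * g x \<partial>M)"
proof -
  note DF = L2_tendstoD[OF F] and DG = L2_tendstoD[OF G]
  obtain C where C: "\<forall>k. (\<integral>x. (G k x)\<^sup>2 \<partial>M) \<le> C" by (rule L2_tendsto_bounded[OF G])
  have 1: "(\<lambda>k. \<integral>x. (F k x - f x) * G k x \<partial>M) \<longlonglongrightarrow> 0"
    using DF DG C by (intro integral_mult_tendsto_0[where C = C] square_integrable_diff) auto
  have 2: "(\<lambda>k. \<integral>x. (G k x - g x) * f x \<partial>M) \<longlonglongrightarrow> 0"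
    using DF DG by (intro integral_mult_tendsto_0[where C = "\<integral>x. (f x)\<^sup>2 \<partial>M"] square_integrable_diff) auto
  \<comment> \<open>The difference of the products is split so that in each summand one factor tends
    to 0 and the other stays bounded in L^2.\<close>
  have "(\<integral>x. F k x * G k x \<partial>M) = (\<integral>x. (F k x - f x) * G k x \<partial>M) + (\<integral>x. (G k x - g x) * f x \<partial>M) + (\<integral>x. f x * g x \<partial>M)" for k
  proof -
    have "(\<integral>x. (F k x - f x) * G k x + (G k x - g x) * f x + f x * g x \<partial>M) =
      (\<integral>x. (F k x - f x) * G k x \<partial>M) + (\<integral>x. (G k x - g x) * f x \<partial>M) + (\<integral>x. f x * g x \<partial>M)"
      using square_integrable_inner[OF square_integrable_diff[OF DF(1)[of k] DF(2)] DG(1)[of k]]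
        square_integrable_inner[OF square_integrable_diff[OF DG(1)[of k] DG(2)] DF(2)] square_integrable_inner[OF DF(2) DG(2)]
      by (simp add: Bochner_Integration.integral_add Bochner_Integration.integrable_add)
    then show ?thesis by (simp add: algebra_simps)
  qed
  then show ?thesis using tendsto_add[OF tendsto_add[OF 1 2] tendsto_const] by simp
qed

lemma L2_tendsto_AE_subseq:
  assumes "L2_tendsto M F f"
  obtains r :: "nat \<Rightarrow> nat" where "strict_mono r" "AE x in M. (\<lambda>k. F (r k) x) \<longlonglongrightarrow> f x"
proof -
  note D = L2_tendstoD[OF assms]
  have "\<exists>r::nat \<Rightarrow> nat. strict_mono r \<and> (AE x in M. (\<lambda>n. (F (r n) x - f x)\<^sup>2) \<longlonglongrightarrow> 0)"
    using D square_integrable_diff[OF D(1) D(2)]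
    by (intro tendsto_L1_AE_subseq) (auto simp: square_integrable_def)
  then obtain r :: "nat \<Rightarrow> nat" where r: "strict_mono r" "AE x in M. (\<lambda>n. (F (r n) x - f x)\<^sup>2) \<longlonglongrightarrow> 0" by auto
  have "AE x in M. (\<lambda>k. F (r k) x) \<longlonglongrightarrow> f x"
    using r(2)
  proof eventually_elim
    fix x assume "(\<lambda>n. (F (r n) x - f x)\<^sup>2) \<longlonglongrightarrow> 0"
    then have "(\<lambda>n. F (r n) x - f x) \<longlonglongrightarrow> 0" by (rule tendsto_0_if_square)
    then show "(\<lambda>k. F (r k) x) \<longlonglongrightarrow> f x" by (simp add: LIM_zero_iff)
  qed
  with r show thesis by (intro that)
qed

lemma L2_tendsto_subseq:
  "L2_tendsto M F f \<Longrightarrow> strict_mono r \<Longrightarrow> L2_tendsto M (\<lambda>k. F (r k)) f"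
  unfolding L2_tendsto_def using LIMSEQ_subseq_LIMSEQ[of _ 0 r] by (auto simp: comp_def)

lemma L2_tendsto_permute:
  assumes F: "L2_tendsto (lborel_pow n) F f" and \<sigma>: "\<sigma> permutes {..<n}"
  shows "L2_tendsto (lborel_pow n) (\<lambda>k y. F k (y \<circ> \<sigma>)) (\<lambda>y. f (y \<circ> \<sigma>))"
proof -
  note D = L2_tendstoD[OF F]
  note [measurable] = measurable_permute_lborel_pow[OF \<sigma>] D(4,5)
  have int: "integrable (lborel_pow n) (\<lambda>y. h (y \<circ> \<sigma>)) \<longleftrightarrow> integrable (lborel_pow n) h"
    "(\<integral>y. h (y \<circ> \<sigma>) \<partial>lborel_pow n) = (\<integral>y. h y \<partial>lborel_pow n)"
    if [measurable]: "h \<in> borel_measurable (lborel_pow n)" for h :: "(nat \<Rightarrow> real) \<Rightarrow> real"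
    using integrable_distr_eq[OF measurable_permute_lborel_pow[OF \<sigma>] that]
      integral_distr[OF measurable_permute_lborel_pow[OF \<sigma>] that]
    by (simp_all add: distr_permute_lborel_pow[OF \<sigma>])
  show ?thesis
    unfolding L2_tendsto_def square_integrable_def
    using D int(1)[of "\<lambda>y. (F _ y)\<^sup>2"] int(1)[of "\<lambda>y. (f y)\<^sup>2"] int(2)[of "\<lambda>y. (F _ y - f y)\<^sup>2"]
    by auto
qed

section \<open>Moments of multiple Wiener--Ito integrals\<close>

text \<open>At every point at most one cell is nonzero, so the positive part may be taken
  coefficient by coefficient.\<close>

lemma step_function_pos_part:
  assumes a: "off_diagonal n m s a"
  shows "step_function n m s (\<lambda>i. max 0 (a i)) y = max 0 (step_function n m s a y)"
    and "off_diagonal n m s (\<lambda>i. max 0 (a i))" and "nonneg_coeff n m (\<lambda>i. max 0 (a i))"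
proof -
  show off: "off_diagonal n m s (\<lambda>i. max 0 (a i))" and "nonneg_coeff n m (\<lambda>i. max 0 (a i))"
    using a by (auto simp: off_diagonal_def nonneg_coeff_def)
  have s: "strict_mono_on {..m} s" using a by (simp add: off_diagonal_def)
  show "step_function n m s (\<lambda>i. max 0 (a i)) y = max 0 (step_function n m s a y)"
  proof (cases "\<exists>j\<in>inj_tuples n m. cell n s j y \<noteq> 0")
    case True
    then obtain j where j: "j \<in> inj_tuples n m" "cell n s j y \<noteq> 0" by auto
    have "cell n s i y = of_bool (i = j) * cell n s j y" if "i \<in> inj_tuples n m" for i
      using cell_mult[OF s that j(1), of y] j(2) by (cases "i = j") simp_all
    then have "(\<Sum>i\<in>inj_tuples n m. c i * cell n s i y) = (\<Sum>i\<in>inj_tuples n m. if i = j then c j * cell n s j y else 0)" for c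
      by (intro sum.cong refl) auto
    then have "step_function n m s c y = c j * cell n s j y" if "off_diagonal n m s c" for c
      unfolding step_function_eq_cells[OF that] using j(1) by simp
    moreover have "0 \<le> cell n s j y" by (auto simp: cell_def intro!: prod_nonneg)
    ultimately show ?thesis using a off by (simp add: max_mult_distrib_right)
  next
    case False
    then show ?thesis by (simp add: step_function_eq_cells[OF a] step_function_eq_cells[OF off])
  qed
qed

context brownian_motion begin

lemma all_moments_step_integral: "off_diagonal n m s a \<Longrightarrow> all_moments M (step_integral B n m s a)"
  using gaussian_family.all_moments_homogeneous_sum[OF gaussian_family_increments]
  by (simp add: step_integral_eq_homogeneous_sum off_diagonal_def)

lemma square_integrable_step_integral: "off_diagonal n m s a \<Longrightarrow> square_integrable M (step_integral B n m s a)"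
  using all_moments_step_integral[of n m s a] by (auto simp: all_moments_def square_integrable_def)

text \<open>The right-hand side is \<open>n!\<close> times the inner product of the symmetrizations,
  left unfolded because the approximating step functions need not be symmetric.\<close>

lemma step_integral_isometry:
  assumes a: "off_diagonal n m s a" and b: "off_diagonal n m s b"
  shows "(\<integral>\<omega>. step_integral B n m s a \<omega> * step_integral B n m s b \<omega> \<partial>M) =
    (\<Sum>\<sigma> | \<sigma> permutes {..<n}. \<integral>y. step_function n m s a y * step_function n m s b (y \<circ> \<sigma>) \<partial>lborel_pow n)"
proof -
  interpret G: gaussian_family M m "\<lambda>l \<omega>. B (s (Suc l)) \<omega> - B (s l) \<omega>" "\<lambda>l. s (Suc l) - s l"
    using a by (intro gaussian_family_increments) (simp add: off_diagonal_def)
  show ?thesis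
    unfolding step_integral_eq_homogeneous_sum[OF a] step_integral_eq_homogeneous_sum[OF b] G.homogeneous_sum_isometry
  proof (intro sum.cong refl)
    fix \<sigma> assume "\<sigma> \<in> {\<sigma>. \<sigma> permutes {..<n}}"
    then have \<sigma>: "\<sigma> permutes {..<n}" by simp
    show "(\<Sum>i\<in>inj_tuples n m. a i * b (i \<circ> \<sigma>) * (\<Prod>l<n. s (Suc (i l)) - s (i l))) =
        (\<integral>y. step_function n m s a y * step_function n m s b (y \<circ> \<sigma>) \<partial>lborel_pow n)"
      using step_function_inner[OF a off_diagonal_permute[OF b \<sigma>]]
      by (simp add: step_function_permute[OF b \<sigma>] has_bochner_integral_integral_eq)
  qed
qed

text \<open>Permuting coordinates preserves the L^2 norm, so by Cauchy-Schwarz each of the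
  \<open>n!\<close> permutation terms is at most the squared norm. This transfers closeness of
  kernels to closeness of integrals.\<close>

lemma step_integral_norm_le:
  assumes a: "off_diagonal n m s a"
  shows "(\<integral>\<omega>. (step_integral B n m s a \<omega>)\<^sup>2 \<partial>M) \<le> fact n * (\<integral>y. (step_function n m s a y)\<^sup>2 \<partial>lborel_pow n)"
proof -
  define I where "I = (\<integral>y. (step_function n m s a y)\<^sup>2 \<partial>lborel_pow n)"
  have le: "(\<integral>y. step_function n m s a y * step_function n m s a (y \<circ> \<sigma>) \<partial>lborel_pow n) \<le> I"
    if \<sigma>: "\<sigma> permutes {..<n}" for \<sigma>
  proof (rule power2_le_imp_le)
    note [measurable] = measurable_permute_lborel_pow[OF \<sigma>]
    have si: "square_integrable (lborel_pow n) (step_function n m s a)"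
      "square_integrable (lborel_pow n) (\<lambda>y. step_function n m s a (y \<circ> \<sigma>))"
      using square_integrable_step_function[OF a] square_integrable_step_function[OF off_diagonal_permute[OF a \<sigma>]]
      by (simp_all add: step_function_permute[OF a \<sigma>] square_integrable_def)
    have "(\<integral>y. (step_function n m s a (y \<circ> \<sigma>))\<^sup>2 \<partial>lborel_pow n) = I"
      unfolding I_def
      by (subst (2) distr_permute_lborel_pow[OF \<sigma>, symmetric]) (simp add: integral_distr)
    then show "(\<integral>y. step_function n m s a y * step_function n m s a (y \<circ> \<sigma>) \<partial>lborel_pow n)\<^sup>2 \<le> I\<^sup>2"
      using integral_Cauchy_Schwarz[of "step_function n m s a" "lborel_pow n" "\<lambda>y. step_function n m s a (y \<circ> \<sigma>)"] si
      by (simp add: square_integrable_def I_def power2_eq_square)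
  qed (simp add: I_def)
  have "(\<integral>\<omega>. (step_integral B n m s a \<omega>)\<^sup>2 \<partial>M) \<le> (\<Sum>\<sigma> | \<sigma> permutes {..<n}. I)"
    unfolding power2_eq_square[of "step_integral _ _ _ _ _ _"] step_integral_isometry[OF a a]
    using le by (intro sum_mono) auto
  also have "\<dots> = fact n * I" by (simp add: card_permutations)
  finally show ?thesis by (simp add: I_def)
qed

lemma step_integral_hypercontractive:
  assumes a: "off_diagonal n m s a"
  shows "(\<integral>\<omega>. step_integral B n m s a \<omega> ^ 4 \<partial>M) \<le> 9 ^ n * (\<integral>\<omega>. (step_integral B n m s a \<omega>)\<^sup>2 \<partial>M)\<^sup>2"
  unfolding step_integral_eq_homogeneous_sum[OF a]
  by (rule gaussian_family.homogeneous_sum_hypercontractive[OF gaussian_family_increments])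
     (use a in \<open>simp add: off_diagonal_def\<close>)

lemma step_integral_covariance:
  assumes a: "off_diagonal (Suc p) m s a" "nonneg_coeff (Suc p) m a"
    and b: "off_diagonal (Suc p) m s b" "nonneg_coeff (Suc p) m b"
  shows "ennreal ((\<integral>\<omega>. (step_integral B (Suc p) m s a \<omega>)\<^sup>2 \<partial>M) * (\<integral>\<omega>. (step_integral B (Suc p) m s b \<omega>)\<^sup>2 \<partial>M))
      + linked_product p (step_function (Suc p) m s a) (step_function (Suc p) m s b)
    \<le> ennreal (\<integral>\<omega>. (step_integral B (Suc p) m s a \<omega>)\<^sup>2 * (step_integral B (Suc p) m s b \<omega>)\<^sup>2 \<partial>M)"
proof -
  have s: "strict_mono_on {..m} s" using a by (simp add: off_diagonal_def)
  interpret G: gaussian_family M m "\<lambda>l \<omega>. B (s (Suc l)) \<omega> - B (s l) \<omega>" "\<lambda>l. s (Suc l) - s l"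
    using s by (rule gaussian_family_increments)
  have nn: "0 \<le> a i" "0 \<le> b i" if "i \<in> inj_tuples (Suc p) m" for i
    using a b that by (auto simp: nonneg_coeff_def inj_tuples_def)
  have "0 \<le> link_sum p m (\<lambda>l. s (Suc l) - s l) a b"
    unfolding link_sum_def
    using nn less_imp_le[OF G.v_pos[OF inj_tuples_less]]
    by (intro sum_nonneg mult_nonneg_nonneg prod_nonneg) auto
  then show ?thesis
    using G.homogeneous_sum_covariance[of p a b] nn
    unfolding linked_product_step[OF a b] step_integral_eq_homogeneous_sum[OF a(1)] step_integral_eq_homogeneous_sum[OF b(1)]
    by (simp add: ennreal_plus[symmetric] del: ennreal_plus)
qed

lemma ex_common_refinement:
  assumes "off_diagonal n m1 s1 a1" "off_diagonal n m2 s2 a2"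
  shows "\<exists>m s a b. off_diagonal n m s a \<and> off_diagonal n m s b \<and>
      step_function n m1 s1 a1 = step_function n m s a \<and> step_function n m2 s2 a2 = step_function n m s b \<and>
      step_integral B n m1 s1 a1 = step_integral B n m s a \<and> step_integral B n m2 s2 a2 = step_integral B n m s b \<and>
      (nonneg_coeff n m1 a1 \<longrightarrow> nonneg_coeff n m a) \<and> (nonneg_coeff n m2 a2 \<longrightarrow> nonneg_coeff n m b)"
  by (rule common_refinement[OF assms]) (intro exI conjI impI; assumption | blast)

text \<open>The two integrals come with unrelated sequences of grids; refining them pairwise for
  each \<open>k\<close> makes the combination an off-diagonal step function again.\<close>

lemma wiener_ito_linear:
  assumes f: "has_wiener_ito_integral M B n f X" and g: "has_wiener_ito_integral M B n g Y"
  shows "has_wiener_ito_integral M B n (\<lambda>y. c * f y + d * g y) (\<lambda>\<omega>. c * X \<omega> + d * Y \<omega>)"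
proof -
  from f obtain m1 s1 a1 where 1: "\<And>k. off_diagonal n (m1 k) (s1 k) (a1 k)"
    "L2_tendsto (lborel_pow n) (\<lambda>k. step_function n (m1 k) (s1 k) (a1 k)) f"
    "L2_tendsto M (\<lambda>k. step_integral B n (m1 k) (s1 k) (a1 k)) X"
    by (auto simp: has_wiener_ito_integral_def)
  from g obtain m2 s2 a2 where 2: "\<And>k. off_diagonal n (m2 k) (s2 k) (a2 k)"
    "L2_tendsto (lborel_pow n) (\<lambda>k. step_function n (m2 k) (s2 k) (a2 k)) g"
    "L2_tendsto M (\<lambda>k. step_integral B n (m2 k) (s2 k) (a2 k)) Y"
    by (auto simp: has_wiener_ito_integral_def)
  have "\<exists>m s a. off_diagonal n m s a \<and>
      step_function n m s a = (\<lambda>y. c * step_function n (m1 k) (s1 k) (a1 k) y + d * step_function n (m2 k) (s2 k) (a2 k) y) \<and>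
      step_integral B n m s a = (\<lambda>\<omega>. c * step_integral B n (m1 k) (s1 k) (a1 k) \<omega> + d * step_integral B n (m2 k) (s2 k) (a2 k) \<omega>)" for k
  proof -
    obtain m s b1 b2 where "off_diagonal n m s b1" "off_diagonal n m s b2"
      "step_function n (m1 k) (s1 k) (a1 k) = step_function n m s b1"
      "step_function n (m2 k) (s2 k) (a2 k) = step_function n m s b2"
      "step_integral B n (m1 k) (s1 k) (a1 k) = step_integral B n m s b1"
      "step_integral B n (m2 k) (s2 k) (a2 k) = step_integral B n m s b2"
      using ex_common_refinement[OF 1(1)[of k] 2(1)[of k]] by blast
    then show ?thesis
      by (intro exI[of _ m] exI[of _ s] exI[of _ "\<lambda>i. c * b1 i + d * b2 i"])
         (auto simp: fun_eq_iff step_function_linear step_integral_linear intro: off_diagonal_linear)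
  qed
  then obtain m s a where "\<And>k. off_diagonal n (m k) (s k) (a k)"
    "\<And>k. step_function n (m k) (s k) (a k) = (\<lambda>y. c * step_function n (m1 k) (s1 k) (a1 k) y + d * step_function n (m2 k) (s2 k) (a2 k) y)"
    "\<And>k. step_integral B n (m k) (s k) (a k) = (\<lambda>\<omega>. c * step_integral B n (m1 k) (s1 k) (a1 k) \<omega> + d * step_integral B n (m2 k) (s2 k) (a2 k) \<omega>)"
    by metis
  then show ?thesis
    unfolding has_wiener_ito_integral_def
    using L2_tendsto_linear[OF 1(2) 2(2), of c d] L2_tendsto_linear[OF 1(3) 2(3), of c d]
    by (intro exI[of _ m] exI[of _ s] exI[of _ a]) simp
qed

lemma wiener_ito_step:
  assumes "off_diagonal n m s a"
  shows "has_wiener_ito_integral M B n (step_function n m s a) (step_integral B n m s a)"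
  unfolding has_wiener_ito_integral_def
  using assms square_integrable_step_function[OF assms] square_integrable_step_integral[OF assms]
  by (intro exI[of _ "\<lambda>_. m"] exI[of _ "\<lambda>_. s"] exI[of _ "\<lambda>_. a"]) (auto simp: L2_tendsto_def)

text \<open>Cutting a step function off at 0 moves it closer to a nonnegative \<open>f\<close> at
  almost every point. Its integral changes, but in squared norm by at most \<open>n!\<close> times
  the squared distance between the step function and its positive part; this tends to 0, so the
  limit is still \<open>X\<close>.\<close>

lemma wiener_ito_nonneg_approximation:
  assumes f: "has_wiener_ito_integral M B n f X" and nonneg: "AE y in lborel_pow n. 0 \<le> f y"
  obtains m s a where "\<forall>k. off_diagonal n (m k) (s k) (a k)" "\<forall>k. nonneg_coeff n (m k) (a k)"
    "L2_tendsto (lborel_pow n) (\<lambda>k. step_function n (m k) (s k) (a k)) f"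
    "L2_tendsto M (\<lambda>k. step_integral B n (m k) (s k) (a k)) X"
proof -
  from f obtain m s a where a: "\<And>k. off_diagonal n (m k) (s k) (a k)"
    and Lf: "L2_tendsto (lborel_pow n) (\<lambda>k. step_function n (m k) (s k) (a k)) f"
    and LX: "L2_tendsto M (\<lambda>k. step_integral B n (m k) (s k) (a k)) X"
    by (auto simp: has_wiener_ito_integral_def)
  define F where "F k = step_function n (m k) (s k) (a k)" for k
  define I where "I k = step_integral B n (m k) (s k) (a k)" for k
  define b where "b k i = max 0 (a k i)" for k i
  have b: "off_diagonal n (m k) (s k) (b k)" "nonneg_coeff n (m k) (b k)"
    and Fb: "step_function n (m k) (s k) (b k) = (\<lambda>y. max 0 (F k y))" for k
    using step_function_pos_part[OF a[of k]] by (auto simp: b_def[abs_def] F_def fun_eq_iff)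
  note DF = L2_tendstoD[OF Lf, folded F_def] and DX = L2_tendstoD[OF LX, folded I_def]
  have sib: "square_integrable (lborel_pow n) (\<lambda>y. max 0 (F k y))" for k
    using square_integrable_step_function[OF b(1)[of k]] by (simp add: Fb)
  have Lfb: "L2_tendsto (lborel_pow n) (\<lambda>k y. max 0 (F k y)) f"
    unfolding L2_tendsto_def
  proof (intro conjI allI)
    have "(\<integral>y. (max 0 (F k y) - f y)\<^sup>2 \<partial>lborel_pow n) \<le> (\<integral>y. (F k y - f y)\<^sup>2 \<partial>lborel_pow n)" for k
    proof (rule integral_mono_AE)
      show "integrable (lborel_pow n) (\<lambda>y. (max 0 (F k y) - f y)\<^sup>2)" "integrable (lborel_pow n) (\<lambda>y. (F k y - f y)\<^sup>2)"
        using square_integrable_diff[OF sib DF(2)] square_integrable_diff[OF DF(1,2)] by (auto simp: square_integrable_def)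
      show "AE y in lborel_pow n. (max 0 (F k y) - f y)\<^sup>2 \<le> (F k y - f y)\<^sup>2"
        using nonneg
      proof eventually_elim
        fix y assume "0 \<le> f y"
        then have "\<bar>max 0 (F k y) - f y\<bar> \<le> \<bar>F k y - f y\<bar>" by linarith
        then show "(max 0 (F k y) - f y)\<^sup>2 \<le> (F k y - f y)\<^sup>2" by (simp add: abs_le_square_iff)
      qed
    qed
    then show "(\<lambda>k. \<integral>y. (max 0 (F k y) - f y)\<^sup>2 \<partial>lborel_pow n) \<longlonglongrightarrow> 0"
      using DF(3) by (rule tendsto_0_squeeze) auto
  qed (use sib DF in auto)
  have LXb: "L2_tendsto M (\<lambda>k. step_integral B n (m k) (s k) (b k)) X"
    unfolding L2_tendsto_def
  proof (intro conjI allI)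
    define J where "J k = step_integral B n (m k) (s k) (b k)" for k
    have siJ: "square_integrable M (J k)" for k
      unfolding J_def by (rule square_integrable_step_integral[OF b(1)])
    have diff: "(\<integral>\<omega>. (J k \<omega> - I k \<omega>)\<^sup>2 \<partial>M) \<le> fact n * (\<integral>y. (max 0 (F k y) - F k y)\<^sup>2 \<partial>lborel_pow n)" for k
      using step_integral_norm_le[OF off_diagonal_linear[OF b(1) a, of k 1 "-1"]]
        step_integral_linear[of B n "m k" "s k" 1 "b k" "-1" "a k"] step_function_linear[of n "m k" "s k" 1 "b k" "-1" "a k"]
      by (simp add: J_def I_def Fb F_def)
    have "(\<lambda>k. \<integral>y. (max 0 (F k y) - F k y)\<^sup>2 \<partial>lborel_pow n) \<longlonglongrightarrow> 0"
      using L2_tendsto_linear[OF Lfb Lf[folded F_def], of 1 "-1"] by (simp add: L2_tendsto_def)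
    then have lim: "(\<lambda>k. 2 * (fact n * (\<integral>y. (max 0 (F k y) - F k y)\<^sup>2 \<partial>lborel_pow n)) + 2 * (\<integral>\<omega>. (I k \<omega> - X \<omega>)\<^sup>2 \<partial>M)) \<longlonglongrightarrow> 0"
      using DX(3) by (auto intro!: tendsto_eq_intros)
    have "(\<integral>\<omega>. (J k \<omega> - X \<omega>)\<^sup>2 \<partial>M) \<le>
        2 * (fact n * (\<integral>y. (max 0 (F k y) - F k y)\<^sup>2 \<partial>lborel_pow n)) + 2 * (\<integral>\<omega>. (I k \<omega> - X \<omega>)\<^sup>2 \<partial>M)" for k
      using integral_sum_square_le[OF square_integrable_diff[OF siJ DX(1)] square_integrable_diff[OF DX(1,2)], of k k k] diff[of k]
      by simp
    then show "(\<lambda>k. \<integral>\<omega>. (step_integral B n (m k) (s k) (b k) \<omega> - X \<omega>)\<^sup>2 \<partial>M) \<longlonglongrightarrow> 0"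
      unfolding J_def[symmetric] using lim by (rule tendsto_0_squeeze) auto
  qed (use square_integrable_step_integral[OF b(1)] DX in auto)
  show thesis
    by (rule that[of m s b]) (use b Lfb LXb in \<open>simp_all add: Fb\<close>)
qed

lemma wiener_ito_common_approximation:
  assumes f: "has_wiener_ito_integral M B n f X" "AE y in lborel_pow n. 0 \<le> f y"
    and g: "has_wiener_ito_integral M B n g Y" "AE y in lborel_pow n. 0 \<le> g y"
  obtains m s a b where "\<forall>k. off_diagonal n (m k) (s k) (a k)" "\<forall>k. nonneg_coeff n (m k) (a k)"
    "\<forall>k. off_diagonal n (m k) (s k) (b k)" "\<forall>k. nonneg_coeff n (m k) (b k)"
    "L2_tendsto (lborel_pow n) (\<lambda>k. step_function n (m k) (s k) (a k)) f"
    "L2_tendsto M (\<lambda>k. step_integral B n (m k) (s k) (a k)) X"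
    "L2_tendsto (lborel_pow n) (\<lambda>k. step_function n (m k) (s k) (b k)) g"
    "L2_tendsto M (\<lambda>k. step_integral B n (m k) (s k) (b k)) Y"
proof -
  obtain m1 s1 a1 where 1: "\<forall>k. off_diagonal n (m1 k) (s1 k) (a1 k)" "\<forall>k. nonneg_coeff n (m1 k) (a1 k)"
    "L2_tendsto (lborel_pow n) (\<lambda>k. step_function n (m1 k) (s1 k) (a1 k)) f"
    "L2_tendsto M (\<lambda>k. step_integral B n (m1 k) (s1 k) (a1 k)) X"
    by (rule wiener_ito_nonneg_approximation[OF f])
  obtain m2 s2 a2 where 2: "\<forall>k. off_diagonal n (m2 k) (s2 k) (a2 k)" "\<forall>k. nonneg_coeff n (m2 k) (a2 k)"
    "L2_tendsto (lborel_pow n) (\<lambda>k. step_function n (m2 k) (s2 k) (a2 k)) g"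
    "L2_tendsto M (\<lambda>k. step_integral B n (m2 k) (s2 k) (a2 k)) Y"
    by (rule wiener_ito_nonneg_approximation[OF g])
  have "\<exists>m s a b. off_diagonal n m s a \<and> nonneg_coeff n m a \<and> off_diagonal n m s b \<and> nonneg_coeff n m b \<and>
      step_function n (m1 k) (s1 k) (a1 k) = step_function n m s a \<and>
      step_function n (m2 k) (s2 k) (a2 k) = step_function n m s b \<and>
      step_integral B n (m1 k) (s1 k) (a1 k) = step_integral B n m s a \<and>
      step_integral B n (m2 k) (s2 k) (a2 k) = step_integral B n m s b" for k
    using ex_common_refinement[OF 1(1)[rule_format, of k] 2(1)[rule_format, of k]] 1(2) 2(2) by blast
  then obtain m s a b where ms: "\<forall>k. off_diagonal n (m k) (s k) (a k)" "\<forall>k. nonneg_coeff n (m k) (a k)"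
      "\<forall>k. off_diagonal n (m k) (s k) (b k)" "\<forall>k. nonneg_coeff n (m k) (b k)"
    and eq: "\<And>k. step_function n (m1 k) (s1 k) (a1 k) = step_function n (m k) (s k) (a k)"
      "\<And>k. step_function n (m2 k) (s2 k) (a2 k) = step_function n (m k) (s k) (b k)"
      "\<And>k. step_integral B n (m1 k) (s1 k) (a1 k) = step_integral B n (m k) (s k) (a k)"
      "\<And>k. step_integral B n (m2 k) (s2 k) (a2 k) = step_integral B n (m k) (s k) (b k)"
    by metis
  show thesis
    by (rule that[OF ms 1(3,4)[unfolded eq] 2(3,4)[unfolded eq]])
qed

lemma wiener_ito_square_integrable:
  assumes "has_wiener_ito_integral M B n f X"
  shows "square_integrable M X" "square_integrable (lborel_pow n) f"
  using assms by (auto simp: has_wiener_ito_integral_def L2_tendsto_def)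

text \<open>The limit of the isometry for step functions on common grids; the symmetry of
  \<open>g\<close> makes all \<open>n!\<close> permutation terms equal.\<close>

lemma wiener_ito_covariance:
  assumes f: "has_wiener_ito_integral M B n f X" "AE y in lborel_pow n. 0 \<le> f y"
    and g: "has_wiener_ito_integral M B n g Y" "AE y in lborel_pow n. 0 \<le> g y"
    and sym: "\<And>\<sigma> y. \<sigma> permutes {..<n} \<Longrightarrow> g (y \<circ> \<sigma>) = g y"
  shows "(\<integral>\<omega>. X \<omega> * Y \<omega> \<partial>M) = fact n * (\<integral>y. f y * g y \<partial>lborel_pow n)"
proof -
  obtain m s a b where *: "\<forall>k. off_diagonal n (m k) (s k) (a k)" "\<forall>k. nonneg_coeff n (m k) (a k)"
    "\<forall>k. off_diagonal n (m k) (s k) (b k)" "\<forall>k. nonneg_coeff n (m k) (b k)"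
    "L2_tendsto (lborel_pow n) (\<lambda>k. step_function n (m k) (s k) (a k)) f"
    "L2_tendsto M (\<lambda>k. step_integral B n (m k) (s k) (a k)) X"
    "L2_tendsto (lborel_pow n) (\<lambda>k. step_function n (m k) (s k) (b k)) g"
    "L2_tendsto M (\<lambda>k. step_integral B n (m k) (s k) (b k)) Y"
    by (rule wiener_ito_common_approximation[OF f g])
  have "(\<lambda>k. \<integral>\<omega>. step_integral B n (m k) (s k) (a k) \<omega> * step_integral B n (m k) (s k) (b k) \<omega> \<partial>M)
      \<longlonglongrightarrow> (\<integral>\<omega>. X \<omega> * Y \<omega> \<partial>M)"
    using *(6,8) by (rule L2_tendsto_inner)
  moreover have "(\<lambda>k. \<Sum>\<sigma> | \<sigma> permutes {..<n}. \<integral>y. step_function n (m k) (s k) (a k) y * step_function n (m k) (s k) (b k) (y \<circ> \<sigma>) \<partial>lborel_pow n)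
      \<longlonglongrightarrow> (\<Sum>\<sigma> | \<sigma> permutes {..<n}. \<integral>y. f y * g (y \<circ> \<sigma>) \<partial>lborel_pow n)"
    using *(5,7) by (intro tendsto_sum L2_tendsto_inner L2_tendsto_permute) auto
  ultimately have "(\<integral>\<omega>. X \<omega> * Y \<omega> \<partial>M) = (\<Sum>\<sigma> | \<sigma> permutes {..<n}. \<integral>y. f y * g (y \<circ> \<sigma>) \<partial>lborel_pow n)"
    unfolding step_integral_isometry[OF *(1,3)[rule_format]] by (rule LIMSEQ_unique)
  also have "\<dots> = fact n * (\<integral>y. f y * g y \<partial>lborel_pow n)"
    by (simp add: sym card_permutations)
  finally show ?thesis .
qed

text \<open>Convergence in L^2 says nothing about fourth moments of the limit. Fatou's lemma along
  an almost surely convergent subsequence carries over the uniform bound for step integrals and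
  yields integrability at the same time.\<close>

lemma wiener_ito_hypercontractive:
  assumes f: "has_wiener_ito_integral M B n f X"
  shows "integrable M (\<lambda>\<omega>. X \<omega> ^ 4)" "(\<integral>\<omega>. X \<omega> ^ 4 \<partial>M) \<le> 9 ^ n * (\<integral>\<omega>. (X \<omega>)\<^sup>2 \<partial>M)\<^sup>2"
proof -
  from f obtain m s a where a: "\<And>k. off_diagonal n (m k) (s k) (a k)"
    and LX: "L2_tendsto M (\<lambda>k. step_integral B n (m k) (s k) (a k)) X"
    by (auto simp: has_wiener_ito_integral_def)
  define I where "I k = step_integral B n (m k) (s k) (a k)" for k
  obtain r :: "nat \<Rightarrow> nat" where r: "strict_mono r" "AE \<omega> in M. (\<lambda>k. I (r k) \<omega>) \<longlonglongrightarrow> X \<omega>"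
    unfolding I_def by (rule L2_tendsto_AE_subseq[OF LX])
  note LXr = L2_tendsto_subseq[OF LX r(1), folded I_def]
  have [measurable]: "I k \<in> borel_measurable M" "X \<in> borel_measurable M" for k
    using L2_tendstoD[OF LX] by (auto simp: I_def)
  define K where "K = 9 ^ n * (\<integral>\<omega>. (X \<omega>)\<^sup>2 \<partial>M)\<^sup>2"
  have "(\<integral>\<^sup>+\<omega>. ennreal (X \<omega> ^ 4) \<partial>M) = (\<integral>\<^sup>+\<omega>. liminf (\<lambda>k. ennreal (I (r k) \<omega> ^ 4)) \<partial>M)"
  proof (rule nn_integral_cong_AE)
    show "AE \<omega> in M. ennreal (X \<omega> ^ 4) = liminf (\<lambda>k. ennreal (I (r k) \<omega> ^ 4))"
      using r(2)
    proof eventually_elim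
      fix \<omega> assume "(\<lambda>k. I (r k) \<omega>) \<longlonglongrightarrow> X \<omega>"
      then have "(\<lambda>k. ennreal (I (r k) \<omega> ^ 4)) \<longlonglongrightarrow> ennreal (X \<omega> ^ 4)"
        by (intro tendsto_ennrealI tendsto_power)
      then show "ennreal (X \<omega> ^ 4) = liminf (\<lambda>k. ennreal (I (r k) \<omega> ^ 4))"
        by (rule lim_imp_Liminf[OF trivial_limit_sequentially, symmetric])
    qed
  qed
  also have "\<dots> \<le> liminf (\<lambda>k. \<integral>\<^sup>+\<omega>. ennreal (I (r k) \<omega> ^ 4) \<partial>M)"
    by (rule nn_integral_liminf) simp
  also have "\<dots> \<le> liminf (\<lambda>k. ennreal (9 ^ n * (\<integral>\<omega>. (I (r k) \<omega>)\<^sup>2 \<partial>M)\<^sup>2))"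
  proof (intro Liminf_mono always_eventually allI)
    fix k
    have "integrable M (\<lambda>\<omega>. I (r k) \<omega> ^ 4)"
      unfolding I_def by (rule all_moments_integrable_power[OF all_moments_step_integral[OF a]])
    then show "(\<integral>\<^sup>+\<omega>. ennreal (I (r k) \<omega> ^ 4) \<partial>M) \<le> ennreal (9 ^ n * (\<integral>\<omega>. (I (r k) \<omega>)\<^sup>2 \<partial>M)\<^sup>2)"
      using step_integral_hypercontractive[OF a[of "r k"]]
      by (subst nn_integral_eq_integral) (auto simp: I_def intro!: ennreal_leI)
  qed
  also have "\<dots> = ennreal K"
  proof (intro lim_imp_Liminf tendsto_ennrealI trivial_limit_sequentially)
    show "(\<lambda>k. 9 ^ n * (\<integral>\<omega>. (I (r k) \<omega>)\<^sup>2 \<partial>M)\<^sup>2) \<longlonglongrightarrow> K"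
      unfolding K_def power2_eq_square[of "I _ _"] power2_eq_square[of "X _"]
      by (intro tendsto_intros L2_tendsto_inner LXr)
  qed
  finally have le: "(\<integral>\<^sup>+\<omega>. ennreal (X \<omega> ^ 4) \<partial>M) \<le> ennreal K" .
  then show int: "integrable M (\<lambda>\<omega>. X \<omega> ^ 4)"
    by (intro integrableI_bounded) (auto simp: order_le_less_trans[OF le])
  show "(\<integral>\<omega>. X \<omega> ^ 4 \<partial>M) \<le> 9 ^ n * (\<integral>\<omega>. (X \<omega>)\<^sup>2 \<partial>M)\<^sup>2"
    using le by (subst (asm) nn_integral_eq_integral[OF int]) (auto simp: K_def)
qed

end

section \<open>Lower semicontinuity of the linked product\<close>

lemma liminf_mult_ennreal:
  fixes a b :: "nat \<Rightarrow> ennreal"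
  shows "liminf a * liminf b \<le> liminf (\<lambda>k. a k * b k)"
proof -
  have "liminf a * liminf b = (SUP n. SUP n'. (INF k\<in>{n..}. a k) * (INF k\<in>{n'..}. b k))"
    by (simp add: liminf_SUP_INF SUP_mult_left_ennreal[symmetric] SUP_mult_right_ennreal[symmetric])
  also have "\<dots> \<le> (SUP n. INF k\<in>{n..}. a k * b k)"
  proof (intro SUP_least)
    fix n n'
    have "(INF k\<in>{n..}. a k) * (INF k\<in>{n'..}. b k) \<le> (INF k\<in>{max n n'..}. a k * b k)"
      by (intro INF_greatest mult_mono INF_lower) auto
    also have "\<dots> \<le> (SUP n. INF k\<in>{n..}. a k * b k)" by (rule SUP_upper) simp
    finally show "(INF k\<in>{n..}. a k) * (INF k\<in>{n'..}. b k) \<le> (SUP n. INF k\<in>{n..}. a k * b k)" .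
  qed
  finally show ?thesis by (simp add: liminf_SUP_INF)
qed

lemma measurable_lborel_pow_upd [measurable (raw)]:
  "R \<in> measurable N (lborel_pow p) \<Longrightarrow> h \<in> measurable N lborel \<Longrightarrow>
    (\<lambda>z. (R z)(p := h z)) \<in> measurable N (lborel_pow (Suc p))"
  by (rule measurable_fun_upd) auto

text \<open>Tonelli for the exceptional null set. The last coordinate is taken outermost because the
  linked product fixes it before integrating over the others.\<close>

lemma AE_lborel_pow_Suc:
  assumes "AE y in lborel_pow (Suc p). P y"
  shows "AE x in lborel. AE r in lborel_pow p. P (r(p := x))"
proof -
  obtain N where N: "{y \<in> space (lborel_pow (Suc p)). \<not> P y} \<subseteq> N" "emeasure (lborel_pow (Suc p)) N = 0"
    "N \<in> sets (lborel_pow (Suc p))"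
    using assms by (rule AE_E)
  note [measurable] = N(3)
  interpret sigma_finite_measure "lborel_pow p" by (rule lborel_pow.sigma_finite) simp
  have upd: "(\<lambda>z. (indicator N ((snd z)(p := fst z)) :: ennreal)) \<in> borel_measurable (lborel \<Otimes>\<^sub>M lborel_pow p)"
    by (rule measurable_compose[OF measurable_lborel_pow_upd borel_measurable_indicator[OF N(3)]]) auto
  have upd1: "(\<lambda>x. \<integral>\<^sup>+r. indicator N (r(p := x)) \<partial>lborel_pow p) \<in> borel_measurable lborel"
    using borel_measurable_nn_integral_fst[OF upd] by simp
  have upd2: "(\<lambda>r. (indicator N (r(p := x)) :: ennreal)) \<in> borel_measurable (lborel_pow p)" for x
    by (rule measurable_compose[OF measurable_lborel_pow_upd borel_measurable_indicator[OF N(3)]]) auto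
  have "0 = (\<integral>\<^sup>+y. indicator N y \<partial>lborel_pow (Suc p))" using N by simp
  also have "\<dots> = (\<integral>\<^sup>+x. \<integral>\<^sup>+r. indicator N (r(p := x)) \<partial>lborel_pow p \<partial>lborel)"
    unfolding lessThan_Suc using N(3)
    by (intro lborel_pow.product_nn_integral_insert_rev) (auto simp: lessThan_Suc)
  finally have "(\<integral>\<^sup>+x. \<integral>\<^sup>+r. indicator N (r(p := x)) \<partial>lborel_pow p \<partial>lborel) = 0" ..
  then have "AE x in lborel. (\<integral>\<^sup>+r. indicator N (r(p := x)) \<partial>lborel_pow p) = 0"
    by (simp only: nn_integral_0_iff_AE[OF upd1])
  then show ?thesis
  proof eventually_elim
    fix x assume "(\<integral>\<^sup>+r. indicator N (r(p := x)) \<partial>lborel_pow p) = 0"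
    then have "AE r in lborel_pow p. (indicator N (r(p := x)) :: ennreal) = 0"
      by (simp only: nn_integral_0_iff_AE[OF upd2])
    then show "AE r in lborel_pow p. P (r(p := x))"
      using AE_space
    proof eventually_elim
      fix r assume r: "(indicator N (r(p := x)) :: ennreal) = 0" "r \<in> space (lborel_pow p)"
      then have "r(p := x) \<in> space (lborel_pow (Suc p))"
        by (auto simp: space_PiM PiE_iff extensional_def)
      with r N(1) show "P (r(p := x))" by (auto simp: indicator_def split: if_splits)
    qed
  qed
qed

text \<open>Fatou's lemma applies to each integral, and the product of two lower limits is at most
  the lower limit of the products. Values in \<open>ennreal\<close> make integrability of the
  contraction a non-issue.\<close>

lemma linked_product_liminf:
  assumes [measurable]: "\<And>k. F k \<in> borel_measurable (lborel_pow (Suc p))" "\<And>k. G k \<in> borel_measurable (lborel_pow (Suc p))"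
    and f: "AE y in lborel_pow (Suc p). (\<lambda>k. F k y) \<longlonglongrightarrow> f y"
    and g: "AE y in lborel_pow (Suc p). (\<lambda>k. G k y) \<longlonglongrightarrow> g y"
  shows "linked_product p f g \<le> liminf (\<lambda>k. linked_product p (F k) (G k))"
proof -
  define L where "L f x x' = (\<integral>\<^sup>+r. ennreal (f (r(p := x))) * ennreal (f (r(p := x'))) \<partial>lborel_pow p)"
    for f :: "(nat \<Rightarrow> real) \<Rightarrow> real" and x x'
  have fatou: "L f x x' \<le> liminf (\<lambda>k. L (F k) x x')"
    if [measurable]: "\<And>k. F k \<in> borel_measurable (lborel_pow (Suc p))"
      and x: "AE r in lborel_pow p. (\<lambda>k. F k (r(p := x))) \<longlonglongrightarrow> f (r(p := x))"
      and x': "AE r in lborel_pow p. (\<lambda>k. F k (r(p := x'))) \<longlonglongrightarrow> f (r(p := x'))" for f F x x'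
  proof -
    have "L f x x' = (\<integral>\<^sup>+r. liminf (\<lambda>k. ennreal (F k (r(p := x))) * ennreal (F k (r(p := x')))) \<partial>lborel_pow p)"
      unfolding L_def
    proof (rule nn_integral_cong_AE)
      show "AE r in lborel_pow p. ennreal (f (r(p := x))) * ennreal (f (r(p := x'))) =
          liminf (\<lambda>k. ennreal (F k (r(p := x))) * ennreal (F k (r(p := x'))))"
        using x x'
      proof eventually_elim
        fix r assume "(\<lambda>k. F k (r(p := x))) \<longlonglongrightarrow> f (r(p := x))" "(\<lambda>k. F k (r(p := x'))) \<longlonglongrightarrow> f (r(p := x'))"
        then have "(\<lambda>k. ennreal (F k (r(p := x))) * ennreal (F k (r(p := x')))) \<longlonglongrightarrow>
            ennreal (f (r(p := x))) * ennreal (f (r(p := x')))"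
          by (intro tendsto_mult_ennreal tendsto_ennrealI) auto
        then show "ennreal (f (r(p := x))) * ennreal (f (r(p := x'))) =
            liminf (\<lambda>k. ennreal (F k (r(p := x))) * ennreal (F k (r(p := x'))))"
          by (rule lim_imp_Liminf[OF trivial_limit_sequentially, symmetric])
      qed
    qed
    also have "\<dots> \<le> liminf (\<lambda>k. L (F k) x x')"
      unfolding L_def by (rule nn_integral_liminf) measurable
    finally show ?thesis .
  qed
  interpret P: sigma_finite_measure "lborel_pow p" by (rule lborel_pow.sigma_finite) simp
  have [measurable]: "(\<lambda>z. L (F k) (fst z) (snd z)) \<in> borel_measurable (lborel \<Otimes>\<^sub>M lborel)"
    "(\<lambda>z. L (G k) (fst z) (snd z)) \<in> borel_measurable (lborel \<Otimes>\<^sub>M lborel)" for k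
    unfolding L_def by measurable
  have L_meas [measurable]: "(\<lambda>x'. L (F k) x x') \<in> borel_measurable lborel" "(\<lambda>x'. L (G k) x x') \<in> borel_measurable lborel" for k x
    using measurable_compose[OF measurable_Pair1', of x lborel, of "\<lambda>z. L (F k) (fst z) (snd z)"]
      measurable_compose[OF measurable_Pair1', of x lborel, of "\<lambda>z. L (G k) (fst z) (snd z)"] by auto
  have "linked_product p f g = (\<integral>\<^sup>+x. \<integral>\<^sup>+x'. L f x x' * L g x x' \<partial>lborel \<partial>lborel)"
    by (simp add: linked_product_def L_def)
  also have "\<dots> \<le> (\<integral>\<^sup>+x. \<integral>\<^sup>+x'. liminf (\<lambda>k. L (F k) x x' * L (G k) x x') \<partial>lborel \<partial>lborel)"
  proof (rule nn_integral_mono_AE)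
    note F = AE_lborel_pow_Suc[OF f] and G = AE_lborel_pow_Suc[OF g]
    show "AE x in lborel. (\<integral>\<^sup>+x'. L f x x' * L g x x' \<partial>lborel) \<le> (\<integral>\<^sup>+x'. liminf (\<lambda>k. L (F k) x x' * L (G k) x x') \<partial>lborel)"
      using F G
    proof eventually_elim
      fix x assume x: "AE r in lborel_pow p. (\<lambda>k. F k (r(p := x))) \<longlonglongrightarrow> f (r(p := x))"
        "AE r in lborel_pow p. (\<lambda>k. G k (r(p := x))) \<longlonglongrightarrow> g (r(p := x))"
      show "(\<integral>\<^sup>+x'. L f x x' * L g x x' \<partial>lborel) \<le> (\<integral>\<^sup>+x'. liminf (\<lambda>k. L (F k) x x' * L (G k) x x') \<partial>lborel)"
      proof (rule nn_integral_mono_AE)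
        show "AE x' in lborel. L f x x' * L g x x' \<le> liminf (\<lambda>k. L (F k) x x' * L (G k) x x')"
          using F G
        proof eventually_elim
          fix x' assume x': "AE r in lborel_pow p. (\<lambda>k. F k (r(p := x'))) \<longlonglongrightarrow> f (r(p := x'))"
            "AE r in lborel_pow p. (\<lambda>k. G k (r(p := x'))) \<longlonglongrightarrow> g (r(p := x'))"
          have "L f x x' * L g x x' \<le> liminf (\<lambda>k. L (F k) x x') * liminf (\<lambda>k. L (G k) x x')"
            using x x' by (intro mult_mono fatou) auto
          also have "\<dots> \<le> liminf (\<lambda>k. L (F k) x x' * L (G k) x x')" by (rule liminf_mult_ennreal)
          finally show "L f x x' * L g x x' \<le> liminf (\<lambda>k. L (F k) x x' * L (G k) x x')" .
        qed
      qed
    qed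
  qed
  also have "\<dots> \<le> (\<integral>\<^sup>+x. liminf (\<lambda>k. \<integral>\<^sup>+x'. L (F k) x x' * L (G k) x x' \<partial>lborel) \<partial>lborel)"
    by (intro nn_integral_mono nn_integral_liminf) measurable
  also have "\<dots> \<le> liminf (\<lambda>k. \<integral>\<^sup>+x. \<integral>\<^sup>+x'. L (F k) x x' * L (G k) x x' \<partial>lborel \<partial>lborel)"
    by (intro nn_integral_liminf) measurable
  finally show ?thesis by (simp add: linked_product_def L_def)
qed

section \<open>Fourth-moment convergence and the covariance of squares\<close>

lemma square_integrable_square:
  "X \<in> borel_measurable M \<Longrightarrow> integrable M (\<lambda>\<omega>. X \<omega> ^ 4) \<Longrightarrow> square_integrable M (\<lambda>\<omega>. (X \<omega>)\<^sup>2)"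
  by (simp add: square_integrable_def power_mult[symmetric])

lemma square_integrable_mult:
  assumes X: "X \<in> borel_measurable M" "integrable M (\<lambda>\<omega>. X \<omega> ^ 4)"
    and Y: "Y \<in> borel_measurable M" "integrable M (\<lambda>\<omega>. Y \<omega> ^ 4)"
  shows "square_integrable M (\<lambda>\<omega>. X \<omega> * Y \<omega>)"
  using square_integrable_inner[OF square_integrable_square[OF X] square_integrable_square[OF Y]] X(1) Y(1)
  by (simp add: square_integrable_def power_mult_distrib)

text \<open>The error is \<open>(X k - x) * Y k + (Y k - y) * x\<close>; by Cauchy-Schwarz each
  summand is controlled by one fourth moment tending to 0 and one that is bounded, which is the role
  of \<open>C\<close>.\<close>

lemma L2_tendsto_mult:
  assumes X: "\<And>k. X k \<in> borel_measurable M" "\<And>k. integrable M (\<lambda>\<omega>. X k \<omega> ^ 4)"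
      "x \<in> borel_measurable M" "integrable M (\<lambda>\<omega>. x \<omega> ^ 4)"
      "\<And>k. integrable M (\<lambda>\<omega>. (X k \<omega> - x \<omega>) ^ 4)" "(\<lambda>k. \<integral>\<omega>. (X k \<omega> - x \<omega>) ^ 4 \<partial>M) \<longlonglongrightarrow> 0"
    and Y: "\<And>k. Y k \<in> borel_measurable M" "\<And>k. integrable M (\<lambda>\<omega>. Y k \<omega> ^ 4)"
      "y \<in> borel_measurable M" "integrable M (\<lambda>\<omega>. y \<omega> ^ 4)"
      "\<And>k. integrable M (\<lambda>\<omega>. (Y k \<omega> - y \<omega>) ^ 4)" "(\<lambda>k. \<integral>\<omega>. (Y k \<omega> - y \<omega>) ^ 4 \<partial>M) \<longlonglongrightarrow> 0"
    and C: "\<And>k. (\<integral>\<omega>. Y k \<omega> ^ 4 \<partial>M) \<le> C"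
  shows "L2_tendsto M (\<lambda>k \<omega>. X k \<omega> * Y k \<omega>) (\<lambda>\<omega>. x \<omega> * y \<omega>)"
  unfolding L2_tendsto_def
proof (intro conjI allI)
  show "square_integrable M (\<lambda>\<omega>. X k \<omega> * Y k \<omega>)" "square_integrable M (\<lambda>\<omega>. x \<omega> * y \<omega>)" for k
    using X Y by (intro square_integrable_mult; simp)+
  have 1: "(\<lambda>k. \<integral>\<omega>. (X k \<omega> - x \<omega>)\<^sup>2 * (Y k \<omega>)\<^sup>2 \<partial>M) \<longlonglongrightarrow> 0"
    using X Y C
    by (intro integral_mult_tendsto_0[where C = C] square_integrable_square) (auto simp: power_mult[symmetric])
  have 2: "(\<lambda>k. \<integral>\<omega>. (Y k \<omega> - y \<omega>)\<^sup>2 * (x \<omega>)\<^sup>2 \<partial>M) \<longlonglongrightarrow> 0"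
    using X Y
    by (intro integral_mult_tendsto_0[where C = "\<integral>\<omega>. x \<omega> ^ 4 \<partial>M"] square_integrable_square) (auto simp: power_mult[symmetric])
  have "(\<integral>\<omega>. (X k \<omega> * Y k \<omega> - x \<omega> * y \<omega>)\<^sup>2 \<partial>M) \<le>
      2 * (\<integral>\<omega>. (X k \<omega> - x \<omega>)\<^sup>2 * (Y k \<omega>)\<^sup>2 \<partial>M) + 2 * (\<integral>\<omega>. (Y k \<omega> - y \<omega>)\<^sup>2 * (x \<omega>)\<^sup>2 \<partial>M)" for k
  proof -
    have "square_integrable M (\<lambda>\<omega>. (X k \<omega> - x \<omega>) * Y k \<omega>)" "square_integrable M (\<lambda>\<omega>. (Y k \<omega> - y \<omega>) * x \<omega>)"
      using X Y by (intro square_integrable_mult; simp)+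
    moreover have "X k \<omega> * Y k \<omega> - x \<omega> * y \<omega> = (X k \<omega> - x \<omega>) * Y k \<omega> + (Y k \<omega> - y \<omega>) * x \<omega>" for \<omega>
      by (simp add: algebra_simps)
    ultimately show ?thesis
      using integral_sum_square_le[of M "\<lambda>\<omega>. (X k \<omega> - x \<omega>) * Y k \<omega>" "\<lambda>\<omega>. (Y k \<omega> - y \<omega>) * x \<omega>"]
      by (simp only: power_mult_distrib)
  qed
  moreover have "(\<lambda>k. 2 * (\<integral>\<omega>. (X k \<omega> - x \<omega>)\<^sup>2 * (Y k \<omega>)\<^sup>2 \<partial>M) + 2 * (\<integral>\<omega>. (Y k \<omega> - y \<omega>)\<^sup>2 * (x \<omega>)\<^sup>2 \<partial>M)) \<longlonglongrightarrow> 0"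
    using 1 2 by (auto intro!: tendsto_eq_intros)
  ultimately show "(\<lambda>k. \<integral>\<omega>. (X k \<omega> * Y k \<omega> - x \<omega> * y \<omega>)\<^sup>2 \<partial>M) \<longlonglongrightarrow> 0"
    by (rule tendsto_0_squeeze) simp
qed

context brownian_motion begin

text \<open>The error is itself a multiple integral of order \<open>n\<close>, namely of the
  difference of the kernels, so hypercontractivity bounds its fourth moment by the square of its
  second.\<close>

lemma step_integral_L4_tendsto:
  assumes a: "\<And>k. off_diagonal n (m k) (s k) (a k)"
    and Lf: "L2_tendsto (lborel_pow n) (\<lambda>k. step_function n (m k) (s k) (a k)) f"
    and LX: "L2_tendsto M (\<lambda>k. step_integral B n (m k) (s k) (a k)) X"
  shows "integrable M (\<lambda>\<omega>. (step_integral B n (m k) (s k) (a k) \<omega> - X \<omega>) ^ 4)"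
    "(\<lambda>k. \<integral>\<omega>. (step_integral B n (m k) (s k) (a k) \<omega> - X \<omega>) ^ 4 \<partial>M) \<longlonglongrightarrow> 0"
proof -
  have f: "has_wiener_ito_integral M B n f X"
    using a Lf LX unfolding has_wiener_ito_integral_def by blast
  have WI: "has_wiener_ito_integral M B n (\<lambda>y. step_function n (m k) (s k) (a k) y - f y)
      (\<lambda>\<omega>. step_integral B n (m k) (s k) (a k) \<omega> - X \<omega>)" for k
    using wiener_ito_linear[OF wiener_ito_step[OF a[of k]] f, of 1 "-1"] by simp
  show "integrable M (\<lambda>\<omega>. (step_integral B n (m k) (s k) (a k) \<omega> - X \<omega>) ^ 4)"
    using wiener_ito_hypercontractive(1)[OF WI] .
  have "(\<lambda>k. 9 ^ n * (\<integral>\<omega>. (step_integral B n (m k) (s k) (a k) \<omega> - X \<omega>)\<^sup>2 \<partial>M)\<^sup>2) \<longlonglongrightarrow> 0"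
    using L2_tendstoD(3)[OF LX] by (auto intro!: tendsto_eq_intros)
  with wiener_ito_hypercontractive(2)[OF WI]
  show "(\<lambda>k. \<integral>\<omega>. (step_integral B n (m k) (s k) (a k) \<omega> - X \<omega>) ^ 4 \<partial>M) \<longlonglongrightarrow> 0"
    by (rule tendsto_0_squeeze) simp
qed

text \<open>Products of the approximating integrals converge in L^2, so the covariances of their
  squares converge. The linked product of the limits is at most the lower limit of the linked
  products, and thus inherits the bound.\<close>

lemma wiener_ito_square_covariance:
  assumes f: "has_wiener_ito_integral M B (Suc p) f X" "AE y in lborel_pow (Suc p). 0 \<le> f y"
    and g: "has_wiener_ito_integral M B (Suc p) g Y" "AE y in lborel_pow (Suc p). 0 \<le> g y"
  shows "linked_product p f g \<le>
    ennreal ((\<integral>\<omega>. (X \<omega>)\<^sup>2 * (Y \<omega>)\<^sup>2 \<partial>M) - (\<integral>\<omega>. (X \<omega>)\<^sup>2 \<partial>M) * (\<integral>\<omega>. (Y \<omega>)\<^sup>2 \<partial>M))"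
proof -
  obtain m s a b where a: "\<forall>k. off_diagonal (Suc p) (m k) (s k) (a k)" "\<forall>k. nonneg_coeff (Suc p) (m k) (a k)"
    and b: "\<forall>k. off_diagonal (Suc p) (m k) (s k) (b k)" "\<forall>k. nonneg_coeff (Suc p) (m k) (b k)"
    and Lf: "L2_tendsto (lborel_pow (Suc p)) (\<lambda>k. step_function (Suc p) (m k) (s k) (a k)) f"
    and LX: "L2_tendsto M (\<lambda>k. step_integral B (Suc p) (m k) (s k) (a k)) X"
    and Lg: "L2_tendsto (lborel_pow (Suc p)) (\<lambda>k. step_function (Suc p) (m k) (s k) (b k)) g"
    and LY: "L2_tendsto M (\<lambda>k. step_integral B (Suc p) (m k) (s k) (b k)) Y"
    by (rule wiener_ito_common_approximation[OF f g])
  define F where "F k = step_function (Suc p) (m k) (s k) (a k)" for k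
  define G where "G k = step_function (Suc p) (m k) (s k) (b k)" for k
  define I where "I k = step_integral B (Suc p) (m k) (s k) (a k)" for k
  define J where "J k = step_integral B (Suc p) (m k) (s k) (b k)" for k
  obtain r1 :: "nat \<Rightarrow> nat" where r1: "strict_mono r1" "AE y in lborel_pow (Suc p). (\<lambda>k. F (r1 k) y) \<longlonglongrightarrow> f y"
    unfolding F_def by (rule L2_tendsto_AE_subseq[OF Lf])
  \<comment> \<open>The second subsequence is taken inside the first, so that along \<open>r\<close>
    both kernels converge almost everywhere.\<close>
  obtain r2 :: "nat \<Rightarrow> nat" where r2: "strict_mono r2" "AE y in lborel_pow (Suc p). (\<lambda>k. G (r1 (r2 k)) y) \<longlonglongrightarrow> g y"
    unfolding G_def by (rule L2_tendsto_AE_subseq[OF L2_tendsto_subseq[OF Lg r1(1)]])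
  define r where "r k = r1 (r2 k)" for k
  have r: "strict_mono r" using strict_mono_o[OF r1(1) r2(1)] by (simp add: r_def[abs_def] comp_def)
  have Ff: "AE y in lborel_pow (Suc p). (\<lambda>k. F (r k) y) \<longlonglongrightarrow> f y"
    using r1(2)
  proof eventually_elim
    fix y assume "(\<lambda>k. F (r1 k) y) \<longlonglongrightarrow> f y"
    from LIMSEQ_subseq_LIMSEQ[OF this r2(1)] show "(\<lambda>k. F (r k) y) \<longlonglongrightarrow> f y" by (simp add: comp_def r_def)
  qed
  define \<alpha> where "\<alpha> k = (\<integral>\<omega>. (I k \<omega>)\<^sup>2 \<partial>M) * (\<integral>\<omega>. (J k \<omega>)\<^sup>2 \<partial>M)" for k
  define \<beta> where "\<beta> k = (\<integral>\<omega>. (I k \<omega>)\<^sup>2 * (J k \<omega>)\<^sup>2 \<partial>M)" for k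
  have \<alpha>: "\<alpha> \<longlonglongrightarrow> (\<integral>\<omega>. (X \<omega>)\<^sup>2 \<partial>M) * (\<integral>\<omega>. (Y \<omega>)\<^sup>2 \<partial>M)"
    unfolding \<alpha>_def[abs_def] power2_eq_square using LX[folded I_def] LY[folded J_def]
    by (intro tendsto_mult L2_tendsto_inner)
  have \<beta>: "\<beta> \<longlonglongrightarrow> (\<integral>\<omega>. (X \<omega>)\<^sup>2 * (Y \<omega>)\<^sup>2 \<partial>M)"
  proof -
    have mI: "all_moments M (I k)" "all_moments M (J k)" for k
      using a b by (auto simp: I_def J_def intro: all_moments_step_integral)
    obtain C where C: "\<forall>k. (\<integral>\<omega>. (J k \<omega>)\<^sup>2 \<partial>M) \<le> C"
      unfolding J_def by (rule L2_tendsto_bounded[OF LY])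
    have "(\<integral>\<omega>. J k \<omega> ^ 4 \<partial>M) \<le> 9 ^ Suc p * C\<^sup>2" for k
    proof -
      have "(\<integral>\<omega>. J k \<omega> ^ 4 \<partial>M) \<le> 9 ^ Suc p * (\<integral>\<omega>. (J k \<omega>)\<^sup>2 \<partial>M)\<^sup>2"
        unfolding J_def using step_integral_hypercontractive b(1) by blast
      also have "\<dots> \<le> 9 ^ Suc p * C\<^sup>2"
        using C by (intro mult_left_mono power_mono) auto
      finally show ?thesis .
    qed
    then have "L2_tendsto M (\<lambda>k \<omega>. I k \<omega> * J k \<omega>) (\<lambda>\<omega>. X \<omega> * Y \<omega>)"
      using mI wiener_ito_hypercontractive(1)[OF f(1)] wiener_ito_hypercontractive(1)[OF g(1)]
        L2_tendstoD(5)[OF LX] L2_tendstoD(5)[OF LY]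
        step_integral_L4_tendsto[OF a(1)[rule_format] Lf LX, folded I_def]
        step_integral_L4_tendsto[OF b(1)[rule_format] Lg LY, folded J_def]
      by (intro L2_tendsto_mult[where C = "9 ^ Suc p * C\<^sup>2"]) (auto simp: all_moments_def)
    from L2_tendsto_inner[OF this this] show ?thesis
      unfolding \<beta>_def[abs_def] by (simp add: power2_eq_square mult_ac)
  qed
  have "linked_product p f g \<le> liminf (\<lambda>k. linked_product p (F (r k)) (G (r k)))"
    using Ff r2(2) by (intro linked_product_liminf) (auto simp: F_def G_def r_def)
  also have "\<dots> \<le> liminf (\<lambda>k. ennreal (\<beta> (r k) - \<alpha> (r k)))"
  proof (intro Liminf_mono always_eventually allI)
    fix k
    have "ennreal (\<alpha> (r k)) + linked_product p (F (r k)) (G (r k)) \<le> ennreal (\<beta> (r k))"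
      using step_integral_covariance[OF a(1)[rule_format] a(2)[rule_format] b(1)[rule_format] b(2)[rule_format], of "r k"]
      by (simp add: \<alpha>_def \<beta>_def F_def G_def I_def J_def)
    moreover have "0 \<le> \<alpha> (r k)" by (simp add: \<alpha>_def)
    ultimately show "linked_product p (F (r k)) (G (r k)) \<le> ennreal (\<beta> (r k) - \<alpha> (r k))"
      by (simp add: ennreal_minus[symmetric] ennreal_le_minus_iff add.commute)
  qed
  also have "\<dots> = ennreal ((\<integral>\<omega>. (X \<omega>)\<^sup>2 * (Y \<omega>)\<^sup>2 \<partial>M) - (\<integral>\<omega>. (X \<omega>)\<^sup>2 \<partial>M) * (\<integral>\<omega>. (Y \<omega>)\<^sup>2 \<partial>M))"
    using LIMSEQ_subseq_LIMSEQ[OF \<alpha> r] LIMSEQ_subseq_LIMSEQ[OF \<beta> r]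
    by (intro lim_imp_Liminf trivial_limit_sequentially tendsto_ennrealI tendsto_diff) (auto simp: comp_def)
  finally show ?thesis .
qed

end

section \<open>Power integrals\<close>

lemma nn_integral_powr_0:
  "a > -1 \<Longrightarrow> 0 \<le> c \<Longrightarrow>
    (\<integral>\<^sup>+x. ennreal (x powr a) * indicator {0..c} x \<partial>lborel) = ennreal (c powr (a + 1) / (a + 1))" for a c :: real
  by (intro nn_integral_has_integral_lebesgue' has_integral_powr_from_0) auto

lemma nn_integral_powr_inf:
  fixes d e :: real
  assumes "0 < d" "1 < e"
  shows "(\<integral>\<^sup>+x. ennreal (x powr (- e)) * indicator {d..} x \<partial>lborel) = ennreal (d powr (1 - e) / (e - 1))"
proof -
  have "(\<integral>\<^sup>+x. ennreal (x powr (- e)) * indicator {d..} x \<partial>lborel) = ennreal (0 - (- (d powr (1 - e)) / (e - 1)))"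
  proof (rule nn_integral_FTC_atLeast)
    have "((\<lambda>x::real. x powr (1 - e)) \<longlongrightarrow> 0) at_top"
      using assms by (intro tendsto_neg_powr filterlim_ident) auto
    from tendsto_divide[OF tendsto_minus[OF this] tendsto_const, of "e - 1"] assms
    show "((\<lambda>x. - (x powr (1 - e)) / (e - 1)) \<longlongrightarrow> 0) at_top" by simp
    fix x assume "d \<le> x"
    then have "0 < x" using assms by simp
    then have "((\<lambda>x. - 1 / (e - 1) * x powr (1 - e)) has_real_derivative - 1 / (e - 1) * ((1 - e) * x powr (1 - e - 1))) (at x)"
      by (intro DERIV_cmult has_real_derivative_powr)
    moreover have "- 1 / (e - 1) * ((1 - e) * x powr (1 - e - 1)) = x powr (- e)"
      using assms by (simp add: divide_simps) (simp add: algebra_simps)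
    ultimately show "((\<lambda>x. - (x powr (1 - e)) / (e - 1)) has_real_derivative x powr - e) (at x)"
      by simp
  qed auto
  then show ?thesis by simp
qed

lemma nn_integral_riesz_local:
  fixes u c \<beta> :: real
  assumes "0 < \<beta>" "\<beta> < 1" "0 \<le> c"
  shows "(\<integral>\<^sup>+w. ennreal (\<bar>u - w\<bar> powr (- \<beta>)) * indicator {u - c..u + c} w \<partial>lborel)
    \<le> ennreal (2 * c powr (1 - \<beta>) / (1 - \<beta>))"
proof -
  let ?f = "\<lambda>z. ennreal (z powr (- \<beta>)) * indicator {0..c} z"
  have "(\<integral>\<^sup>+w. ennreal (\<bar>u - w\<bar> powr (- \<beta>)) * indicator {u - c..u + c} w \<partial>lborel) =
      (\<integral>\<^sup>+z. ennreal (\<bar>z\<bar> powr (- \<beta>)) * indicator {u - c..u + c} (u + z) \<partial>lborel)"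
    using nn_integral_real_affine[of "\<lambda>w. ennreal (\<bar>u - w\<bar> powr (- \<beta>)) * indicator {u - c..u + c} w" 1 u] by simp
  also have "\<dots> \<le> (\<integral>\<^sup>+z. ?f z + ?f (- z) \<partial>lborel)"
    by (intro nn_integral_mono) (auto simp: indicator_def abs_if)
  also have "\<dots> = (\<integral>\<^sup>+z. ?f z \<partial>lborel) + (\<integral>\<^sup>+z. ?f (- z) \<partial>lborel)"
    by (intro nn_integral_add) auto
  also have "(\<integral>\<^sup>+z. ?f (- z) \<partial>lborel) = (\<integral>\<^sup>+z. ?f z \<partial>lborel)"
    using nn_integral_real_affine[of ?f "-1" 0] by simp
  also have "(\<integral>\<^sup>+z. ?f z \<partial>lborel) + (\<integral>\<^sup>+z. ?f z \<partial>lborel) = ennreal (2 * c powr (1 - \<beta>) / (1 - \<beta>))"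
    using assms nn_integral_powr_0[of "- \<beta>" c] by (simp add: ennreal_plus[symmetric] del: ennreal_plus)
  finally show ?thesis .
qed

text \<open>A cell at index distance at most 1 lies within \<open>2 * g\<close> of \<open>u\<close>.
  This costs \<open>8 / (1 - \<beta>)\<close>: a factor 2 each for the two sides of
  \<open>u\<close>, for the doubled radius and for
  \<open>(1 + d) powr (- \<beta>) \<ge> 1 / 2\<close>. For other cells
  \<open>\<bar>u - w\<bar>\<close> is at least a third of \<open>g * (1 + d)\<close>, at the cost of
  \<open>3 powr \<beta> \<le> 3\<close>. The constant is the sum of both and so serves either
  case.\<close>

lemma nn_integral_riesz_grid:
  fixes g u \<beta> :: real and i j :: nat
  assumes \<beta>: "0 < \<beta>" "\<beta> < 1" and g: "0 < g" and u: "g * real i \<le> u" "u \<le> g * real (i + 1)"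
  shows "(\<integral>\<^sup>+w. ennreal (\<bar>u - w\<bar> powr (- \<beta>)) * indicator {g * real j..g * real (j + 1)} w \<partial>lborel)
    \<le> ennreal ((3 + 8 / (1 - \<beta>)) * g powr (1 - \<beta>) * (1 + \<bar>real i - real j\<bar>) powr (- \<beta>))"
proof -
  define d where "d = \<bar>real i - real j\<bar>"
  have d: "0 \<le> d" by (simp add: d_def)
  have gp: "0 < g powr (1 - \<beta>)" using g by simp
  show ?thesis
  proof (cases "d \<le> 1")
    case True
    have "(\<integral>\<^sup>+w. ennreal (\<bar>u - w\<bar> powr (- \<beta>)) * indicator {g * real j..g * real (j + 1)} w \<partial>lborel)
      \<le> (\<integral>\<^sup>+w. ennreal (\<bar>u - w\<bar> powr (- \<beta>)) * indicator {u - 2 * g..u + 2 * g} w \<partial>lborel)"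
    proof (intro nn_integral_mono mult_left_mono)
      fix w
      have "w \<in> {u - 2 * g..u + 2 * g}" if "w \<in> {g * real j..g * real (j + 1)}"
      proof -
        have "g * real i - g * real j \<le> g" "g * real j - g * real i \<le> g"
          using True mult_left_mono[of "real i - real j" 1 g] mult_left_mono[of "real j - real i" 1 g] g
          by (auto simp: d_def algebra_simps)
        then show ?thesis using that u by (auto simp: algebra_simps)
      qed
      then show "indicator {g * real j..g * real (j + 1)} w \<le> (indicator {u - 2 * g..u + 2 * g} w :: ennreal)"
        by (auto simp: indicator_def)
    qed simp
    also have "\<dots> \<le> ennreal (2 * (2 * g) powr (1 - \<beta>) / (1 - \<beta>))"
      using \<beta> g by (intro nn_integral_riesz_local) auto
    also have "\<dots> \<le> ennreal ((3 + 8 / (1 - \<beta>)) * g powr (1 - \<beta>) * (1 + d) powr (- \<beta>))"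
    proof (rule ennreal_leI)
      have "2 powr (1 - \<beta>) \<le> (2::real) powr 1" using \<beta> by (intro powr_mono) auto
      moreover have "1 / 2 \<le> (1 + d) powr (- \<beta>)"
      proof -
        have "(1 + d) powr (- 1) \<le> (1 + d) powr (- \<beta>)" using \<beta> d by (intro powr_mono) auto
        moreover have "1 / 2 \<le> (1 + d) powr (- 1)"
          using True d by (simp add: powr_minus field_simps)
        ultimately show ?thesis by linarith
      qed
      ultimately have "2 powr (1 - \<beta>) * 1 \<le> 2 * (2 * (1 + d) powr (- \<beta>))" by (intro mult_mono) auto
      then have "2 * (2 * g) powr (1 - \<beta>) / (1 - \<beta>) \<le> 2 * (4 * (1 + d) powr (- \<beta>) * g powr (1 - \<beta>)) / (1 - \<beta>)"
        using \<beta> g gp by (auto simp: powr_mult intro!: divide_right_mono)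
      also have "\<dots> = 8 / (1 - \<beta>) * (g powr (1 - \<beta>) * (1 + d) powr (- \<beta>))"
        by simp
      also have "\<dots> \<le> (3 + 8 / (1 - \<beta>)) * (g powr (1 - \<beta>) * (1 + d) powr (- \<beta>))"
        by (intro mult_right_mono) auto
      also have "\<dots> = (3 + 8 / (1 - \<beta>)) * g powr (1 - \<beta>) * (1 + d) powr (- \<beta>)"
        by (simp only: mult.assoc)
      finally show "2 * (2 * g) powr (1 - \<beta>) / (1 - \<beta>) \<le> (3 + 8 / (1 - \<beta>)) * g powr (1 - \<beta>) * (1 + d) powr (- \<beta>)" .
    qed
    finally show ?thesis by (simp add: d_def)
  next
    case False
    \<comment> \<open>Index distances are integers, and from 2 on \<open>(1 + d) / 3\<close> is at
      most \<open>d - 1\<close>.\<close>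
    have d2: "2 \<le> d"
    proof -
      have d_int: "d = real_of_int \<bar>int i - int j\<bar>" by (simp add: d_def)
      then have "1 < \<bar>int i - int j\<bar>" using False by linarith
      then show ?thesis unfolding d_int by linarith
    qed
    have "(\<integral>\<^sup>+w. ennreal (\<bar>u - w\<bar> powr (- \<beta>)) * indicator {g * real j..g * real (j + 1)} w \<partial>lborel)
      \<le> (\<integral>\<^sup>+w. ennreal ((g * ((1 + d) / 3)) powr (- \<beta>)) * indicator {g * real j..g * real (j + 1)} w \<partial>lborel)"
    proof (intro nn_integral_mono)
      fix w
      have "\<bar>u - w\<bar> powr (- \<beta>) \<le> (g * ((1 + d) / 3)) powr (- \<beta>)" if "w \<in> {g * real j..g * real (j + 1)}"
      proof (rule powr_mono2')
        have "g * ((1 + d) / 3) \<le> g * (d - 1)" using d2 g by (intro mult_left_mono) auto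
        also have "\<dots> \<le> \<bar>u - w\<bar>"
        proof -
          have "g * (d - 1) = g * d - g" "g * real (i + 1) = g * real i + g" "g * real (j + 1) = g * real j + g"
            by (simp_all add: algebra_simps)
          moreover have "g * d = g * real j - g * real i \<or> g * d = g * real i - g * real j"
            by (auto simp: d_def abs_if right_diff_distrib)
          ultimately show ?thesis using that u unfolding atLeastAtMost_iff by linarith
        qed
        finally show "g * ((1 + d) / 3) \<le> \<bar>u - w\<bar>" .
      qed (use \<beta> g d in auto)
      then show "ennreal (\<bar>u - w\<bar> powr (- \<beta>)) * indicator {g * real j..g * real (j + 1)} w \<le>
          ennreal ((g * ((1 + d) / 3)) powr (- \<beta>)) * indicator {g * real j..g * real (j + 1)} w"
        by (auto simp: indicator_def intro: ennreal_leI)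
    qed
    also have "\<dots> = ennreal ((g * ((1 + d) / 3)) powr (- \<beta>) * g)"
      using g by (simp add: nn_integral_cmult ennreal_mult algebra_simps)
    also have "\<dots> \<le> ennreal ((3 + 8 / (1 - \<beta>)) * g powr (1 - \<beta>) * (1 + d) powr (- \<beta>))"
    proof (rule ennreal_leI)
      have "(g * ((1 + d) / 3)) powr (- \<beta>) * g = g powr (1 - \<beta>) * (1 + d) powr (- \<beta>) * 3 powr \<beta>"
      proof -
        have gb: "g powr (- \<beta>) * g = g powr (1 - \<beta>)"
          using g powr_add[of g "- \<beta>" 1] by simp
        have "(g * (D / 3)) powr (- \<beta>) = g powr (- \<beta>) * (D powr (- \<beta>) * 3 powr \<beta>)" if "0 < D" for D
          using g that by (simp add: powr_mult powr_divide powr_minus field_simps)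
        from this[of "1 + d"] have "(g * ((1 + d) / 3)) powr (- \<beta>) = g powr (- \<beta>) * ((1 + d) powr (- \<beta>) * 3 powr \<beta>)"
          using d by simp
        then have "(g * ((1 + d) / 3)) powr (- \<beta>) * g = (g powr (- \<beta>) * g) * ((1 + d) powr (- \<beta>) * 3 powr \<beta>)"
          by (simp only: mult_ac)
        then show ?thesis unfolding gb by (simp only: mult_ac)
      qed
      also have "\<dots> \<le> g powr (1 - \<beta>) * (1 + d) powr (- \<beta>) * (3 + 8 / (1 - \<beta>))"
      proof (rule mult_left_mono)
        have "3 powr \<beta> \<le> (3::real) powr 1" using \<beta> by (intro powr_mono) auto
        then show "3 powr \<beta> \<le> 3 + 8 / (1 - \<beta>)" using \<beta> by (simp add: add_increasing2)
      qed simp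
      finally show "(g * ((1 + d) / 3)) powr (- \<beta>) * g \<le> (3 + 8 / (1 - \<beta>)) * g powr (1 - \<beta>) * (1 + d) powr (- \<beta>)"
        by (simp add: mult_ac)
    qed
    finally show ?thesis by (simp add: d_def)
  qed
qed

section \<open>The one-dimensional singular kernel and its overlaps\<close>

definition sing :: "real \<Rightarrow> real \<Rightarrow> real \<Rightarrow> real" where
  "sing \<alpha> u x = max 0 (u - x) powr (- \<alpha>)"

lemma sing_nonneg: "0 \<le> sing \<alpha> u x"
  by (simp add: sing_def)

lemma sing_measurable [measurable]:
  "f \<in> borel_measurable N \<Longrightarrow> h \<in> borel_measurable N \<Longrightarrow> (\<lambda>z. sing \<alpha> (f z) (h z)) \<in> borel_measurable N"
  unfolding sing_def by measurable

text \<open>The two summands come from the parts of the overlap integral within and beyond distance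
  \<open>\<bar>u - w\<bar>\<close> of the smaller of the two points.\<close>

definition overlap_const :: "real \<Rightarrow> real" where
  "overlap_const \<alpha> = 1 / (1 - \<alpha>) + 1 / (2 * \<alpha> - 1)"

text \<open>The exact value is a Beta-type constant times the same power. For the bound, measure
  \<open>z\<close> leftwards from the smaller point and put \<open>d = w - u\<close>: for
  \<open>z \<le> d\<close> the farther factor is at most \<open>d powr (- \<alpha>)\<close>, beyond
  that both are at most \<open>z powr (- \<alpha>)\<close>. Convergence at 0 needs
  \<open>\<alpha> < 1\<close>, at infinity \<open>2 * \<alpha> > 1\<close>.\<close>

lemma nn_integral_sing_overlap:
  assumes \<alpha>: "1 / 2 < \<alpha>" "\<alpha> < 1" and uw: "u \<noteq> w"
  shows "(\<integral>\<^sup>+x. ennreal (sing \<alpha> u x) * ennreal (sing \<alpha> w x) \<partial>lborel)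
    \<le> ennreal (overlap_const \<alpha> * \<bar>u - w\<bar> powr (1 - 2 * \<alpha>))"
proof -
  have *: "(\<integral>\<^sup>+x. ennreal (sing \<alpha> u x) * ennreal (sing \<alpha> w x) \<partial>lborel)
    \<le> ennreal (overlap_const \<alpha> * (w - u) powr (1 - 2 * \<alpha>))" if "u < w" for u w
  proof -
    define d where "d = w - u"
    have d: "0 < d" using that by (simp add: d_def)
    have "(\<integral>\<^sup>+x. ennreal (sing \<alpha> u x) * ennreal (sing \<alpha> w x) \<partial>lborel) =
        (\<integral>\<^sup>+z. ennreal (max 0 z powr (- \<alpha>)) * ennreal (max 0 (z + d) powr (- \<alpha>)) \<partial>lborel)"
      using nn_integral_real_affine[of "\<lambda>x. ennreal (sing \<alpha> u x) * ennreal (sing \<alpha> w x)" "-1" u]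
      by (simp add: sing_def d_def algebra_simps)
    also have "\<dots> \<le> (\<integral>\<^sup>+z. ennreal (d powr (- \<alpha>)) * (ennreal (z powr (- \<alpha>)) * indicator {0..d} z)
        + ennreal (z powr (- (2 * \<alpha>))) * indicator {d..} z \<partial>lborel)"
    proof (rule nn_integral_mono)
      fix z :: real
      consider "z \<le> 0" | "0 < z" "z \<le> d" | "d < z" by linarith
      then show "ennreal (max 0 z powr (- \<alpha>)) * ennreal (max 0 (z + d) powr (- \<alpha>)) \<le>
        ennreal (d powr (- \<alpha>)) * (ennreal (z powr (- \<alpha>)) * indicator {0..d} z)
        + ennreal (z powr (- (2 * \<alpha>))) * indicator {d..} z"
      proof cases
        case 1
        then show ?thesis by simp
      next
        case 2
        have "ennreal (z powr (- \<alpha>)) * ennreal ((z + d) powr (- \<alpha>)) \<le> ennreal (z powr (- \<alpha>)) * ennreal (d powr (- \<alpha>))"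
          using 2 d \<alpha> by (intro mult_left_mono ennreal_leI powr_mono2') auto
        also have "\<dots> \<le> ennreal (z powr (- \<alpha>)) * ennreal (d powr (- \<alpha>)) + ennreal (z powr (- (2 * \<alpha>))) * indicator {d..} z"
          by simp
        finally show ?thesis using 2 d by (simp add: mult_ac)
      next
        case 3
        have "ennreal (z powr (- \<alpha>)) * ennreal ((z + d) powr (- \<alpha>)) \<le> ennreal (z powr (- \<alpha>)) * ennreal (z powr (- \<alpha>))"
          using 3 d \<alpha> by (intro mult_left_mono ennreal_leI powr_mono2') auto
        also have "\<dots> = ennreal (z powr (- (2 * \<alpha>)))"
          by (simp add: ennreal_mult[symmetric] powr_add[symmetric])
        finally show ?thesis using 3 d by simp
      qed
    qed
    also have "\<dots> = ennreal (d powr (- \<alpha>)) * ennreal (d powr (1 - \<alpha>) / (1 - \<alpha>)) + ennreal (d powr (1 - 2 * \<alpha>) / (2 * \<alpha> - 1))"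
      using nn_integral_powr_0[of "- \<alpha>" d] nn_integral_powr_inf[of d "2 * \<alpha>"] \<alpha> d
      by (subst nn_integral_add) (auto simp: nn_integral_cmult)
    also have "\<dots> = ennreal (overlap_const \<alpha> * d powr (1 - 2 * \<alpha>))"
    proof -
      have "d powr (- \<alpha>) * d powr (1 - \<alpha>) = d powr (1 - 2 * \<alpha>)" by (simp add: powr_add[symmetric])
      then show ?thesis
        using \<alpha> by (simp add: ennreal_mult[symmetric] ennreal_plus[symmetric] overlap_const_def algebra_simps del: ennreal_plus)
    qed
    finally show ?thesis by (simp add: d_def)
  qed
  show ?thesis
  proof (cases "u < w")
    case True
    then show ?thesis using *[OF True] by simp
  next
    case False
    then have "w < u" using uw by simp
    then show ?thesis using *[of w u] by (simp add: mult.commute)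
  qed
qed

lemma overlap_const_pos: "1 / 2 < \<alpha> \<Longrightarrow> \<alpha> < 1 \<Longrightarrow> 0 < overlap_const \<alpha>"
  by (simp add: overlap_const_def add_pos_pos)

section \<open>Increments of the Hermite kernel\<close>

text \<open>The kernel of an increment with values in \<open>ennreal\<close>: additivity in the
  interval and Tonelli then hold without excluding the points \<open>y\<close> where the integral
  over \<open>u\<close> diverges.\<close>

definition kernel_nn :: "real \<Rightarrow> nat \<Rightarrow> real \<Rightarrow> real \<Rightarrow> (nat \<Rightarrow> real) \<Rightarrow> ennreal" where
  "kernel_nn \<alpha> q a b y = (\<integral>\<^sup>+u. indicator {a..b} u * (\<Prod>l<q. ennreal (sing \<alpha> u (y l))) \<partial>lborel)"

lemma kernel_nn_measurable [measurable]: "kernel_nn \<alpha> q a b \<in> borel_measurable (lborel_pow q)"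
proof -
  have "(\<lambda>z. indicator {a..b} (snd z) * (\<Prod>l<q. ennreal (sing \<alpha> (snd z) ((fst z) l)))) \<in> borel_measurable (lborel_pow q \<Otimes>\<^sub>M lborel)"
    by measurable
  then show ?thesis
    unfolding kernel_nn_def[abs_def] by (intro lborel.borel_measurable_nn_integral) (simp add: split_beta')
qed

text \<open>By Tonelli the integral over \<open>y\<close> comes innermost, where the product over
  coordinates factorises into equal one-dimensional overlaps.\<close>

lemma nn_integral_kernel_mult:
  "(\<integral>\<^sup>+y. kernel_nn \<alpha> q a b y * kernel_nn \<alpha> q a' b' y \<partial>lborel_pow q) =
    (\<integral>\<^sup>+u. \<integral>\<^sup>+w. indicator {a..b} u * indicator {a'..b'} w *
      (\<integral>\<^sup>+x. ennreal (sing \<alpha> u x) * ennreal (sing \<alpha> w x) \<partial>lborel) ^ q \<partial>lborel \<partial>lborel)"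
proof -
  interpret P: sigma_finite_measure "lborel_pow q" by (rule lborel_pow.sigma_finite) simp
  interpret PS: pair_sigma_finite lborel "lborel_pow q" ..
  define h where "h u y = (\<Prod>l<q. ennreal (sing \<alpha> u (y l)))" for u and y :: "nat \<Rightarrow> real"
  have h_meas: "(\<lambda>z. h (f z) (k z)) \<in> borel_measurable N" if [measurable]: "f \<in> borel_measurable N" "k \<in> measurable N (lborel_pow q)"
    for f k and N :: "'z measure"
    unfolding h_def
  proof (rule borel_measurable_prod_ennreal)
    fix l assume "l \<in> {..<q}"
    then have [measurable]: "(\<lambda>z. k z l) \<in> borel_measurable N"
      using measurable_compose[OF that(2) measurable_component_singleton[of l "{..<q}" "\<lambda>_. lborel"]] by simp
    show "(\<lambda>z. ennreal (sing \<alpha> (f z) (k z l))) \<in> borel_measurable N" by measurable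
  qed
  have [measurable]: "(\<lambda>u. h u y) \<in> borel_measurable borel" if "y \<in> space (lborel_pow q)" for y
    by (rule h_meas) (use that in auto)
  have [measurable]: "h u \<in> borel_measurable (lborel_pow q)" for u
    by (rule h_meas) auto
  have "(\<integral>\<^sup>+y. kernel_nn \<alpha> q a b y * kernel_nn \<alpha> q a' b' y \<partial>lborel_pow q) =
     (\<integral>\<^sup>+y. \<integral>\<^sup>+u. \<integral>\<^sup>+w. (indicator {a..b} u * h u y) * (indicator {a'..b'} w * h w y) \<partial>lborel \<partial>lborel \<partial>lborel_pow q)"
    unfolding kernel_nn_def h_def[symmetric]
    by (intro nn_integral_cong) (simp add: nn_integral_cmult nn_integral_multc)
  also have "\<dots> = (\<integral>\<^sup>+u. \<integral>\<^sup>+y. \<integral>\<^sup>+w. (indicator {a..b} u * h u y) * (indicator {a'..b'} w * h w y) \<partial>lborel \<partial>lborel_pow q \<partial>lborel)"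
  proof (rule PS.Fubini')
    have [measurable]: "(\<lambda>z. h (fst (fst z)) (snd (fst z))) \<in> borel_measurable ((lborel \<Otimes>\<^sub>M lborel_pow q) \<Otimes>\<^sub>M lborel)"
      "(\<lambda>z. h (snd z) (snd (fst z))) \<in> borel_measurable ((lborel \<Otimes>\<^sub>M lborel_pow q) \<Otimes>\<^sub>M lborel)"
      by (rule h_meas; measurable)+
    have "(\<lambda>z. (indicator {a..b} (fst (fst z)) * h (fst (fst z)) (snd (fst z))) * (indicator {a'..b'} (snd z) * h (snd z) (snd (fst z))))
        \<in> borel_measurable ((lborel \<Otimes>\<^sub>M lborel_pow q) \<Otimes>\<^sub>M lborel)"
      by measurable
    from lborel.borel_measurable_nn_integral_fst[OF this]
    show "(\<lambda>(u, y). \<integral>\<^sup>+w. (indicator {a..b} u * h u y) * (indicator {a'..b'} w * h w y) \<partial>lborel) \<in> borel_measurable (lborel \<Otimes>\<^sub>M lborel_pow q)"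
      by (simp add: split_beta')
  qed
  also have "\<dots> = (\<integral>\<^sup>+u. \<integral>\<^sup>+w. \<integral>\<^sup>+y. (indicator {a..b} u * h u y) * (indicator {a'..b'} w * h w y) \<partial>lborel_pow q \<partial>lborel \<partial>lborel)"
  proof (intro nn_integral_cong PS.Fubini')
    fix u
    have [measurable]: "(\<lambda>z. h u (snd z)) \<in> borel_measurable (lborel \<Otimes>\<^sub>M lborel_pow q)"
      "(\<lambda>z. h (fst z) (snd z)) \<in> borel_measurable (lborel \<Otimes>\<^sub>M lborel_pow q)"
      by (rule h_meas; measurable)+
    show "(\<lambda>(w, y). (indicator {a..b} u * h u y) * (indicator {a'..b'} w * h w y)) \<in> borel_measurable (lborel \<Otimes>\<^sub>M lborel_pow q)"
      unfolding split_beta' by measurable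
  qed
  also have "\<dots> = (\<integral>\<^sup>+u. \<integral>\<^sup>+w. indicator {a..b} u * indicator {a'..b'} w *
      (\<integral>\<^sup>+x. ennreal (sing \<alpha> u x) * ennreal (sing \<alpha> w x) \<partial>lborel) ^ q \<partial>lborel \<partial>lborel)"
  proof (intro nn_integral_cong)
    fix u w
    have "(\<integral>\<^sup>+y. (indicator {a..b} u * h u y) * (indicator {a'..b'} w * h w y) \<partial>lborel_pow q) =
        (\<integral>\<^sup>+y. (indicator {a..b} u * indicator {a'..b'} w) * (h u y * h w y) \<partial>lborel_pow q)"
      by (simp only: mult_ac)
    also have "\<dots> = indicator {a..b} u * indicator {a'..b'} w * (\<integral>\<^sup>+y. h u y * h w y \<partial>lborel_pow q)"
      by (intro nn_integral_cmult) measurable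
    also have "(\<integral>\<^sup>+y. h u y * h w y \<partial>lborel_pow q) = (\<integral>\<^sup>+y. (\<Prod>l<q. ennreal (sing \<alpha> u (y l)) * ennreal (sing \<alpha> w (y l))) \<partial>lborel_pow q)"
      by (simp add: h_def prod.distrib)
    also have "\<dots> = (\<integral>\<^sup>+x. ennreal (sing \<alpha> u x) * ennreal (sing \<alpha> w x) \<partial>lborel) ^ q"
      by (subst lborel_pow.product_nn_integral_prod) auto
    finally show "(\<integral>\<^sup>+y. (indicator {a..b} u * h u y) * (indicator {a'..b'} w * h w y) \<partial>lborel_pow q) =
      indicator {a..b} u * indicator {a'..b'} w * (\<integral>\<^sup>+x. ennreal (sing \<alpha> u x) * ennreal (sing \<alpha> w x) \<partial>lborel) ^ q" .
  qed
  finally show ?thesis .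
qed

text \<open>The \<open>q\<close>-th power of the overlap bound is a Riesz kernel with exponent
  \<open>\<beta>\<close>. Integrating it over one cell gives \<open>g powr (1 - \<beta>)\<close>
  times the decay in the index distance, and the other cell contributes its length
  \<open>g\<close>.\<close>

lemma nn_integral_kernel_grid_le:
  fixes g :: real and i j q :: nat
  assumes \<alpha>: "1 / 2 < \<alpha>" "\<alpha> < 1" and \<beta>: "\<beta> = real q * (2 * \<alpha> - 1)" "0 < \<beta>" "\<beta> < 1" and g: "0 < g"
  shows "(\<integral>\<^sup>+y. kernel_nn \<alpha> q (g * real i) (g * real (i + 1)) y * kernel_nn \<alpha> q (g * real j) (g * real (j + 1)) y \<partial>lborel_pow q)
    \<le> ennreal (overlap_const \<alpha> ^ q * (3 + 8 / (1 - \<beta>)) * (g powr (2 - \<beta>) * (1 + \<bar>real i - real j\<bar>) powr (- \<beta>)))"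
proof -
  let ?I = "indicator {g * real i..g * real (i + 1)} :: real \<Rightarrow> ennreal"
  let ?J = "indicator {g * real j..g * real (j + 1)} :: real \<Rightarrow> ennreal"
  define c where "c = overlap_const \<alpha> ^ q"
  define R where "R = (3 + 8 / (1 - \<beta>)) * g powr (1 - \<beta>) * (1 + \<bar>real i - real j\<bar>) powr (- \<beta>)"
  have c: "0 \<le> c" using overlap_const_pos[OF \<alpha>] by (simp add: c_def)
  have R: "0 \<le> R" using \<beta> by (simp add: R_def)
  have pow: "(\<integral>\<^sup>+x. ennreal (sing \<alpha> u x) * ennreal (sing \<alpha> w x) \<partial>lborel) ^ q \<le> ennreal (c * \<bar>u - w\<bar> powr (- \<beta>))"
    if "u \<noteq> w" for u w
  proof -
    have "(\<integral>\<^sup>+x. ennreal (sing \<alpha> u x) * ennreal (sing \<alpha> w x) \<partial>lborel) ^ q \<le>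
        ennreal (overlap_const \<alpha> * \<bar>u - w\<bar> powr (1 - 2 * \<alpha>)) ^ q"
      using nn_integral_sing_overlap[OF \<alpha> that] by (rule power_mono) simp
    also have "\<dots> = ennreal ((overlap_const \<alpha> * \<bar>u - w\<bar> powr (1 - 2 * \<alpha>)) ^ q)"
      using overlap_const_pos[OF \<alpha>] by (intro ennreal_power) auto
    also have "(overlap_const \<alpha> * \<bar>u - w\<bar> powr (1 - 2 * \<alpha>)) ^ q = c * \<bar>u - w\<bar> powr (- \<beta>)"
    proof -
      have "(\<bar>u - w\<bar> powr (1 - 2 * \<alpha>)) ^ q = \<bar>u - w\<bar> powr (- \<beta>)"
        using that by (simp add: powr_realpow[symmetric] powr_powr \<beta> algebra_simps)
      then show ?thesis by (simp add: power_mult_distrib c_def)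
    qed
    finally show ?thesis .
  qed
  have "(\<integral>\<^sup>+y. kernel_nn \<alpha> q (g * real i) (g * real (i + 1)) y * kernel_nn \<alpha> q (g * real j) (g * real (j + 1)) y \<partial>lborel_pow q)
      \<le> (\<integral>\<^sup>+u. ?I u * ennreal (c * R) \<partial>lborel)"
    unfolding nn_integral_kernel_mult
  proof (rule nn_integral_mono)
    fix u
    have "(\<integral>\<^sup>+w. ?I u * ?J w * (\<integral>\<^sup>+x. ennreal (sing \<alpha> u x) * ennreal (sing \<alpha> w x) \<partial>lborel) ^ q \<partial>lborel)
        \<le> (\<integral>\<^sup>+w. (?I u * ennreal c) * (ennreal (\<bar>u - w\<bar> powr (- \<beta>)) * ?J w) \<partial>lborel)"
    proof (rule nn_integral_mono_AE)
      \<comment> \<open>The diagonal has to be left out: for \<open>w = u\<close> the overlap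
        integral diverges, while \<open>0 powr (- \<beta>)\<close> is 0.\<close>
      have "AE w in lborel. w \<noteq> u" by (rule AE_lborel_singleton)
      then show "AE w in lborel. ?I u * ?J w * (\<integral>\<^sup>+x. ennreal (sing \<alpha> u x) * ennreal (sing \<alpha> w x) \<partial>lborel) ^ q
          \<le> (?I u * ennreal c) * (ennreal (\<bar>u - w\<bar> powr (- \<beta>)) * ?J w)"
      proof eventually_elim
        fix w assume "w \<noteq> u"
        then have "?I u * ?J w * (\<integral>\<^sup>+x. ennreal (sing \<alpha> u x) * ennreal (sing \<alpha> w x) \<partial>lborel) ^ q
            \<le> ?I u * ?J w * ennreal (c * \<bar>u - w\<bar> powr (- \<beta>))"
          by (intro mult_left_mono pow) auto
        then show "?I u * ?J w * (\<integral>\<^sup>+x. ennreal (sing \<alpha> u x) * ennreal (sing \<alpha> w x) \<partial>lborel) ^ q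
          \<le> (?I u * ennreal c) * (ennreal (\<bar>u - w\<bar> powr (- \<beta>)) * ?J w)"
          using c by (simp add: ennreal_mult mult_ac)
      qed
    qed
    also have "\<dots> = (?I u * ennreal c) * (\<integral>\<^sup>+w. ennreal (\<bar>u - w\<bar> powr (- \<beta>)) * ?J w \<partial>lborel)"
      by (intro nn_integral_cmult) measurable
    also have "\<dots> \<le> (?I u * ennreal c) * ennreal R"
    proof (cases "u \<in> {g * real i..g * real (i + 1)}")
      case True
      then show ?thesis
        unfolding R_def using \<beta> g by (intro mult_left_mono nn_integral_riesz_grid) auto
    next
      case False
      then have "?I u = 0" by simp
      then show ?thesis by (simp only: mult_zero_left order_refl)
    qed
    also have "\<dots> = ?I u * ennreal (c * R)" using c R by (simp add: ennreal_mult mult.assoc)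
    finally show "(\<integral>\<^sup>+w. ?I u * ?J w * (\<integral>\<^sup>+x. ennreal (sing \<alpha> u x) * ennreal (sing \<alpha> w x) \<partial>lborel) ^ q \<partial>lborel) \<le> ?I u * ennreal (c * R)" .
  qed
  also have "\<dots> = (\<integral>\<^sup>+u. ?I u \<partial>lborel) * ennreal (c * R)"
    by (intro nn_integral_multc) measurable
  also have "\<dots> = ennreal (g * (c * R))"
    using g c R by (simp add: ennreal_mult[symmetric] algebra_simps)
  also have "g * (c * R) = overlap_const \<alpha> ^ q * (3 + 8 / (1 - \<beta>)) * (g powr (2 - \<beta>) * (1 + \<bar>real i - real j\<bar>) powr (- \<beta>))"
  proof -
    have "g * g powr (1 - \<beta>) = g powr (2 - \<beta>)" using g powr_add[of g 1 "1 - \<beta>"] by simp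
    then show ?thesis by (simp add: R_def c_def mult_ac)
  qed
  finally show ?thesis .
qed

abbreviation kernel_incr :: "real \<Rightarrow> nat \<Rightarrow> real \<Rightarrow> nat \<Rightarrow> (nat \<Rightarrow> real) \<Rightarrow> real" where
  "kernel_incr H q g i y \<equiv> hermite_kernel H q (g * real (i + 1)) y - hermite_kernel H q (g * real i) y"

text \<open>Valid at every \<open>y\<close>: where the integral over \<open>u\<close> diverges,
  \<open>enn2real\<close> sends infinity to 0, the value of a non-integrable Bochner
  integral.\<close>

lemma hermite_kernel_eq_kernel_nn:
  "hermite_kernel H q t y = enn2real (kernel_nn (1 / 2 + (1 - H) / real q) q 0 t y)"
proof -
  have "hermite_kernel H q t y =
      (\<integral>u. indicator {0..t} u * (\<Prod>l<q. sing (1 / 2 + (1 - H) / real q) u (y l)) \<partial>lborel)"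
    by (simp add: hermite_kernel_def sing_def set_lebesgue_integral_def)
  also have "\<dots> = enn2real (\<integral>\<^sup>+u. ennreal (indicator {0..t} u * (\<Prod>l<q. sing (1 / 2 + (1 - H) / real q) u (y l))) \<partial>lborel)"
    by (intro integral_eq_nn_integral) (auto intro!: mult_nonneg_nonneg prod_nonneg sing_nonneg)
  also have "(\<integral>\<^sup>+u. ennreal (indicator {0..t} u * (\<Prod>l<q. sing (1 / 2 + (1 - H) / real q) u (y l))) \<partial>lborel) =
      kernel_nn (1 / 2 + (1 - H) / real q) q 0 t y"
    unfolding kernel_nn_def
    by (intro nn_integral_cong) (simp add: ennreal_mult prod_nonneg sing_nonneg ennreal_indicator prod_ennreal)
  finally show ?thesis .
qed

lemma kernel_nn_split:
  assumes "a \<le> b" "b \<le> c"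
  shows "kernel_nn \<alpha> q a c y = kernel_nn \<alpha> q a b y + kernel_nn \<alpha> q b c y"
proof -
  have "AE u in lborel. u \<noteq> b" by (rule AE_lborel_singleton)
  then have "AE u in lborel. indicator {a..c} u * (\<Prod>l<q. ennreal (sing \<alpha> u (y l))) =
      indicator {a..b} u * (\<Prod>l<q. ennreal (sing \<alpha> u (y l))) + indicator {b..c} u * (\<Prod>l<q. ennreal (sing \<alpha> u (y l)))"
    by eventually_elim (use assms in \<open>auto simp: indicator_def\<close>)
  then show ?thesis
    unfolding kernel_nn_def by (subst nn_integral_add[symmetric]) (auto intro: nn_integral_cong_AE)
qed

text \<open>The exponent in the kernel is tuned to the order: the product of \<open>q\<close>
  overlaps decays with exponent \<open>2 - 2 * H\<close>, whatever \<open>q\<close> is.\<close>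

lemma hermite_exponent:
  fixes H :: real and q :: nat
  assumes H: "1 / 2 < H" "H < 1" and q: "1 \<le> q" and \<alpha>: "\<alpha> = 1 / 2 + (1 - H) / real q"
  shows "1 / 2 < \<alpha>" "\<alpha> < 1" "real q * (2 * \<alpha> - 1) = 2 - 2 * H"
proof -
  have q0: "0 < real q" "1 \<le> real q" using q by auto
  show "1 / 2 < \<alpha>" using H q0 by (simp add: \<alpha>)
  have "(1 - H) / real q \<le> (1 - H) / 1" using H q0 by (intro divide_left_mono) auto
  then show "\<alpha> < 1" using H by (simp add: \<alpha>)
  show "real q * (2 * \<alpha> - 1) = 2 - 2 * H" using q0 by (simp add: \<alpha> field_simps)
qed

lemma kernel_nn_finite:
  assumes H: "1 / 2 < H" "H < 1" and q: "1 \<le> q" and \<alpha>: "\<alpha> = 1 / 2 + (1 - H) / real q" and t: "0 < t"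
  shows "AE y in lborel_pow q. kernel_nn \<alpha> q 0 t y < \<infinity>"
proof -
  note ex = hermite_exponent[OF H q \<alpha>]
  have "(\<integral>\<^sup>+y. kernel_nn \<alpha> q 0 t y * kernel_nn \<alpha> q 0 t y \<partial>lborel_pow q) < \<infinity>"
    \<comment> \<open>The interval \<open>{0..t}\<close> is the cell with index 0 of the grid of
      mesh \<open>t\<close>.\<close>
    using nn_integral_kernel_grid_le[OF ex(1,2) refl, of q t 0 0] t H
    by (auto simp: ex(3) order_le_less_trans[OF _ ennreal_less_top])
  then have "AE y in lborel_pow q. kernel_nn \<alpha> q 0 t y * kernel_nn \<alpha> q 0 t y \<noteq> \<infinity>"
    by (intro nn_integral_PInf_AE) auto
  then show ?thesis
    by eventually_elim (auto simp: ennreal_mult_eq_top_iff less_top)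
qed

lemma hermite_kernel_increment:
  assumes H: "1 / 2 < H" "H < 1" and q: "1 \<le> q" and \<alpha>: "\<alpha> = 1 / 2 + (1 - H) / real q"
    and ab: "0 \<le> a" "a < b"
  shows "AE y in lborel_pow q. 0 \<le> hermite_kernel H q b y - hermite_kernel H q a y \<and>
    ennreal (hermite_kernel H q b y - hermite_kernel H q a y) = kernel_nn \<alpha> q a b y"
proof -
  have "AE y in lborel_pow q. kernel_nn \<alpha> q 0 b y < \<infinity>"
    using ab by (intro kernel_nn_finite[OF H q \<alpha>]) auto
  then show ?thesis
  proof eventually_elim
    fix y assume fin: "kernel_nn \<alpha> q 0 b y < \<infinity>"
    have split: "kernel_nn \<alpha> q 0 b y = kernel_nn \<alpha> q 0 a y + kernel_nn \<alpha> q a b y"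
      using ab by (intro kernel_nn_split) auto
    \<comment> \<open>Finiteness up to \<open>b\<close> passes to both parts; without it
      \<open>enn2real\<close> would not be additive.\<close>
    then have "kernel_nn \<alpha> q 0 a y < \<infinity>" "kernel_nn \<alpha> q a b y < \<infinity>"
      using fin by (auto simp: less_top)
    then have "hermite_kernel H q b y - hermite_kernel H q a y = enn2real (kernel_nn \<alpha> q a b y)"
      unfolding hermite_kernel_eq_kernel_nn \<alpha>[symmetric] split by (simp add: enn2real_plus)
    then show "0 \<le> hermite_kernel H q b y - hermite_kernel H q a y \<and>
        ennreal (hermite_kernel H q b y - hermite_kernel H q a y) = kernel_nn \<alpha> q a b y"
      using \<open>kernel_nn \<alpha> q a b y < \<infinity>\<close> by simp
  qed
qed

lemma hermite_kernel_symmetric: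
  assumes "\<sigma> permutes {..<q}"
  shows "hermite_kernel H q t (y \<circ> \<sigma>) = hermite_kernel H q t y"
  unfolding hermite_kernel_def
  using prod.permute[OF assms, of "\<lambda>l. max 0 (_ - y l) powr (- (1 / 2 + (1 - H) / real q))"]
  by (simp add: comp_def)

section \<open>A product-form minorant of the kernel increments\<close>

definition test_fun :: "real \<Rightarrow> real \<Rightarrow> nat \<Rightarrow> real \<Rightarrow> real" where
  "test_fun \<alpha> g i x = indicator {..<g * real i} x * (g * real (i + 1) - x) powr (- \<alpha>)"

lemma test_fun_measurable [measurable]: "test_fun \<alpha> g i \<in> borel_measurable borel"
  unfolding test_fun_def[abs_def] by measurable

lemma test_fun_le_sing:
  assumes "0 \<le> \<alpha>" "0 < g" "g * real i \<le> u" "u \<le> g * real (i + 1)"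
  shows "test_fun \<alpha> g i x \<le> sing \<alpha> u x"
proof (cases "x < g * real i")
  case True
  then have "(g * real (i + 1) - x) powr (- \<alpha>) \<le> (u - x) powr (- \<alpha>)"
    using assms by (intro powr_mono2') auto
  then show ?thesis using True assms by (simp add: test_fun_def sing_def max_def)
next
  case False
  then show ?thesis by (simp add: test_fun_def sing_nonneg)
qed

text \<open>To the left of the cell, replacing \<open>u\<close> by the right end point bounds every
  factor from below independently of \<open>u\<close>. The integral over \<open>u\<close> then only
  contributes the length \<open>g\<close>, and what remains is a tensor power, for which
  contractions factorise.\<close>

lemma kernel_nn_ge:
  assumes "0 \<le> \<alpha>" "0 < g"
  shows "ennreal g * (\<Prod>l<q. ennreal (test_fun \<alpha> g i (y l))) \<le> kernel_nn \<alpha> q (g * real i) (g * real (i + 1)) y"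
proof -
  have "ennreal g * (\<Prod>l<q. ennreal (test_fun \<alpha> g i (y l))) =
      (\<integral>\<^sup>+u. indicator {g * real i..g * real (i + 1)} u * (\<Prod>l<q. ennreal (test_fun \<alpha> g i (y l))) \<partial>lborel)"
    using assms by (subst nn_integral_multc) (auto simp: algebra_simps)
  also have "\<dots> \<le> kernel_nn \<alpha> q (g * real i) (g * real (i + 1)) y"
    unfolding kernel_nn_def
  proof (rule nn_integral_mono)
    fix u
    show "indicator {g * real i..g * real (i + 1)} u * (\<Prod>l<q. ennreal (test_fun \<alpha> g i (y l))) \<le>
        indicator {g * real i..g * real (i + 1)} u * (\<Prod>l<q. ennreal (sing \<alpha> u (y l)))"
      by (cases "u \<in> {g * real i..g * real (i + 1)}")
         (use assms in \<open>auto intro!: prod_mono_ennreal ennreal_leI test_fun_le_sing\<close>)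
  qed
  finally show ?thesis .
qed

text \<open>It is enough to integrate over an interval of length \<open>G\<close> just left of both
  cells. The right ends of both cells lie within \<open>G\<close> of its right end \<open>b\<close>,
  so both functions are at least \<open>(2 * G) powr (- \<alpha>)\<close> there.\<close>

lemma nn_integral_test_fun_mult:
  fixes i j :: nat
  assumes \<alpha>: "0 \<le> \<alpha>" and g: "0 < g"
    and G_def: "G = g * (1 + \<bar>real i - real j\<bar>)"
  shows "ennreal ((2 * G) powr (- (2 * \<alpha>)) * G) \<le>
    (\<integral>\<^sup>+x. ennreal (test_fun \<alpha> g i x) * ennreal (test_fun \<alpha> g j x) \<partial>lborel)"
proof -
  define b where "b = g * real (min i j)"
  have G: "0 < G" using g by (simp add: G_def)
  have "ennreal ((2 * G) powr (- (2 * \<alpha>)) * G) =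
      (\<integral>\<^sup>+x. ennreal ((2 * G) powr (- (2 * \<alpha>))) * indicator {b - G<..<b} x \<partial>lborel)"
    using G by (simp add: nn_integral_cmult ennreal_mult)
  also have "\<dots> \<le> (\<integral>\<^sup>+x. ennreal (test_fun \<alpha> g i x) * ennreal (test_fun \<alpha> g j x) \<partial>lborel)"
  proof (rule nn_integral_mono)
    fix x
    show "ennreal ((2 * G) powr (- (2 * \<alpha>))) * indicator {b - G<..<b} x \<le> ennreal (test_fun \<alpha> g i x) * ennreal (test_fun \<alpha> g j x)"
    proof (cases "x \<in> {b - G<..<b}")
      case True
      have le: "(2 * G) powr (- \<alpha>) \<le> test_fun \<alpha> g k x" if "k = i \<or> k = j" for k
      proof -
        have "b \<le> g * real k" using that g by (auto simp: b_def)
        moreover have "g * real (k + 1) \<le> b + G"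
        proof -
          have "real (k + 1) \<le> real (min i j) + (1 + \<bar>real i - real j\<bar>)" using that by (auto simp: min_def)
          then have "g * real (k + 1) \<le> g * (real (min i j) + (1 + \<bar>real i - real j\<bar>))"
            using g by (intro mult_left_mono) auto
          then show ?thesis by (simp add: b_def G_def distrib_left)
        qed
        ultimately have "x < g * real k" "g * real (k + 1) - x \<le> 2 * G" "0 < g * real (k + 1) - x"
          using True g by (auto simp: algebra_simps)
        then show ?thesis
          using \<alpha> by (simp add: test_fun_def powr_mono2')
      qed
      have "ennreal ((2 * G) powr (- (2 * \<alpha>))) = ennreal ((2 * G) powr (- \<alpha>)) * ennreal ((2 * G) powr (- \<alpha>))"
        by (simp add: ennreal_mult[symmetric] powr_add[symmetric])
      also have "\<dots> \<le> ennreal (test_fun \<alpha> g i x) * ennreal (test_fun \<alpha> g j x)"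
        using le by (intro mult_mono ennreal_leI) auto
      finally show ?thesis using True by simp
    qed simp
  qed
  finally show ?thesis .
qed

text \<open>For tensor powers of \<open>h\<close> and \<open>h'\<close> the contracted slots give
  the squared norms of \<open>h\<close> and \<open>h'\<close>, each to the power \<open>p\<close>,
  and the two free slots give the squared inner product of \<open>h\<close> with
  \<open>h'\<close>.\<close>

lemma linked_product_ge_product:
  assumes [measurable]: "h \<in> borel_measurable borel" "h' \<in> borel_measurable borel"
    and f: "AE y in lborel_pow (Suc p). c * (\<Prod>l<Suc p. ennreal (h (y l))) \<le> ennreal (f y)"
    and f': "AE y in lborel_pow (Suc p). c' * (\<Prod>l<Suc p. ennreal (h' (y l))) \<le> ennreal (f' y)"
  shows "c ^ 2 * c' ^ 2 * (\<integral>\<^sup>+x. ennreal (h x) * ennreal (h' x) \<partial>lborel) ^ 2 *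
      ((\<integral>\<^sup>+x. ennreal (h x) * ennreal (h x) \<partial>lborel) * (\<integral>\<^sup>+x. ennreal (h' x) * ennreal (h' x) \<partial>lborel)) ^ p
    \<le> linked_product p f f'"
proof -
  define L where "L f x x' = (\<integral>\<^sup>+r. ennreal (f (r(p := x))) * ennreal (f (r(p := x'))) \<partial>lborel_pow p)"
    for f :: "(nat \<Rightarrow> real) \<Rightarrow> real" and x x'
  define N where "N h = (\<integral>\<^sup>+x. ennreal (h x) * ennreal (h x) \<partial>lborel)" for h :: "real \<Rightarrow> real"
  have inner: "c ^ 2 * N h ^ p * (ennreal (h x) * ennreal (h x')) \<le> L f x x'"
    if [measurable]: "h \<in> borel_measurable borel"
      and x: "AE r in lborel_pow p. c * (\<Prod>l<Suc p. ennreal (h ((r(p := x)) l))) \<le> ennreal (f (r(p := x)))"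
      and x': "AE r in lborel_pow p. c * (\<Prod>l<Suc p. ennreal (h ((r(p := x')) l))) \<le> ennreal (f (r(p := x')))"
    for c :: ennreal and f :: "(nat \<Rightarrow> real) \<Rightarrow> real" and h x x'
  proof -
    have "c ^ 2 * N h ^ p * (ennreal (h x) * ennreal (h x')) =
        c ^ 2 * (ennreal (h x) * ennreal (h x')) * (\<integral>\<^sup>+r. (\<Prod>l<p. ennreal (h (r l)) * ennreal (h (r l))) \<partial>lborel_pow p)"
      by (subst lborel_pow.product_nn_integral_prod) (auto simp: N_def mult_ac)
    also have "\<dots> = (\<integral>\<^sup>+r. c ^ 2 * (ennreal (h x) * ennreal (h x')) * (\<Prod>l<p. ennreal (h (r l)) * ennreal (h (r l))) \<partial>lborel_pow p)"
      by (intro nn_integral_cmult[symmetric]) measurable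
    also have "\<dots> \<le> L f x x'"
      unfolding L_def
    proof (rule nn_integral_mono_AE)
      show "AE r in lborel_pow p. c ^ 2 * (ennreal (h x) * ennreal (h x')) * (\<Prod>l<p. ennreal (h (r l)) * ennreal (h (r l)))
          \<le> ennreal (f (r(p := x))) * ennreal (f (r(p := x')))"
        using x x'
      proof eventually_elim
        fix r assume "c * (\<Prod>l<Suc p. ennreal (h ((r(p := x)) l))) \<le> ennreal (f (r(p := x)))"
          "c * (\<Prod>l<Suc p. ennreal (h ((r(p := x')) l))) \<le> ennreal (f (r(p := x')))"
        from mult_mono[OF this]
        show "c ^ 2 * (ennreal (h x) * ennreal (h x')) * (\<Prod>l<p. ennreal (h (r l)) * ennreal (h (r l)))
          \<le> ennreal (f (r(p := x))) * ennreal (f (r(p := x')))"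
          by (simp add: power2_eq_square prod.distrib mult_ac)
      qed
    qed
    finally show ?thesis .
  qed
  note F = AE_lborel_pow_Suc[OF f] and F' = AE_lborel_pow_Suc[OF f']
  define K where "K = c ^ 2 * c' ^ 2 * (N h * N h') ^ p"
  have "c ^ 2 * c' ^ 2 * (\<integral>\<^sup>+x. ennreal (h x) * ennreal (h' x) \<partial>lborel) ^ 2 * (N h * N h') ^ p =
      (\<integral>\<^sup>+x. \<integral>\<^sup>+x'. K * (ennreal (h x) * ennreal (h' x)) * (ennreal (h x') * ennreal (h' x')) \<partial>lborel \<partial>lborel)"
  proof -
    define S where "S = (\<integral>\<^sup>+x. ennreal (h x) * ennreal (h' x) \<partial>lborel)"
    have "(\<integral>\<^sup>+x'. K * (ennreal (h x) * ennreal (h' x)) * (ennreal (h x') * ennreal (h' x')) \<partial>lborel) =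
      K * (ennreal (h x) * ennreal (h' x)) * S" for x
      unfolding S_def by (intro nn_integral_cmult) measurable
    moreover have "(\<integral>\<^sup>+x. K * (ennreal (h x) * ennreal (h' x)) * S \<partial>lborel) = K * S * S"
    proof -
      have "(\<integral>\<^sup>+x. K * (ennreal (h x) * ennreal (h' x)) * S \<partial>lborel) = (\<integral>\<^sup>+x. (K * S) * (ennreal (h x) * ennreal (h' x)) \<partial>lborel)"
        by (simp only: mult_ac)
      also have "\<dots> = K * S * S"
        unfolding S_def by (intro nn_integral_cmult) measurable
      finally show ?thesis .
    qed
    ultimately show ?thesis
      by (simp add: K_def S_def power2_eq_square mult_ac)
  qed
  also have "\<dots> \<le> (\<integral>\<^sup>+x. \<integral>\<^sup>+x'. L f x x' * L f' x x' \<partial>lborel \<partial>lborel)"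
  proof (rule nn_integral_mono_AE)
    show "AE x in lborel. (\<integral>\<^sup>+x'. K * (ennreal (h x) * ennreal (h' x)) * (ennreal (h x') * ennreal (h' x')) \<partial>lborel)
        \<le> (\<integral>\<^sup>+x'. L f x x' * L f' x x' \<partial>lborel)"
      using F F'
    proof eventually_elim
      fix x assume x: "AE r in lborel_pow p. c * (\<Prod>l<Suc p. ennreal (h ((r(p := x)) l))) \<le> ennreal (f (r(p := x)))"
        "AE r in lborel_pow p. c' * (\<Prod>l<Suc p. ennreal (h' ((r(p := x)) l))) \<le> ennreal (f' (r(p := x)))"
      show "(\<integral>\<^sup>+x'. K * (ennreal (h x) * ennreal (h' x)) * (ennreal (h x') * ennreal (h' x')) \<partial>lborel)
        \<le> (\<integral>\<^sup>+x'. L f x x' * L f' x x' \<partial>lborel)"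
      proof (rule nn_integral_mono_AE)
        show "AE x' in lborel. K * (ennreal (h x) * ennreal (h' x)) * (ennreal (h x') * ennreal (h' x')) \<le> L f x x' * L f' x x'"
          using F F'
        proof eventually_elim
          fix x' assume x': "AE r in lborel_pow p. c * (\<Prod>l<Suc p. ennreal (h ((r(p := x')) l))) \<le> ennreal (f (r(p := x')))"
            "AE r in lborel_pow p. c' * (\<Prod>l<Suc p. ennreal (h' ((r(p := x')) l))) \<le> ennreal (f' (r(p := x')))"
          show "K * (ennreal (h x) * ennreal (h' x)) * (ennreal (h x') * ennreal (h' x')) \<le> L f x x' * L f' x x'"
            using mult_mono[OF inner[OF assms(1) x(1) x'(1)] inner[OF assms(2) x(2) x'(2)]]
            by (simp add: K_def power_mult_distrib mult_ac)
        qed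
      qed
    qed
  qed
  also have "\<dots> = linked_product p f f'"
    by (simp add: linked_product_def L_def)
  finally show ?thesis by (simp add: N_def)
qed

text \<open>Only the two free slots, through \<open>A\<close>, see the distance \<open>D\<close> of
  the cells, hence the exponent \<open>2 - 4 * \<alpha> = - (4 * (1 - H) / q)\<close>; the
  contracted slots pair a cell with itself and give \<open>E\<close>. The powers of \<open>g\<close>
  add up to \<open>4 + q * (2 - 4 * \<alpha>) = 4 * H\<close>.\<close>

lemma linked_product_hermite_ge:
  fixes H g :: real and i j p q :: nat
  assumes H: "1 / 2 < H" "H < 1" and q: "q = Suc p" and g: "0 < g"
    and \<alpha>: "\<alpha> = 1 / 2 + (1 - H) / real q"
  shows "ennreal (2 powr (- (4 * \<alpha> * real q)) * (g powr (4 * H) * (1 + \<bar>real i - real j\<bar>) powr (- (4 * (1 - H) / real q))))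
    \<le> linked_product p (\<lambda>y. kernel_incr H q g i y)
        (\<lambda>y. kernel_incr H q g j y)"
proof -
  have q1: "1 \<le> q" using q by simp
  note ex = hermite_exponent[OF H q1 \<alpha>]
  define D where "D = 1 + \<bar>real i - real j\<bar>"
  have D: "0 < D" by (simp add: D_def)
  define G where "G = g * D"
  have G: "0 < G" using g D by (simp add: G_def)
  define A where "A = (2 * G) powr (- (2 * \<alpha>)) * G"
  define E where "E = (2 * g) powr (- (2 * \<alpha>)) * g"
  have AE0: "0 \<le> A" "0 \<le> E" using G g by (auto simp: A_def E_def)
  have AEf: "AE y in lborel_pow (Suc p). ennreal g * (\<Prod>l<Suc p. ennreal (test_fun \<alpha> g k (y l))) \<le>
      ennreal (kernel_incr H q g k y)" for k
  proof -
    have "AE y in lborel_pow q. 0 \<le> kernel_incr H q g k y \<and>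
        ennreal (kernel_incr H q g k y) = kernel_nn \<alpha> q (g * real k) (g * real (k + 1)) y"
      using g by (intro hermite_kernel_increment[OF H q1 \<alpha>]) auto
    then show ?thesis
      unfolding q
    proof eventually_elim
      fix y assume "0 \<le> kernel_incr H (Suc p) g k y \<and>
        ennreal (kernel_incr H (Suc p) g k y) = kernel_nn \<alpha> (Suc p) (g * real k) (g * real (k + 1)) y"
      then show "ennreal g * (\<Prod>l<Suc p. ennreal (test_fun \<alpha> g k (y l))) \<le>
        ennreal (kernel_incr H (Suc p) g k y)"
        using kernel_nn_ge[where \<alpha> = \<alpha> and g = g and q = "Suc p" and i = k and y = y] ex(1) g by simp
    qed
  qed
  have I: "ennreal A \<le> (\<integral>\<^sup>+x. ennreal (test_fun \<alpha> g i x) * ennreal (test_fun \<alpha> g j x) \<partial>lborel)"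
    using nn_integral_test_fun_mult[of \<alpha> g G i j] ex(1) g by (simp add: A_def G_def D_def)
  have J: "ennreal E \<le> (\<integral>\<^sup>+x. ennreal (test_fun \<alpha> g k x) * ennreal (test_fun \<alpha> g k x) \<partial>lborel)" for k
    using nn_integral_test_fun_mult[of \<alpha> g g k k] ex(1) g by (simp add: E_def)
  have "ennreal g ^ 2 * ennreal g ^ 2 * ennreal A ^ 2 * (ennreal E * ennreal E) ^ p \<le>
    ennreal g ^ 2 * ennreal g ^ 2 * (\<integral>\<^sup>+x. ennreal (test_fun \<alpha> g i x) * ennreal (test_fun \<alpha> g j x) \<partial>lborel) ^ 2 *
      ((\<integral>\<^sup>+x. ennreal (test_fun \<alpha> g i x) * ennreal (test_fun \<alpha> g i x) \<partial>lborel) *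
       (\<integral>\<^sup>+x. ennreal (test_fun \<alpha> g j x) * ennreal (test_fun \<alpha> g j x) \<partial>lborel)) ^ p"
    using I J by (intro mult_mono power_mono order_refl) auto
  also have "\<dots> \<le> linked_product p (\<lambda>y. kernel_incr H q g i y)
        (\<lambda>y. kernel_incr H q g j y)"
    by (rule linked_product_ge_product[OF test_fun_measurable test_fun_measurable AEf AEf])
  also have "ennreal g ^ 2 * ennreal g ^ 2 * ennreal A ^ 2 * (ennreal E * ennreal E) ^ p = ennreal (g ^ 4 * A ^ 2 * (E * E) ^ p)"
    using g AE0 by (simp add: ennreal_power ennreal_mult[symmetric] power_add[symmetric])
  also have "g ^ 4 * A ^ 2 * (E * E) ^ p =
      2 powr (- (4 * \<alpha> * real q)) * (g powr (4 * H) * D powr (- (4 * (1 - H) / real q)))"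
  proof -
    have A: "A ^ 2 = 2 powr (- (4 * \<alpha>)) * (g powr (2 - 4 * \<alpha>) * D powr (2 - 4 * \<alpha>))"
    proof -
      have "A = 2 powr (- (2 * \<alpha>)) * (G powr (- (2 * \<alpha>)) * G powr 1)" using G by (simp add: A_def powr_mult)
      also have "\<dots> = 2 powr (- (2 * \<alpha>)) * (g powr (1 - 2 * \<alpha>) * D powr (1 - 2 * \<alpha>))"
        unfolding powr_add[symmetric] using g D by (simp add: G_def powr_mult)
      finally have "A = 2 powr (- (2 * \<alpha>)) * (g powr (1 - 2 * \<alpha>) * D powr (1 - 2 * \<alpha>))" .
      moreover have "(x powr c)\<^sup>2 = x powr (2 * c)" for x c :: real
        by (simp add: power2_eq_square powr_add[symmetric])
      ultimately show ?thesis
        by (simp only: power_mult_distrib) (simp add: right_diff_distrib)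
    qed
    have E: "(E * E) ^ p = 2 powr (- (4 * \<alpha> * real p)) * g powr ((2 - 4 * \<alpha>) * real p)"
    proof -
      have "E = 2 powr (- (2 * \<alpha>)) * (g powr (- (2 * \<alpha>)) * g powr 1)" using g by (simp add: E_def powr_mult)
      also have "\<dots> = 2 powr (- (2 * \<alpha>)) * g powr (1 - 2 * \<alpha>)" unfolding powr_add[symmetric] by simp
      finally have "E * E = 2 powr (- (4 * \<alpha>)) * g powr (2 - 4 * \<alpha>)"
        by (simp add: powr_add[symmetric] mult_ac)
      then show ?thesis
        using g by (simp add: power_mult_distrib powr_power mult_ac)
    qed
    have g4: "g ^ 4 = g powr 4" using g by (simp add: powr_numeral)
    have e1: "- (4 * \<alpha>) + - (4 * \<alpha> * real p) = - (4 * \<alpha> * real q)" by (simp add: q algebra_simps)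
    have e2: "4 + (2 - 4 * \<alpha>) + (2 - 4 * \<alpha>) * real p = 4 * H"
      using ex(3) by (simp add: q algebra_simps)
    have e3: "2 - 4 * \<alpha> = - (4 * (1 - H) / real q)" by (simp add: \<alpha>)
    have "g ^ 4 * A ^ 2 * (E * E) ^ p =
        (2 powr (- (4 * \<alpha>)) * 2 powr (- (4 * \<alpha> * real p))) * ((g powr 4 * g powr (2 - 4 * \<alpha>) * g powr ((2 - 4 * \<alpha>) * real p)) * D powr (2 - 4 * \<alpha>))"
      unfolding A E g4 by (simp only: mult_ac)
    also have "\<dots> = 2 powr (- (4 * \<alpha> * real q)) * (g powr (4 * H) * D powr (- (4 * (1 - H) / real q)))"
      unfolding powr_add[symmetric] e1 e2 e3[symmetric] ..
    finally show ?thesis .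
  qed
  finally show ?thesis by (simp add: D_def)
qed

section \<open>Sums over the grid\<close>

definition decay_sum :: "nat \<Rightarrow> real \<Rightarrow> real" where
  "decay_sum N b = (\<Sum>i<N. \<Sum>j<N. (1 + \<bar>real i - real j\<bar>) powr (- b))"

lemma decay_sum_nonneg: "0 \<le> decay_sum N b"
  by (simp add: decay_sum_def sum_nonneg)

lemma decay_sum_antimono: "b \<le> b' \<Longrightarrow> decay_sum N b' \<le> decay_sum N b"
  unfolding decay_sum_def by (intro sum_mono powr_mono) auto

lemma decay_sum_Cauchy_Schwarz: "(decay_sum N (a + b))\<^sup>2 \<le> decay_sum N (2 * a) * decay_sum N (2 * b)"
proof -
  define d where "d z = 1 + \<bar>real (fst z) - real (snd z)\<bar>" for z :: "nat \<times> nat"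
  have eq: "decay_sum N c = (\<Sum>z\<in>{..<N} \<times> {..<N}. d z powr (- c))" for c
    by (simp add: decay_sum_def sum.cartesian_product d_def split_beta)
  have "(\<Sum>z\<in>{..<N} \<times> {..<N}. d z powr (- a) * d z powr (- b))\<^sup>2 \<le>
      (\<Sum>z\<in>{..<N} \<times> {..<N}. (d z powr (- a))\<^sup>2) * (\<Sum>z\<in>{..<N} \<times> {..<N}. (d z powr (- b))\<^sup>2)"
    by (rule Cauchy_Schwarz_ineq_sum)
  moreover have "d z powr (- a) * d z powr (- b) = d z powr (- (a + b))" for z
    by (simp add: powr_add[symmetric])
  moreover have "(d z powr (- c))\<^sup>2 = d z powr (- (2 * c))" for z c
    by (simp add: power2_eq_square powr_add[symmetric])
  ultimately show ?thesis by (simp add: eq)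
qed

text \<open>No distance in the grid makes \<open>1 + \<bar>i - j\<bar>\<close> exceed
  \<open>N\<close>. For \<open>b < 1\<close> this crude bound already grows faster than
  \<open>N\<close>.\<close>

lemma decay_sum_ge: "0 \<le> b \<Longrightarrow> real N * (real N * real N powr (- b)) \<le> decay_sum N b"
proof -
  assume b: "0 \<le> b"
  have "(\<Sum>i<N. \<Sum>j<N. real N powr (- b)) \<le> decay_sum N b"
    unfolding decay_sum_def using b by (intro sum_mono powr_mono2') auto
  then show ?thesis by simp
qed

text \<open>At index distance at least \<open>R\<close> the ratio of the summands is at most
  \<open>(1 + R) powr (- (b' - b))\<close>. The band below \<open>R\<close> holds at most
  \<open>2 * R * N\<close> pairs, negligible against \<open>N powr (2 - b)\<close> because
  \<open>b < 1\<close>. The exponent \<open>b'\<close> may lie on either side of 1.\<close>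

lemma decay_sum_negligible:
  assumes b: "0 < b" "b < 1" "b < b'" and \<epsilon>: "0 < \<epsilon>"
  shows "eventually (\<lambda>N. decay_sum N b' \<le> \<epsilon> * decay_sum N b) sequentially"
proof -
  have "(\<lambda>R. (1 + real R) powr (- (b' - b))) \<longlonglongrightarrow> 0"
    using b by (intro tendsto_neg_powr filterlim_tendsto_add_at_top[OF tendsto_const] filterlim_real_sequentially) auto
  then have "eventually (\<lambda>R. (1 + real R) powr (- (b' - b)) < \<epsilon> / 2) sequentially"
    using \<epsilon> by (intro order_tendstoD(2)) auto
  then obtain R where R: "(1 + real R) powr (- (b' - b)) < \<epsilon> / 2"
    by (auto simp: eventually_sequentially)
  have "(\<lambda>N. real N powr (- (1 - b))) \<longlonglongrightarrow> 0"
    using b by (intro tendsto_neg_powr filterlim_real_sequentially) auto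
  \<comment> \<open>The \<open>+ 1\<close> keeps the bound positive when
    \<open>R = 0\<close>.\<close>
  then have "eventually (\<lambda>N. real N powr (- (1 - b)) < \<epsilon> / (4 * real R + 1)) sequentially"
    using \<epsilon> by (intro order_tendstoD(2)) auto
  then have "eventually (\<lambda>N. 4 * real R / \<epsilon> \<le> real N powr (1 - b)) sequentially"
    using eventually_gt_at_top[of 0]
  proof eventually_elim
    fix N :: nat
    assume "real N powr (- (1 - b)) < \<epsilon> / (4 * real R + 1)" "0 < N"
    then have "real N powr (- (1 - b)) * real N powr (1 - b) < \<epsilon> / (4 * real R + 1) * real N powr (1 - b)"
      by (intro mult_strict_right_mono) auto
    then have "1 < \<epsilon> / (4 * real R + 1) * real N powr (1 - b)"
      using \<open>0 < N\<close> by (simp add: powr_add[symmetric])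
    then show "4 * real R / \<epsilon> \<le> real N powr (1 - b)"
      using \<epsilon> by (simp add: field_simps)
  qed
  then show ?thesis
  proof eventually_elim
    fix N assume N: "4 * real R / \<epsilon> \<le> real N powr (1 - b)"
    have near: "(\<Sum>j<N. of_bool (\<bar>real i - real j\<bar> < real R)) \<le> 2 * real R" for i
    proof -
      have "(\<Sum>j<N. of_bool (\<bar>real i - real j\<bar> < real R)) = real (card {j \<in> {..<N}. \<bar>real i - real j\<bar> < real R})"
        by (simp add: of_bool_def sum.If_cases Int_def)
      \<comment> \<open>Truncation of \<open>i - R\<close> at 0 is harmless, since indices are not
        negative.\<close>
      also have "\<dots> \<le> real (card {i - R..<i + R})"
        by (intro of_nat_mono card_mono) auto
      also have "\<dots> \<le> 2 * real R" by auto
      finally show ?thesis .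
    qed
    have "decay_sum N b' \<le> (\<Sum>i<N. \<Sum>j<N. \<epsilon> / 2 * (1 + \<bar>real i - real j\<bar>) powr (- b) + of_bool (\<bar>real i - real j\<bar> < real R))"
      unfolding decay_sum_def
    proof (intro sum_mono)
      fix i j :: nat
      define d where "d = \<bar>real i - real j\<bar>"
      have d: "0 \<le> d" by (simp add: d_def)
      show "(1 + \<bar>real i - real j\<bar>) powr (- b') \<le> \<epsilon> / 2 * (1 + \<bar>real i - real j\<bar>) powr (- b) + of_bool (\<bar>real i - real j\<bar> < real R)"
        unfolding d_def[symmetric]
      proof (cases "d < real R")
        case True
        have "(1 + d) powr (- b') \<le> (1 + d) powr 0" using b d by (intro powr_mono) auto
        moreover have "0 \<le> \<epsilon> / 2 * (1 + d) powr (- b)" using \<epsilon> by simp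
        ultimately show "(1 + d) powr (- b') \<le> \<epsilon> / 2 * (1 + d) powr (- b) + of_bool (d < real R)"
          using True d by simp
      next
        case False
        have "(1 + d) powr (- (b' - b)) \<le> (1 + real R) powr (- (b' - b))"
          using False b d by (intro powr_mono2') auto
        then have "(1 + d) powr (- (b' - b)) * (1 + d) powr (- b) \<le> \<epsilon> / 2 * (1 + d) powr (- b)"
          using R by (intro mult_right_mono) auto
        then show "(1 + d) powr (- b') \<le> \<epsilon> / 2 * (1 + d) powr (- b) + of_bool (d < real R)"
          using False by (simp add: powr_add[symmetric])
      qed
    qed
    also have "\<dots> = \<epsilon> / 2 * decay_sum N b + (\<Sum>i<N. \<Sum>j<N. of_bool (\<bar>real i - real j\<bar> < real R))"
      by (simp add: sum.distrib decay_sum_def sum_distrib_left)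
    also have "(\<Sum>i<N. \<Sum>j<N. of_bool (\<bar>real i - real j\<bar> < real R)) \<le> real N * (2 * real R)"
      using sum_mono[of "{..<N}" _ "\<lambda>_. 2 * real R", OF near] by simp
    also have "real N * (2 * real R) \<le> \<epsilon> / 2 * decay_sum N b"
    proof (cases "N = 0")
      case False
      have "2 * real R \<le> \<epsilon> / 2 * real N powr (1 - b)" using N \<epsilon> by (simp add: field_simps)
      also have "real N powr (1 - b) = real N * real N powr (- b)"
        using False powr_add[of "real N" 1 "- b"] by simp
      finally have "real N * (2 * real R) \<le> \<epsilon> / 2 * (real N * (real N * real N powr (- b)))"
        using mult_left_mono[of "2 * real R" "\<epsilon> / 2 * (real N * real N powr (- b))" "real N"] by (simp add: mult_ac)
      also have "\<dots> \<le> \<epsilon> / 2 * decay_sum N b"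
        using decay_sum_ge[of b N] b \<epsilon> by (intro mult_left_mono) auto
      finally show ?thesis .
    qed (simp add: decay_sum_def)
    finally show "decay_sum N b' \<le> \<epsilon> * decay_sum N b" by simp
  qed
qed

text \<open>Monotonicity in the exponent is enough for the first factor from Cauchy-Schwarz; all
  smallness comes from the second. The estimate is for squares, so it is applied with the square of
  \<open>\<epsilon>\<close>.\<close>

lemma decay_sum_product_negligible:
  assumes b1: "b1 \<le> 2 * \<beta>1" and b2: "0 < b2" "b2 < 1" "b2 < 2 * \<beta>2" and \<epsilon>: "0 < \<epsilon>"
  shows "eventually (\<lambda>N. decay_sum N (\<beta>1 + \<beta>2) \<le> \<epsilon> * sqrt (decay_sum N b1 * decay_sum N b2)) sequentially"
proof -
  have "0 < \<epsilon>\<^sup>2" using \<epsilon> by simp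
  from decay_sum_negligible[OF b2 this] show ?thesis
  proof eventually_elim
    fix N assume *: "decay_sum N (2 * \<beta>2) \<le> \<epsilon>\<^sup>2 * decay_sum N b2"
    have "(decay_sum N (\<beta>1 + \<beta>2))\<^sup>2 \<le> decay_sum N (2 * \<beta>1) * decay_sum N (2 * \<beta>2)"
      by (rule decay_sum_Cauchy_Schwarz)
    also have "\<dots> \<le> decay_sum N b1 * (\<epsilon>\<^sup>2 * decay_sum N b2)"
      using * decay_sum_antimono[OF b1] by (intro mult_mono decay_sum_nonneg)
    also have "\<dots> = (\<epsilon> * sqrt (decay_sum N b1 * decay_sum N b2))\<^sup>2"
      using decay_sum_nonneg by (simp add: power_mult_distrib)
    finally show "decay_sum N (\<beta>1 + \<beta>2) \<le> \<epsilon> * sqrt (decay_sum N b1 * decay_sum N b2)"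
      by (rule power2_le_imp_le) (use \<epsilon> decay_sum_nonneg in auto)
  qed
qed

section \<open>Increments of Hermite processes\<close>

text \<open>The square of \<open>hermite_const\<close> is kept out of this constant, so that the
  normalization appears in the same form in the upper and the lower bound. The factorial comes from
  the isometry.\<close>

definition cov_const :: "real \<Rightarrow> nat \<Rightarrow> real" where
  "cov_const H q = fact q * (overlap_const (1 / 2 + (1 - H) / real q) ^ q * (3 + 8 / (1 - (2 - 2 * H))))"

definition var_const :: "real \<Rightarrow> nat \<Rightarrow> real" where
  "var_const H q = 2 powr (- (4 * (1 / 2 + (1 - H) / real q) * real q))"

lemma cov_const_pos:
  assumes "1 / 2 < H" "H < 1" "1 \<le> q"
  shows "0 < cov_const H q"
proof -
  have "0 < overlap_const (1 / 2 + (1 - H) / real q)"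
    using hermite_exponent[OF assms refl] by (intro overlap_const_pos)
  moreover have "0 < 3 + 8 / (1 - (2 - 2 * H))" using assms by (simp add: add_pos_pos)
  ultimately show ?thesis by (simp add: cov_const_def)
qed

lemma var_const_pos: "0 < var_const H q"
  by (simp add: var_const_def)

context brownian_motion begin

lemma hermite_increment_wiener_ito:
  assumes Z: "hermite_process M B H q Z" and g: "0 < g"
  obtains X where "has_wiener_ito_integral M B q
      (\<lambda>y. kernel_incr H q g i y) X"
    "increment Z g i = (\<lambda>\<omega>. hermite_const H q * X \<omega>)"
proof -
  have t: "0 \<le> g * real (i + 1)" "0 \<le> g * real i" using g by auto
  obtain X1 where X1: "has_wiener_ito_integral M B q (hermite_kernel H q (g * real (i + 1))) X1"
    "Z (g * real (i + 1)) = (\<lambda>\<omega>. hermite_const H q * X1 \<omega>)"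
    using Z t(1) unfolding hermite_process_def by blast
  obtain X0 where X0: "has_wiener_ito_integral M B q (hermite_kernel H q (g * real i)) X0"
    "Z (g * real i) = (\<lambda>\<omega>. hermite_const H q * X0 \<omega>)"
    using Z t(2) unfolding hermite_process_def by blast
  show thesis
  proof (rule that)
    show "has_wiener_ito_integral M B q
      (\<lambda>y. kernel_incr H q g i y) (\<lambda>\<omega>. X1 \<omega> - X0 \<omega>)"
      using wiener_ito_linear[OF X1(1) X0(1), of 1 "-1"] by simp
    show "increment Z g i = (\<lambda>\<omega>. hermite_const H q * (X1 \<omega> - X0 \<omega>))"
      by (simp only: fun_eq_iff increment_def X1(2) X0(2) right_diff_distrib) simp
  qed
qed

text \<open>Second moments are part of the definition of the integral; fourth moments come from
  hypercontractivity.\<close>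

lemma hermite_increment_moments:
  assumes Z: "hermite_process M B H q Z" and g: "0 < g"
  shows "square_integrable M (increment Z g i)" "integrable M (\<lambda>\<omega>. increment Z g i \<omega> ^ 4)"
proof -
  obtain X where X: "has_wiener_ito_integral M B q
      (\<lambda>y. kernel_incr H q g i y) X"
    "increment Z g i = (\<lambda>\<omega>. hermite_const H q * X \<omega>)"
    by (rule hermite_increment_wiener_ito[OF Z g])
  show "square_integrable M (increment Z g i)"
    using square_integrable_linear[OF wiener_ito_square_integrable(1)[OF X(1)] wiener_ito_square_integrable(1)[OF X(1)], of "hermite_const H q" 0]
    by (simp add: X(2))
  show "integrable M (\<lambda>\<omega>. increment Z g i \<omega> ^ 4)"
    using wiener_ito_hypercontractive(1)[OF X(1)] by (simp add: X(2) power_mult_distrib)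
qed

lemma hermite_increment_covariance:
  assumes Z: "hermite_process M B H q Z" and H: "1 / 2 < H" "H < 1" and q: "1 \<le> q" and g: "0 < g"
  shows "\<bar>\<integral>\<omega>. increment Z g i \<omega> * increment Z g j \<omega> \<partial>M\<bar> \<le>
    (hermite_const H q)\<^sup>2 * cov_const H q * (g powr (2 * H) * (1 + \<bar>real i - real j\<bar>) powr (- (2 - 2 * H)))"
proof -
  define \<alpha> where "\<alpha> = 1 / 2 + (1 - H) / real q"
  note ex = hermite_exponent[OF H q \<alpha>_def]
  define f where "f k y = kernel_incr H q g k y" for k :: nat and y
  define K where "K k = kernel_nn \<alpha> q (g * real k) (g * real (k + 1))" for k :: nat
  have fK: "AE y in lborel_pow q. 0 \<le> f k y \<and> ennreal (f k y) = K k y" for k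
    unfolding f_def K_def using g by (intro hermite_kernel_increment[OF H q \<alpha>_def]) auto
  then have f0: "AE y in lborel_pow q. 0 \<le> f k y" for k
    by (rule AE_mp) auto
  obtain X where X: "has_wiener_ito_integral M B q (f i) X" "increment Z g i = (\<lambda>\<omega>. hermite_const H q * X \<omega>)"
    unfolding f_def by (rule hermite_increment_wiener_ito[OF Z g])
  obtain Y where Y: "has_wiener_ito_integral M B q (f j) Y" "increment Z g j = (\<lambda>\<omega>. hermite_const H q * Y \<omega>)"
    unfolding f_def by (rule hermite_increment_wiener_ito[OF Z g])
  have EXY: "(\<integral>\<omega>. X \<omega> * Y \<omega> \<partial>M) = fact q * (\<integral>y. f i y * f j y \<partial>lborel_pow q)"
    using X(1) f0 Y(1) f0
    by (rule wiener_ito_covariance) (simp add: f_def hermite_kernel_symmetric)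
  have nn: "AE y in lborel_pow q. 0 \<le> f i y * f j y"
    using f0[of i] f0[of j] by eventually_elim simp
  have int: "integrable (lborel_pow q) (\<lambda>y. f i y * f j y)"
    using X(1) Y(1) by (intro square_integrable_inner wiener_ito_square_integrable(2))
  define R where "R = overlap_const \<alpha> ^ q * (3 + 8 / (1 - (2 - 2 * H))) * (g powr (2 * H) * (1 + \<bar>real i - real j\<bar>) powr (- (2 - 2 * H)))"
  have R: "0 \<le> R" using overlap_const_pos[OF ex(1,2)] H by (simp add: R_def)
  have "ennreal (\<integral>y. f i y * f j y \<partial>lborel_pow q) = (\<integral>\<^sup>+y. ennreal (f i y * f j y) \<partial>lborel_pow q)"
    using nn int by (rule nn_integral_eq_integral[symmetric, rotated])
  also have "\<dots> = (\<integral>\<^sup>+y. K i y * K j y \<partial>lborel_pow q)"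
  proof (rule nn_integral_cong_AE)
    show "AE y in lborel_pow q. ennreal (f i y * f j y) = K i y * K j y"
      using fK[of i] fK[of j] by eventually_elim (auto simp: ennreal_mult)
  qed
  also have "\<dots> \<le> ennreal R"
    using nn_integral_kernel_grid_le[OF ex(1,2) ex(3)[symmetric], of g i j] H g by (simp add: K_def R_def)
  finally have le: "(\<integral>y. f i y * f j y \<partial>lborel_pow q) \<le> R" using R by simp
  have "0 \<le> (\<integral>y. f i y * f j y \<partial>lborel_pow q)" using nn by (rule integral_nonneg_AE)
  moreover have "(\<integral>\<omega>. increment Z g i \<omega> * increment Z g j \<omega> \<partial>M) = (\<integral>\<omega>. (hermite_const H q)\<^sup>2 * (X \<omega> * Y \<omega>) \<partial>M)"
    unfolding X(2) Y(2) by (simp only: power2_eq_square mult_ac)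
  ultimately have "\<bar>\<integral>\<omega>. increment Z g i \<omega> * increment Z g j \<omega> \<partial>M\<bar> = (hermite_const H q)\<^sup>2 * (fact q * (\<integral>y. f i y * f j y \<partial>lborel_pow q))"
    by (simp add: EXY)
  also have "\<dots> \<le> (hermite_const H q)\<^sup>2 * (fact q * R)"
    using le by (intro mult_left_mono) auto
  finally show ?thesis by (simp add: R_def cov_const_def \<alpha>_def mult_ac)
qed

lemma hermite_increment_square_covariance:
  assumes Z: "hermite_process M B H q Z" and H: "1 / 2 < H" "H < 1" and q: "1 \<le> q" and g: "0 < g"
  shows "hermite_const H q ^ 4 * var_const H q * (g powr (4 * H) * (1 + \<bar>real i - real j\<bar>) powr (- (4 * (1 - H) / real q)))
    \<le> (\<integral>\<omega>. (increment Z g i \<omega>)\<^sup>2 * (increment Z g j \<omega>)\<^sup>2 \<partial>M) -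
      (\<integral>\<omega>. (increment Z g i \<omega>)\<^sup>2 \<partial>M) * (\<integral>\<omega>. (increment Z g j \<omega>)\<^sup>2 \<partial>M)"
proof -
  obtain p where p: "q = Suc p" using q by (cases q) auto
  define f where "f k y = kernel_incr H q g k y" for k :: nat and y
  have f0: "AE y in lborel_pow q. 0 \<le> f k y" for k
    using hermite_kernel_increment[OF H q refl, of "g * real k" "g * real (k + 1)"] g
    unfolding f_def by (rule_tac AE_mp) auto
  obtain X where X: "has_wiener_ito_integral M B q (f i) X" "increment Z g i = (\<lambda>\<omega>. hermite_const H q * X \<omega>)"
    unfolding f_def by (rule hermite_increment_wiener_ito[OF Z g])
  obtain Y where Y: "has_wiener_ito_integral M B q (f j) Y" "increment Z g j = (\<lambda>\<omega>. hermite_const H q * Y \<omega>)"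
    unfolding f_def by (rule hermite_increment_wiener_ito[OF Z g])
  define V where "V = (\<integral>\<omega>. (X \<omega>)\<^sup>2 * (Y \<omega>)\<^sup>2 \<partial>M) - (\<integral>\<omega>. (X \<omega>)\<^sup>2 \<partial>M) * (\<integral>\<omega>. (Y \<omega>)\<^sup>2 \<partial>M)"
  define W where "W = var_const H q * (g powr (4 * H) * (1 + \<bar>real i - real j\<bar>) powr (- (4 * (1 - H) / real q)))"
  have "ennreal W \<le> linked_product p (f i) (f j)"
    using linked_product_hermite_ge[OF H p g refl, of i j] unfolding f_def[abs_def] W_def var_const_def .
  also have "\<dots> \<le> ennreal V"
    unfolding V_def using X(1) f0 Y(1) f0 unfolding p by (rule wiener_ito_square_covariance)
  finally have "ennreal W \<le> ennreal V" .
  \<comment> \<open>Excludes that \<open>V\<close> is negative and \<open>ennreal V\<close> merely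
    0, so the inequality can be read back in the reals.\<close>
  moreover have "0 < W"
    unfolding W_def using var_const_pos[of H q] g by (intro mult_pos_pos) auto
  ultimately have "W \<le> V"
    by (auto simp: ennreal_le_iff2)
  then have "hermite_const H q ^ 4 * W \<le> hermite_const H q ^ 4 * V" by (intro mult_left_mono) auto
  moreover have "hermite_const H q ^ 4 * V = (\<integral>\<omega>. (increment Z g i \<omega>)\<^sup>2 * (increment Z g j \<omega>)\<^sup>2 \<partial>M) -
      (\<integral>\<omega>. (increment Z g i \<omega>)\<^sup>2 \<partial>M) * (\<integral>\<omega>. (increment Z g j \<omega>)\<^sup>2 \<partial>M)"
  proof -
    define c where "c = hermite_const H q"
    have "(c * x)\<^sup>2 * (c * y)\<^sup>2 = c ^ 4 * (x\<^sup>2 * y\<^sup>2)" for x y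
      by (simp add: power2_eq_square power4_eq_xxxx mult_ac)
    then have e1: "(\<integral>\<omega>. (increment Z g i \<omega>)\<^sup>2 * (increment Z g j \<omega>)\<^sup>2 \<partial>M) = c ^ 4 * (\<integral>\<omega>. (X \<omega>)\<^sup>2 * (Y \<omega>)\<^sup>2 \<partial>M)"
      by (simp add: X(2) Y(2) c_def[symmetric])
    have e2: "(\<integral>\<omega>. (increment Z g i \<omega>)\<^sup>2 \<partial>M) = c\<^sup>2 * (\<integral>\<omega>. (X \<omega>)\<^sup>2 \<partial>M)"
      "(\<integral>\<omega>. (increment Z g j \<omega>)\<^sup>2 \<partial>M) = c\<^sup>2 * (\<integral>\<omega>. (Y \<omega>)\<^sup>2 \<partial>M)"
      by (simp_all add: X(2) Y(2) c_def power_mult_distrib)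
    have e3: "c ^ 4 = c\<^sup>2 * c\<^sup>2" by (simp add: power2_eq_square power4_eq_xxxx)
    show ?thesis
      unfolding e1 e2 c_def[symmetric] V_def e3 by (simp only: right_diff_distrib mult_ac)
  qed
  ultimately show ?thesis by (simp add: W_def mult.assoc)
qed

text \<open>Centring makes the second moment a double sum of covariances of squared increments, each
  of which has its own lower bound.\<close>

lemma qv_deviation_ge:
  assumes Z: "hermite_process M B H q Z" and H: "1 / 2 < H" "H < 1" and q: "1 \<le> q" and g: "0 < g"
  shows "(hermite_const H q)\<^sup>2 * sqrt (var_const H q) * g powr (2 * H) * sqrt (decay_sum N (4 * (1 - H) / real q))
    \<le> qv_deviation M Z g N"
proof -
  define I where "I k = increment Z g k" for k
  define e where "e k = (\<integral>\<omega>. (I k \<omega>)\<^sup>2 \<partial>M)" for k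
  note mom = hermite_increment_moments[OF Z g, folded I_def]
  have int2: "integrable M (\<lambda>\<omega>. (I k \<omega>)\<^sup>2)" for k using mom(1)[of k] by (simp add: square_integrable_def)
  have int4: "integrable M (\<lambda>\<omega>. (I i \<omega>)\<^sup>2 * (I j \<omega>)\<^sup>2)" for i j
    using mom by (intro square_integrable_inner square_integrable_square) (auto simp: square_integrable_def)
  have prod: "has_bochner_integral M (\<lambda>\<omega>. ((I i \<omega>)\<^sup>2 - e i) * ((I j \<omega>)\<^sup>2 - e j)) ((\<integral>\<omega>. (I i \<omega>)\<^sup>2 * (I j \<omega>)\<^sup>2 \<partial>M) - e i * e j)" for i j
  proof -
    have "has_bochner_integral M (\<lambda>\<omega>. (I i \<omega>)\<^sup>2 * (I j \<omega>)\<^sup>2 - e j * (I i \<omega>)\<^sup>2 - e i * (I j \<omega>)\<^sup>2 + e i * e j)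
        ((\<integral>\<omega>. (I i \<omega>)\<^sup>2 * (I j \<omega>)\<^sup>2 \<partial>M) - e j * e i - e i * e j + e i * e j)"
      using int2 int4 unfolding has_bochner_integral_iff by (simp add: e_def prob_space)
    then show ?thesis by (simp add: algebra_simps)
  qed
  have "(centred_quadratic_variation M Z g N \<omega>)\<^sup>2 = (\<Sum>i<N. \<Sum>j<N. ((I i \<omega>)\<^sup>2 - e i) * ((I j \<omega>)\<^sup>2 - e j))" for \<omega>
    by (simp add: centred_quadratic_variation_def I_def e_def power2_eq_square[of "sum _ _"] sum_product)
  then have var: "(\<integral>\<omega>. (centred_quadratic_variation M Z g N \<omega>)\<^sup>2 \<partial>M) =
      (\<Sum>i<N. \<Sum>j<N. (\<integral>\<omega>. (I i \<omega>)\<^sup>2 * (I j \<omega>)\<^sup>2 \<partial>M) - e i * e j)"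
    using prod by (simp add: has_bochner_integral_iff)
  define c where "c = (hermite_const H q)\<^sup>2 * sqrt (var_const H q) * g powr (2 * H)"
  have c: "0 \<le> c" using var_const_pos[of H q] by (simp add: c_def)
  have c2: "c\<^sup>2 = hermite_const H q ^ 4 * var_const H q * g powr (4 * H)"
  proof -
    have "(g powr (2 * H))\<^sup>2 = g powr (4 * H)" by (simp add: power2_eq_square powr_add[symmetric])
    then show ?thesis
      using var_const_pos[of H q] by (simp add: c_def power_mult_distrib power_mult[symmetric])
  qed
  have "c\<^sup>2 * decay_sum N (4 * (1 - H) / real q) \<le> (\<integral>\<omega>. (centred_quadratic_variation M Z g N \<omega>)\<^sup>2 \<partial>M)"
    unfolding var decay_sum_def sum_distrib_left
    using hermite_increment_square_covariance[OF Z H q g] by (intro sum_mono) (simp add: c2 I_def e_def mult.assoc)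
  then have "sqrt (c\<^sup>2 * decay_sum N (4 * (1 - H) / real q)) \<le> qv_deviation M Z g N"
    unfolding qv_deviation_def by (rule real_sqrt_le_mono)
  then show ?thesis using c by (simp add: real_sqrt_mult c_def)
qed

text \<open>\<open>Z2'\<close> is given only by its law and its independence of \<open>Z1\<close>.
  Independence separates the increments of the two processes in each expectation, and equality of
  laws replaces the moments of \<open>Z2'\<close> by those of \<open>Z2\<close>.\<close>

lemma cross_variation_le:
  assumes Z1: "hermite_process M B H1 q1 Z1" "1 / 2 < H1" "H1 < 1" "1 \<le> q1"
    and Z2: "hermite_process M B H2 q2 Z2" "1 / 2 < H2" "H2 < 1" "1 \<le> q2"
    and copy: "independent_copy M Z2' Z2" and ind: "indep_processes M Z2' Z1" and g: "0 < g"
  shows "\<bar>\<integral>\<omega>. (cross_variation Z1 Z2' g N \<omega>)\<^sup>2 \<partial>M\<bar> \<le>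
    ((hermite_const H1 q1)\<^sup>2 * cov_const H1 q1 * g powr (2 * H1)) *
    ((hermite_const H2 q2)\<^sup>2 * cov_const H2 q2 * g powr (2 * H2)) * decay_sum N ((2 - 2 * H1) + (2 - 2 * H2))"
proof -
  \<comment> \<open>Independence and equality of law concern whole trajectories, so products of
    increments are written as measurable functionals of the path; positivity of \<open>g\<close>
    keeps the evaluation points in the index set.\<close>
  define \<phi> where "\<phi> i j z = (z (g * real (i + 1)) - z (g * real i)) * (z (g * real (j + 1)) - z (g * real j))"
    for i j :: nat and z :: "real \<Rightarrow> real"
  have [measurable]: "\<phi> i j \<in> borel_measurable path_space" for i j
    unfolding \<phi>_def[abs_def] using g
    by (intro borel_measurable_times borel_measurable_diff measurable_component_singleton) auto
  have \<phi>: "\<phi> i j (trajectory Z \<omega>) = increment Z g i \<omega> * increment Z g j \<omega>" for i j \<omega> and Z :: "real \<Rightarrow> 'w \<Rightarrow> real"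
    using g by (simp add: \<phi>_def trajectory_def increment_def)
  have tr: "trajectory Z2' \<in> measurable M path_space" "trajectory Z2 \<in> measurable M path_space"
    and law: "distr M path_space (trajectory Z2') = distr M path_space (trajectory Z2)"
    using copy unfolding independent_copy_def indep_processes_def by (auto dest: indep_var_rv1 indep_var_rv2)
  have int1: "integrable M (\<lambda>\<omega>. increment Z1 g i \<omega> * increment Z1 g j \<omega>)" for i j
    by (intro square_integrable_inner hermite_increment_moments[OF Z1(1) g])
  have int2: "integrable M (\<lambda>\<omega>. increment Z2 g i \<omega> * increment Z2 g j \<omega>)" for i j
    by (intro square_integrable_inner hermite_increment_moments[OF Z2(1) g])
  have int2': "integrable M (\<lambda>\<omega>. increment Z2' g i \<omega> * increment Z2' g j \<omega>)"
    and eq2: "(\<integral>\<omega>. increment Z2' g i \<omega> * increment Z2' g j \<omega> \<partial>M) = (\<integral>\<omega>. increment Z2 g i \<omega> * increment Z2 g j \<omega> \<partial>M)" for i j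
    using integrable_distr_eq[OF tr(1), of "\<phi> i j"] integrable_distr_eq[OF tr(2), of "\<phi> i j"]
      integral_distr[OF tr(1), of "\<phi> i j"] integral_distr[OF tr(2), of "\<phi> i j"] int2[of i j]
    by (simp_all add: \<phi> law)
  have indep: "indep_var borel (\<lambda>\<omega>. increment Z2' g i \<omega> * increment Z2' g j \<omega>) borel (\<lambda>\<omega>. increment Z1 g i \<omega> * increment Z1 g j \<omega>)" for i j
    using indep_var_compose[OF ind[unfolded indep_processes_def], of "\<phi> i j" borel "\<phi> i j" borel]
    by (simp add: comp_def \<phi>)
  have "(cross_variation Z1 Z2' g N \<omega>)\<^sup>2 = (\<Sum>i<N. \<Sum>j<N.
      (increment Z2' g i \<omega> * increment Z2' g j \<omega>) * (increment Z1 g i \<omega> * increment Z1 g j \<omega>))" for \<omega>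
    unfolding cross_variation_def power2_eq_square sum_product by (simp only: mult_ac)
  then have E: "(\<integral>\<omega>. (cross_variation Z1 Z2' g N \<omega>)\<^sup>2 \<partial>M) = (\<Sum>i<N. \<Sum>j<N.
      (\<integral>\<omega>. increment Z2 g i \<omega> * increment Z2 g j \<omega> \<partial>M) * (\<integral>\<omega>. increment Z1 g i \<omega> * increment Z1 g j \<omega> \<partial>M))"
    using indep_var_integrable[OF indep int2' int1] indep_var_lebesgue_integral[OF indep int2' int1] eq2 by simp
  have "\<bar>\<integral>\<omega>. (cross_variation Z1 Z2' g N \<omega>)\<^sup>2 \<partial>M\<bar> \<le> (\<Sum>i<N. \<Sum>j<N.
      \<bar>\<integral>\<omega>. increment Z2 g i \<omega> * increment Z2 g j \<omega> \<partial>M\<bar> * \<bar>\<integral>\<omega>. increment Z1 g i \<omega> * increment Z1 g j \<omega> \<partial>M\<bar>)"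
    unfolding E by (intro order_trans[OF sum_abs] sum_mono) (simp add: abs_mult)
  also have "\<dots> \<le> (\<Sum>i<N. \<Sum>j<N.
      ((hermite_const H2 q2)\<^sup>2 * cov_const H2 q2 * (g powr (2 * H2) * (1 + \<bar>real i - real j\<bar>) powr (- (2 - 2 * H2)))) *
      ((hermite_const H1 q1)\<^sup>2 * cov_const H1 q1 * (g powr (2 * H1) * (1 + \<bar>real i - real j\<bar>) powr (- (2 - 2 * H1)))))"
    using cov_const_pos[OF Z2(2-4)]
    by (intro sum_mono mult_mono hermite_increment_covariance Z1 Z2 g) auto
  also have "\<dots> = ((hermite_const H1 q1)\<^sup>2 * cov_const H1 q1 * g powr (2 * H1)) *
    ((hermite_const H2 q2)\<^sup>2 * cov_const H2 q2 * g powr (2 * H2)) * decay_sum N ((2 - 2 * H1) + (2 - 2 * H2))"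
  proof -
    have "(1 + \<bar>real i - real j\<bar>) powr (- ((2 - 2 * H1) + (2 - 2 * H2))) =
        (1 + \<bar>real i - real j\<bar>) powr (- (2 - 2 * H2)) * (1 + \<bar>real i - real j\<bar>) powr (- (2 - 2 * H1))" for i j :: nat
      by (simp add: powr_add[symmetric])
    then show ?thesis
      unfolding decay_sum_def sum_distrib_left by (simp only: mult_ac)
  qed
  finally show ?thesis .
qed

end

section \<open>Comparison of the cross variation with the two deviations\<close>

theorem theorem3:
  fixes M :: "'w measure" and B Z1 Z2 Z2' :: "real \<Rightarrow> 'w \<Rightarrow> real"
    and q :: nat and H1 H2 :: real and \<gamma> :: "nat \<Rightarrow> real"
  assumes "q \<ge> 1" and "H1 \<in> {1/2<..<1}" and "H2 \<in> {1/2<..<1}"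
    and "\<And>N. N \<ge> 1 \<Longrightarrow> \<gamma> N > 0"
    and "brownian_motion M B"
    and "hermite_process M B H1 q Z1"
    and "hermite_process M B H2 (q + 1) Z2"
    and "independent_copy M Z2' Z2"
    and "indep_processes M Z2' Z1"
  shows "(\<lambda>N. \<integral>\<omega>. (cross_variation Z1 Z2' (\<gamma> N) N \<omega>)\<^sup>2 \<partial>M)
    \<in> o(\<lambda>N. qv_deviation M Z1 (\<gamma> N) N * qv_deviation M Z2 (\<gamma> N) N)"
proof (rule landau_o.smallI)
  fix c :: real assume c: "0 < c"
  interpret brownian_motion M B by fact
  have H: "1 / 2 < H1" "H1 < 1" "1 / 2 < H2" "H2 < 1" and q: "1 \<le> q" "1 \<le> q + 1"
    using assms by auto
  define C where "C = cov_const H1 q * cov_const H2 (q + 1)"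
  define V where "V = sqrt (var_const H1 q) * sqrt (var_const H2 (q + 1))"
  have C: "0 < C" using cov_const_pos H q by (simp add: C_def)
  have V: "0 < V" using var_const_pos by (simp add: V_def)
  define b1 b2 where "b1 = 4 * (1 - H1) / real q" and "b2 = 4 * (1 - H2) / real (q + 1)"
  \<comment> \<open>Equality holds for \<open>q = 1\<close>, so the strict gap has to come from the
    second process.\<close>
  have b1: "b1 \<le> 2 * (2 - 2 * H1)"
    using divide_left_mono[of 1 "real q" "4 * (1 - H1)"] H q by (simp add: b1_def)
  have b2: "0 < b2" "b2 < 1" "b2 < 2 * (2 - 2 * H2)"
  proof -
    show "0 < b2" using H by (simp add: b2_def)
    \<comment> \<open>The order \<open>q + 1\<close> is at least 2, which halves the exponent to at
      most \<open>2 - 2 * H2\<close>; this is below 1 because \<open>H2\<close> exceeds 1/2.\<close>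
    have "b2 \<le> 4 * (1 - H2) / 2"
      unfolding b2_def using H q by (intro divide_left_mono) auto
    then show "b2 < 1" "b2 < 2 * (2 - 2 * H2)" using H by auto
  qed
  \<comment> \<open>With this choice \<open>C\<close> and \<open>V\<close> cancel and leave the
    prescribed \<open>c\<close>.\<close>
  have "0 < c * V / C" using c V C by simp
  from decay_sum_product_negligible[OF b1 b2 this] eventually_ge_at_top[of 1]
  show "eventually (\<lambda>N. norm (\<integral>\<omega>. (cross_variation Z1 Z2' (\<gamma> N) N \<omega>)\<^sup>2 \<partial>M) \<le>
      c * norm (qv_deviation M Z1 (\<gamma> N) N * qv_deviation M Z2 (\<gamma> N) N)) sequentially"
  proof eventually_elim
    fix N :: nat
    assume S: "decay_sum N ((2 - 2 * H1) + (2 - 2 * H2)) \<le> c * V / C * sqrt (decay_sum N b1 * decay_sum N b2)" and N: "1 \<le> N"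
    define g where "g = \<gamma> N"
    have g: "0 < g" using assms(4)[OF N] by (simp add: g_def)
    \<comment> \<open>All that depends on the mesh and on the normalization; it is the same factor
      in the upper bound and in the product of the lower bounds.\<close>
    define s where "s = (hermite_const H1 q)\<^sup>2 * (hermite_const H2 (q + 1))\<^sup>2 * g powr (2 * H1) * g powr (2 * H2)"
    have s: "0 \<le> s" by (simp add: s_def)
    have "\<bar>\<integral>\<omega>. (cross_variation Z1 Z2' g N \<omega>)\<^sup>2 \<partial>M\<bar> \<le> s * C * decay_sum N ((2 - 2 * H1) + (2 - 2 * H2))"
      using cross_variation_le[OF assms(6) H(1,2) q(1) assms(7) H(3,4) q(2) assms(8,9) g, of N]
      by (simp add: s_def C_def mult_ac)
    also have "\<dots> \<le> s * C * (c * V / C * sqrt (decay_sum N b1 * decay_sum N b2))"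
      using S s C by (intro mult_left_mono) auto
    also have "\<dots> = c * (((hermite_const H1 q)\<^sup>2 * sqrt (var_const H1 q) * g powr (2 * H1) * sqrt (decay_sum N b1)) *
        ((hermite_const H2 (q + 1))\<^sup>2 * sqrt (var_const H2 (q + 1)) * g powr (2 * H2) * sqrt (decay_sum N b2)))"
      using C by (simp add: s_def V_def real_sqrt_mult mult_ac)
    also have "\<dots> \<le> c * (qv_deviation M Z1 g N * qv_deviation M Z2 g N)"
    proof (intro mult_left_mono mult_mono)
      show "(hermite_const H1 q)\<^sup>2 * sqrt (var_const H1 q) * g powr (2 * H1) * sqrt (decay_sum N b1) \<le> qv_deviation M Z1 g N"
        unfolding b1_def by (rule qv_deviation_ge[OF assms(6) H(1,2) q(1) g])
      show "(hermite_const H2 (q + 1))\<^sup>2 * sqrt (var_const H2 (q + 1)) * g powr (2 * H2) * sqrt (decay_sum N b2) \<le> qv_deviation M Z2 g N"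
        unfolding b2_def by (rule qv_deviation_ge[OF assms(7) H(3,4) q(2) g])
    qed (use c var_const_pos[of H2 "q + 1"] decay_sum_nonneg in \<open>auto simp: qv_deviation_def\<close>)
    also have "\<dots> \<le> c * norm (qv_deviation M Z1 g N * qv_deviation M Z2 g N)"
      using c by (intro mult_left_mono) auto
    finally show "norm (\<integral>\<omega>. (cross_variation Z1 Z2' (\<gamma> N) N \<omega>)\<^sup>2 \<partial>M) \<le>
      c * norm (qv_deviation M Z1 (\<gamma> N) N * qv_deviation M Z2 (\<gamma> N) N)"
      by (simp add: g_def)
  qed
qed

end
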